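(* Let $\mathbb{K}=\mathbb{R}$ or $\mathbb{C}$, and let $\Pi$ be a Poisson structure near $0$ in $\mathbb{K}^{n}$, $n=2l+m$, with a canonical coordinate system $(x_1,y_1,\dots,x_l,y_l,z_1,\dots,z_m)$ near $0$ in which $$\Pi=\sum_{i=1}^l\frac{\partial}{\partial x_i}\wedge\frac{\partial}{\partial y_i}+\frac12\sum_{i,j,k}c_{ij}^kz_k\frac{\partial}{\partial z_i}\wedge\frac{\partial}{\partial z_j},$$ where $c_{ij}^k$ are the structure constants of an $m$-dimensional semisimple Lie algebra $\mathfrak{g}$ over $\mathbb{K}$. Let $H$ be a formal or local analytic function on $(\mathbb{K}^{n},0)$ with $H(0)=0$ whose Hamiltonian vector field $X_H$ with respect to $\Pi$ satisfies $X_H(0)=0$. Then there is a formal canonical coordinate system $(\hat x_i,\hat y_i,\hat z_j)$ of $\Pi$ at $0$ in which $H$ satisfies $$\{H,H_{ss}\}=0,$$ where $H_{ss}$ is a (nonhomogeneous quadratic) function such that its Hamiltonian vector field $X_{H_{ss}}$ is linear and is the semisimple part of the linear part $X_H^{(1)}$ of $X_H$ in this coordinate system. In particular, the semisimple part of the linear part of $X_H$ is a Hamiltonian vector field.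
   Context: A (formal) canonical coordinate system $(\hat x_1,\hat y_1,\dots,\hat x_l,\hat y_l,\hat z_1,\dots,\hat z_m)$ of $\Pi$ at $0$ is a (formal) coordinate system centered at $0$ in which $\Pi=\sum_{i=1}^l\partial_{\hat x_i}\wedge\partial_{\hat y_i}+\frac12\sum_{i,j,k}c_{ij}^k\hat z_k\,\partial_{\hat z_i}\wedge\partial_{\hat z_j}$, with the same constants $c_{ij}^k$. (By theorems of Weinstein and Conn, a formal, resp. analytic, Poisson structure whose transverse structure at $0$ has linear part corresponding to a semisimple Lie algebra always admits a formal, resp. analytic, canonical coordinate system.) $\{\cdot,\cdot\}$ is the Poisson bracket of $\Pi$ and $X_f=\{f,\cdot\}$. The linear part of $X_H$ is its degree-one Taylor part at $0$ in the given coordinates; the semisimple part of a linear vector field is the one given by the Jordan decomposition of the corresponding linear endomorphism. *)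

theory Defs
  imports
    Complex_Main
    "HOL-Library.Multiset"
    "Jordan_Normal_Form.Matrix"
begin

section \<open>The ground field\<close>

text \<open>
  A type of this class is (up to isomorphism) the field of real or the field of complex numbers.
\<close>

class real_or_complex = field_char_0 +
  fixes to_complex :: "'a \<Rightarrow> complex"
  assumes to_complex_one: "to_complex 1 = 1"
    and to_complex_add: "to_complex (a + b) = to_complex a + to_complex b"
    and to_complex_mult: "to_complex (a * b) = to_complex a * to_complex b"
    and range_to_complex: "range to_complex = \<real> \<or> range to_complex = UNIV"

instantiation real :: real_or_complex
begin
definition to_complex_real :: "real \<Rightarrow> complex"
  where "to_complex_real = complex_of_real"
instance
  by standard (simp_all add: to_complex_real_def Reals_def)
end

instantiation complex :: real_or_complex
begin
definition to_complex_complex :: "complex \<Rightarrow> complex"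
  where "to_complex_complex = id"
instance
  by standard (simp_all add: to_complex_complex_def)
end


section \<open>Semisimple Lie algebras\<close>

locale lie_algebra = vector_space scale
  for scale :: "'k::field \<Rightarrow> 'g::ab_group_add \<Rightarrow> 'g" +
  fixes br :: "'g \<Rightarrow> 'g \<Rightarrow> 'g"
  assumes br_add_left: "br (x + y) z = br x z + br y z"
    and br_add_right: "br x (y + z) = br x y + br x z"
    and br_scale_left: "br (scale a x) y = scale a (br x y)"
    and br_scale_right: "br x (scale a y) = scale a (br x y)"
    and br_self: "br x x = 0"
    and jacobi: "br x (br y z) + br y (br z x) + br z (br x y) = 0"
begin

definition lie_ideal :: "'g set \<Rightarrow> bool"
  where "lie_ideal I \<longleftrightarrow> subspace I \<and> (\<forall>x. \<forall>y\<in>I. br x y \<in> I)"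

definition derived_algebra :: "'g set \<Rightarrow> 'g set"
  where "derived_algebra I = span {br x y | x y. x \<in> I \<and> y \<in> I}"

definition solvable :: "'g set \<Rightarrow> bool"
  where "solvable I \<longleftrightarrow> (\<exists>k. (derived_algebra ^^ k) I = {0})"

definition semisimple :: bool
  where "semisimple \<longleftrightarrow> (\<forall>I. lie_ideal I \<and> solvable I \<longrightarrow> I = {0})"

definition structure_constants ::
    "nat \<Rightarrow> (nat \<Rightarrow> 'g) \<Rightarrow> (nat \<Rightarrow> nat \<Rightarrow> nat \<Rightarrow> 'k) \<Rightarrow> bool"
  where "structure_constants m e c \<longleftrightarrow>
    inj_on e {..<m} \<and> independent (e ` {..<m}) \<and> span (e ` {..<m}) = UNIV \<and>
    (\<forall>i<m. \<forall>j<m. br (e i) (e j) = (\<Sum>k<m. scale (c i j k) (e k)))"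

end


section \<open>Formal power series in several variables\<close>

text \<open>
  The variables are numbered by natural numbers. A monomial is encoded as the finite multiset of
  its variables: \<open>w\<^sub>0\<^sup>2 w\<^sub>3\<close> is \<open>{#0, 0, 3#}\<close>, the product of monomials is the sum of multisets and
  the degree is the size. The type comprises series in infinitely many variables; the ring
  \<open>\<bbbK>[[w\<^sub>0, \<dots>, w\<^bsub>n-1\<^esub>]]\<close> is singled out by \<open>formal_functions\<close> below.
\<close>

typedef 'a mfps = "UNIV :: (nat multiset \<Rightarrow> 'a) set"
  morphisms mfps_coeff Abs_mfps
  by simp

lemma mfps_coeff_Abs [simp]: "mfps_coeff (Abs_mfps f) = f"
  by (simp add: Abs_mfps_inverse)

lemma mfps_ext: "(\<And>M. mfps_coeff f M = mfps_coeff g M) \<Longrightarrow> f = g"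
  by (simp add: mfps_coeff_inject[symmetric] fun_eq_iff)

lemma finite_splittings: "finite {(A, B). A + B = (M :: 'a multiset)}"
proof -
  have fin: "finite {A. A \<subseteq># M}"
  proof (induction M)
    case (add x M)
    have "{A. A \<subseteq># add_mset x M} \<subseteq> {A. A \<subseteq># M} \<union> add_mset x ` {A. A \<subseteq># M}"
    proof
      fix A assume A: "A \<in> {A. A \<subseteq># add_mset x M}"
      show "A \<in> {A. A \<subseteq># M} \<union> add_mset x ` {A. A \<subseteq># M}"
      proof (cases "x \<in># A")
        case True
        then obtain B where "A = add_mset x B" by (metis mset_add)
        then show ?thesis using A by auto
      next
        case False
        then show ?thesis using A
          by (metis (no_types, lifting) Un_iff diff_single_trivial mem_Collect_eq
              subset_eq_diff_conv union_mset_add_mset_right add.right_neutral)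
      qed
    qed
    then show ?case using add.IH finite_subset by blast
  qed simp
  have "{(A, B). A + B = M} \<subseteq> (\<lambda>A. (A, M - A)) ` {A. A \<subseteq># M}"
    by auto
  then show ?thesis using fin finite_subset by blast
qed

instantiation mfps :: (comm_ring_1) comm_ring_1
begin

definition zero_mfps :: "'a mfps" where "0 = Abs_mfps (\<lambda>_. 0)"
definition one_mfps :: "'a mfps" where "1 = Abs_mfps (\<lambda>M. if M = {#} then 1 else 0)"
definition plus_mfps :: "'a mfps \<Rightarrow> 'a mfps \<Rightarrow> 'a mfps"
  where "f + g = Abs_mfps (\<lambda>M. mfps_coeff f M + mfps_coeff g M)"
definition minus_mfps :: "'a mfps \<Rightarrow> 'a mfps \<Rightarrow> 'a mfps"
  where "f - g = Abs_mfps (\<lambda>M. mfps_coeff f M - mfps_coeff g M)"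
definition uminus_mfps :: "'a mfps \<Rightarrow> 'a mfps"
  where "- f = Abs_mfps (\<lambda>M. - mfps_coeff f M)"
definition times_mfps :: "'a mfps \<Rightarrow> 'a mfps \<Rightarrow> 'a mfps"
  where "f * g = Abs_mfps (\<lambda>M. \<Sum>(A, B) \<in> {(A, B). A + B = M}. mfps_coeff f A * mfps_coeff g B)"

instance
proof
  fix a b c :: "'a mfps"
  show "a + b + c = a + (b + c)" "a + b = b + a" "0 + a = a" "- a + a = 0" "a - b = a + - b"
    by (simp_all add: plus_mfps_def zero_mfps_def uminus_mfps_def minus_mfps_def algebra_simps
        mfps_coeff_inverse)
  show "(0 :: 'a mfps) \<noteq> 1"
    by (simp add: zero_mfps_def one_mfps_def Abs_mfps_inject fun_eq_iff)
  show "(a + b) * c = a * c + b * c"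
    by (simp add: plus_mfps_def times_mfps_def distrib_right sum.distrib case_prod_unfold)
  show "a * b = b * a"
  proof (rule mfps_ext)
    fix M
    show "mfps_coeff (a * b) M = mfps_coeff (b * a) M"
      unfolding times_mfps_def mfps_coeff_Abs
      by (rule sum.reindex_bij_witness[where i = prod.swap and j = prod.swap])
        (auto simp: add.commute mult.commute)
  qed
  show "1 * a = a"
  proof (rule mfps_ext)
    fix M
    have "mfps_coeff (1 * a) M
        = (\<Sum>(A, B) \<in> {(A, B). A + B = M}. if A = {#} then mfps_coeff a B else 0)"
      by (auto simp: times_mfps_def one_mfps_def intro!: sum.cong)
    also have "\<dots> = (\<Sum>(A :: nat multiset, B) \<in> {({#}, M)}. if A = {#} then mfps_coeff a B else 0)"
      by (rule sum.mono_neutral_right[OF finite_splittings]) (auto split: if_splits)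
    finally show "mfps_coeff (1 * a) M = mfps_coeff a M" by simp
  qed
  show "a * b * c = a * (b * c)"
  proof (rule mfps_ext)
    fix M
    let ?S = "\<lambda>M :: nat multiset. {(A, B). A + B = M}"
    let ?t = "\<lambda>A B C. mfps_coeff a A * mfps_coeff b B * mfps_coeff c C"
    have "mfps_coeff (a * b * c) M
        = (\<Sum>p \<in> ?S M. \<Sum>q \<in> ?S (fst p). ?t (fst q) (snd q) (snd p))"
      by (simp add: times_mfps_def sum_distrib_right case_prod_unfold)
    also have "\<dots> = (\<Sum>(p, q) \<in> (SIGMA p:?S M. ?S (fst p)). ?t (fst q) (snd q) (snd p))"
      by (rule sum.Sigma) (auto simp: finite_splittings)
    also have "\<dots> = (\<Sum>(p, q) \<in> (SIGMA p:?S M. ?S (snd p)). ?t (fst p) (fst q) (snd q))"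
      by (rule sum.reindex_bij_witness[where
            i = "\<lambda>(p, q). ((fst p + fst q, snd q), (fst p, fst q))" and
            j = "\<lambda>(p, q). ((fst q, snd q + snd p), (snd q, snd p))"])
        (auto simp: add.assoc)
    also have "\<dots> = (\<Sum>p \<in> ?S M. \<Sum>q \<in> ?S (snd p). ?t (fst p) (fst q) (snd q))"
      by (rule sum.Sigma[symmetric]) (auto simp: finite_splittings)
    also have "\<dots> = mfps_coeff (a * (b * c)) M"
      by (simp add: times_mfps_def sum_distrib_left case_prod_unfold mult.assoc)
    finally show "mfps_coeff (a * b * c) M = mfps_coeff (a * (b * c)) M" .
  qed
qed

end

definition mfps_const :: "'a::comm_ring_1 \<Rightarrow> 'a mfps"
  where "mfps_const r = Abs_mfps (\<lambda>M. if M = {#} then r else 0)"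

definition mfps_var :: "nat \<Rightarrow> 'a::comm_ring_1 mfps"
  where "mfps_var i = Abs_mfps (\<lambda>M. if M = {#i#} then 1 else 0)"

definition mfps_deriv :: "nat \<Rightarrow> 'a::comm_ring_1 mfps \<Rightarrow> 'a mfps"
  where "mfps_deriv i f =
    Abs_mfps (\<lambda>M. of_nat (count M i + 1) * mfps_coeff f (add_mset i M))"

definition formal_functions :: "nat \<Rightarrow> 'a::comm_ring_1 mfps set"
  where "formal_functions n = {f. \<forall>M. mfps_coeff f M \<noteq> 0 \<longrightarrow> set_mset M \<subseteq> {..<n}}"

text \<open>
  \<open>mfps_compose n F \<phi>\<close> is \<open>F(\<phi>\<^sub>0, \<dots>, \<phi>\<^bsub>n-1\<^esub>)\<close>. It is only meaningful if the \<open>\<phi>\<^sub>i\<close> have no constant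
  term: then monomials of \<open>F\<close> of degree larger than the size of \<open>N\<close> do not contribute to the
  coefficient at \<open>N\<close>.
\<close>

definition mfps_compose :: "nat \<Rightarrow> 'a::comm_ring_1 mfps \<Rightarrow> (nat \<Rightarrow> 'a mfps) \<Rightarrow> 'a mfps"
  where "mfps_compose n F \<phi> = Abs_mfps (\<lambda>N.
    \<Sum>M | set_mset M \<subseteq> {..<n} \<and> size M \<le> size N.
      mfps_coeff F M * mfps_coeff (\<Prod>i\<in>#M. \<phi> i) N)"

definition formal_coordinates :: "nat \<Rightarrow> (nat \<Rightarrow> 'a::comm_ring_1 mfps) \<Rightarrow> bool"
  where "formal_coordinates n \<phi> \<longleftrightarrow>
    (\<forall>i<n. \<phi> i \<in> formal_functions n \<and> mfps_coeff (\<phi> i) {#} = 0) \<and>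
    invertible_mat (mat n n (\<lambda>(i, j). mfps_coeff (\<phi> i) {#j#}))"


section \<open>Formal bivector and vector fields\<close>

text \<open>
  A bivector field \<open>\<Pi> = 1/2 \<Sum> P\<^sub>a\<^sub>b \<partial>\<^sub>a \<and> \<partial>\<^sub>b\<close> is represented by its skew-symmetric coefficient matrix
  \<open>P\<close>, so that \<open>\<partial>\<^sub>a \<and> \<partial>\<^sub>b\<close> has entry \<open>1\<close> at \<open>(a, b)\<close> and \<open>-1\<close> at \<open>(b, a)\<close>. Accordingly
  \<open>{f, g} = \<Sum> P\<^sub>a\<^sub>b \<partial>\<^sub>a f \<partial>\<^sub>b g\<close>; for \<open>\<partial>\<^sub>x \<and> \<partial>\<^sub>y\<close> this gives \<open>{x, y} = 1\<close>.
\<close>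

type_synonym 'a bivector = "nat \<Rightarrow> nat \<Rightarrow> 'a mfps"

definition coord_wedge :: "nat \<Rightarrow> nat \<Rightarrow> 'a::comm_ring_1 bivector"
  where "coord_wedge a b = (\<lambda>p q. of_bool (p = a \<and> q = b) - of_bool (p = b \<and> q = a))"

definition poisson_bracket ::
    "nat \<Rightarrow> 'a::comm_ring_1 bivector \<Rightarrow> 'a mfps \<Rightarrow> 'a mfps \<Rightarrow> 'a mfps"
  where "poisson_bracket n P f g =
    (\<Sum>a<n. \<Sum>b<n. P a b * mfps_deriv a f * mfps_deriv b g)"

text \<open>Vector fields are given by their action on functions: \<open>X\<^sub>f = {f, \<cdot>}\<close>.\<close>

abbreviation hamiltonian_vf ::
    "nat \<Rightarrow> 'a::comm_ring_1 bivector \<Rightarrow> 'a mfps \<Rightarrow> 'a mfps \<Rightarrow> 'a mfps"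
  where "hamiltonian_vf n P f \<equiv> poisson_bracket n P f"

text \<open>
  The coordinates on \<open>\<bbbK>\<^bsup>2l+m\<^esup>\<close> are numbered so that \<open>x\<^sub>i\<close>, \<open>y\<^sub>i\<close>, \<open>z\<^sub>j\<close> are the variables
  \<open>i\<close>, \<open>l + i\<close>, \<open>2l + j\<close> respectively (for \<open>i < l\<close> and \<open>j < m\<close>).
\<close>

definition canonical_bivector ::
    "nat \<Rightarrow> nat \<Rightarrow> (nat \<Rightarrow> nat \<Rightarrow> nat \<Rightarrow> 'a::field) \<Rightarrow> 'a bivector"
  where "canonical_bivector l m c = (\<lambda>p q.
    (\<Sum>i<l. coord_wedge i (l + i) p q) +
    mfps_const (1/2) * (\<Sum>i<m. \<Sum>j<m. \<Sum>k<m.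
      mfps_const (c i j k) * mfps_var (2*l + k) * coord_wedge (2*l + i) (2*l + j) p q))"

text \<open>
  The coefficient at \<open>(a, b)\<close> of a bivector field in a coordinate system \<open>\<phi>\<close> is \<open>{\<phi>\<^sub>a, \<phi>\<^sub>b}\<close>, written
  as a series in \<open>\<phi>\<close>; the \<open>a\<close>-th component of a vector field \<open>X\<close> is \<open>X(\<phi>\<^sub>a)\<close>, written as a series
  in \<open>\<phi>\<close>.
\<close>

definition bivector_in_coordinates ::
    "nat \<Rightarrow> (nat \<Rightarrow> 'a::comm_ring_1 mfps) \<Rightarrow> 'a bivector \<Rightarrow> 'a bivector \<Rightarrow> bool"
  where "bivector_in_coordinates n \<phi> P Q \<longleftrightarrow>
    (\<forall>a<n. \<forall>b<n. Q a b \<in> formal_functions n \<and>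
      poisson_bracket n P (\<phi> a) (\<phi> b) = mfps_compose n (Q a b) \<phi>)"

definition vf_in_coordinates ::
    "nat \<Rightarrow> (nat \<Rightarrow> 'a::comm_ring_1 mfps) \<Rightarrow> ('a mfps \<Rightarrow> 'a mfps) \<Rightarrow> (nat \<Rightarrow> 'a mfps) \<Rightarrow> bool"
  where "vf_in_coordinates n \<phi> X F \<longleftrightarrow>
    (\<forall>a<n. F a \<in> formal_functions n \<and> X (\<phi> a) = mfps_compose n (F a) \<phi>)"

definition canonical_coordinates ::
    "nat \<Rightarrow> nat \<Rightarrow> (nat \<Rightarrow> nat \<Rightarrow> nat \<Rightarrow> 'a::field) \<Rightarrow> 'a bivector \<Rightarrow> (nat \<Rightarrow> 'a mfps) \<Rightarrow> bool"
  where "canonical_coordinates l m c P \<phi> \<longleftrightarrow>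
    formal_coordinates (2*l + m) \<phi> \<and>
    bivector_in_coordinates (2*l + m) \<phi> P (canonical_bivector l m c)"

text \<open>
  The linear vector field with components \<open>\<Sum>\<^sub>b A\<^sub>a\<^sub>b w\<^sub>b\<close>, corresponding to the endomorphism with
  matrix \<open>A\<close>, and conversely the matrix of the linear part of a vector field.
\<close>

definition linear_vf :: "nat \<Rightarrow> 'a::comm_ring_1 mat \<Rightarrow> nat \<Rightarrow> 'a mfps"
  where "linear_vf n A = (\<lambda>a. \<Sum>b<n. mfps_const (A $$ (a, b)) * mfps_var b)"

definition linear_part :: "nat \<Rightarrow> (nat \<Rightarrow> 'a::comm_ring_1 mfps) \<Rightarrow> 'a mat"
  where "linear_part n F = mat n n (\<lambda>(a, b). mfps_coeff (F a) {#b#})"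

definition at_most_quadratic :: "'a::comm_ring_1 mfps \<Rightarrow> bool"
  where "at_most_quadratic Q \<longleftrightarrow> (\<forall>M. mfps_coeff Q M \<noteq> 0 \<longrightarrow> size M \<le> 2)"


section \<open>The Jordan decomposition\<close>

definition semisimple_mat :: "'k::real_or_complex mat \<Rightarrow> bool"
  where "semisimple_mat S \<longleftrightarrow> (\<exists>D. diagonal_mat D \<and> similar_mat (map_mat to_complex S) D)"

definition is_semisimple_part :: "nat \<Rightarrow> 'k::real_or_complex mat \<Rightarrow> 'k mat \<Rightarrow> bool"
  where "is_semisimple_part n A S \<longleftrightarrow>
    S \<in> carrier_mat n n \<and> semisimple_mat S \<and>
    (\<exists>N \<in> carrier_mat n n. (\<exists>k. N ^\<^sub>m k = 0\<^sub>m n n) \<and> S * N = N * S \<and> A = S + N)"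

end

theory Submission
  imports Defs "Jordan_Normal_Form.Jordan_Normal_Form_Existence"
begin

text \<open>
  Give the symplectic coordinates weight 1 and the coordinates on the Lie algebra weight 2. Then the
  Poisson bracket is homogeneous of weight \<open>-2\<close>, the hypotheses say that \<open>H = h + (terms of weight
  \<ge> 3)\<close> with \<open>h\<close> of weight 2, and \<open>{h, \<cdot>}\<close> is a linear vector field. Its semisimple part is a
  derivation of the bracket on linear functions, since generalised eigenspaces multiply like their
  eigenvalues add up. On the symplectic variables this derivation is Hamiltonian by a direct formula; on
  the Lie algebra it is inner, because the Killing form is nondegenerate (Cartan's criterion). This gives
  \<open>h_ss\<close>, still of weight 2. Weight by weight, one removes from \<open>H\<close> the part on which \<open>{h_ss, \<cdot>}\<close>
  does not vanish by a formal canonical transformation: there \<open>{h, \<cdot>}\<close> is invertible. In the resulting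
  coordinates the linear part of \<open>X_H\<close> is \<open>X_h\<close> plus a block that maps the symplectic variables to the
  Lie algebra and commutes with the semisimple part, so its semisimple part is that of \<open>h_ss\<close>.
\<close>

section \<open>Formal power series and vector fields\<close>

text \<open>Measured by ordinary degree, the bracket of two symplectic variables loses 2 and that of
  two Lie algebra variables loses 1; the weights equalise the losses and make an induction possible.
  The price comes at the end: \<open>x z\<close> has weight 3, yet \<open>{x z, y} = z\<close> is
  linear, so the linear part of the field sees more than the terms of weight 2. The other obstacle
  is the ground field. Eigenvalues live in the complex numbers, while the coordinates must have
  coefficients in the ground field. The linear algebra is therefore done after complexification and
  brought back: the semisimple part because it is invariant under conjugation, solutions of linear
  equations by a linear retraction. One functional calculus on generalised eigenspaces serves twice:
  the identity function gives the semisimple part, complex conjugation gives the operator that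
  detects nilpotency in Cartan's criterion. The canonical transformation is handled only through the
  coefficients of its powers of \<open>t\<close>, each a finite expression in brackets.\<close>

lemma mfps_coeff_zero [simp]: "mfps_coeff 0 M = 0"
  by (simp add: zero_mfps_def)

lemma mfps_coeff_one: "mfps_coeff 1 M = (if M = {#} then 1 else 0)"
  by (simp add: one_mfps_def)

lemma mfps_coeff_add [simp]: "mfps_coeff (f + g) M = mfps_coeff f M + mfps_coeff g M"
  by (simp add: plus_mfps_def)

lemma mfps_coeff_minus [simp]: "mfps_coeff (f - g) M = mfps_coeff f M - mfps_coeff g M"
  by (simp add: minus_mfps_def)

lemma mfps_coeff_uminus [simp]: "mfps_coeff (- f) M = - mfps_coeff f M"
  by (simp add: uminus_mfps_def)

lemma mfps_coeff_times:
  "mfps_coeff (f * g) M = (\<Sum>(A, B)\<in>{(A, B). A + B = M}. mfps_coeff f A * mfps_coeff g B)"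
  by (simp add: times_mfps_def)

lemma mfps_coeff_sum [simp]: "mfps_coeff (\<Sum>x\<in>A. f x) M = (\<Sum>x\<in>A. mfps_coeff (f x) M)"
  by (induction A rule: infinite_finite_induct) auto

lemma mfps_coeff_const: "mfps_coeff (mfps_const r) M = (if M = {#} then r else 0)"
  by (simp add: mfps_const_def)

lemma mfps_coeff_var: "mfps_coeff (mfps_var i) M = (if M = {#i#} then 1 else 0)"
  by (simp add: mfps_var_def)

lemma mfps_coeff_deriv:
  "mfps_coeff (mfps_deriv i f) M = of_nat (count M i + 1) * mfps_coeff f (add_mset i M)"
  by (simp add: mfps_deriv_def)

lemma mfps_coeff_const_mult [simp]: "mfps_coeff (mfps_const r * f) M = r * mfps_coeff f M"
proof -
  have "mfps_coeff (mfps_const r * f) M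
      = (\<Sum>(A, B) \<in> {(A, B). A + B = M}. if A = {#} then r * mfps_coeff f B else 0)"
    by (auto simp: mfps_coeff_times mfps_coeff_const intro!: sum.cong)
  also have "\<dots> = (\<Sum>(A :: nat multiset, B) \<in> {({#}, M)}. if A = {#} then r * mfps_coeff f B else 0)"
    by (rule sum.mono_neutral_right[OF finite_splittings]) (auto split: if_splits)
  finally show ?thesis by simp
qed

lemma mfps_coeff_empty_times [simp]:
  "mfps_coeff (f * g) {#} = mfps_coeff f {#} * mfps_coeff g {#}"
proof -
  have "{(A, B). A + B = ({#} :: nat multiset)} = {({#}, {#})}" by auto
  then show ?thesis by (simp add: mfps_coeff_times)
qed

lemma mfps_const_simps:
  "mfps_const (r + s) = mfps_const r + mfps_const s"
  "mfps_const (r - s) = mfps_const r - mfps_const s"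
  "mfps_const (- r) = - mfps_const r"
  "mfps_const (r * s) = mfps_const r * mfps_const s"
  "mfps_const 0 = 0" "mfps_const 1 = 1"
  by (rule mfps_ext; simp add: mfps_coeff_const mfps_coeff_one)+

lemma mfps_const_sum: "mfps_const (\<Sum>x\<in>A. f x) = (\<Sum>x\<in>A. mfps_const (f x))"
  by (induction A rule: infinite_finite_induct) (auto simp: mfps_const_simps)

lemma mfps_deriv_add [simp]: "mfps_deriv i (f + g) = mfps_deriv i f + mfps_deriv i g"
  by (rule mfps_ext) (simp add: mfps_coeff_deriv algebra_simps)

lemma mfps_deriv_const_mult [simp]:
  "mfps_deriv i (mfps_const r * f) = mfps_const r * mfps_deriv i f"
  by (rule mfps_ext) (simp only: mfps_coeff_deriv mfps_coeff_const_mult mult.left_commute)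

lemma mfps_deriv_const [simp]: "mfps_deriv i (mfps_const r) = 0"
  by (rule mfps_ext) (simp add: mfps_coeff_deriv mfps_coeff_const)

lemma mfps_deriv_zero [simp]: "mfps_deriv i 0 = 0"
  by (rule mfps_ext) (simp add: mfps_coeff_deriv)

lemma mfps_deriv_var [simp]: "mfps_deriv i (mfps_var j) = (if i = j then 1 else 0)"
  by (rule mfps_ext) (auto simp: mfps_coeff_deriv mfps_coeff_var mfps_coeff_one)

lemma mfps_deriv_commute: "mfps_deriv i (mfps_deriv j f) = mfps_deriv j (mfps_deriv i f)"
  by (rule mfps_ext) (auto simp: mfps_coeff_deriv add_mset_commute algebra_simps)

lemma mfps_deriv_times:
  "mfps_deriv i (f * g) = mfps_deriv i f * g + f * mfps_deriv i g"
proof (rule mfps_ext)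
  fix M
  let ?S = "\<lambda>M :: nat multiset. {(A, B). A + B = M}"
  have shift: "(\<Sum>(A, B)\<in>?S (add_mset i M). of_nat (count A i) * mfps_coeff f A * mfps_coeff g B)
      = mfps_coeff (mfps_deriv i f * g) M" for f g :: "'a mfps"
  proof -
    let ?h = "\<lambda>(A, B). (add_mset i A, B :: nat multiset)"
    have "(\<Sum>(A, B)\<in>?S (add_mset i M). of_nat (count A i) * mfps_coeff f A * mfps_coeff g B)
        = (\<Sum>(A, B)\<in>?h ` ?S M. of_nat (count A i) * mfps_coeff f A * mfps_coeff g B)"
    proof (rule sum.mono_neutral_right[OF finite_splittings])
      show "\<forall>p\<in>?S (add_mset i M) - ?h ` ?S M.
          (case p of (A, B) \<Rightarrow> of_nat (count A i) * mfps_coeff f A * mfps_coeff g B) = 0"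
      proof (clarify, rule ccontr)
        fix A B
        assume AB: "A + B = add_mset i M" and n: "(A, B) \<notin> ?h ` ?S M"
          and nz: "of_nat (count A i) * mfps_coeff f A * mfps_coeff g B \<noteq> 0"
        have "i \<in># A"
        proof (rule ccontr)
          assume "i \<notin># A"
          then have "count A i = 0" by (simp add: not_in_iff)
          with nz show False by simp
        qed
        then obtain A' where A': "A = add_mset i A'" by (metis mset_add)
        with AB have "A' + B = M" by simp
        then have "(A, B) \<in> ?h ` ?S M" using A' by force
        with n show False by simp
      qed
    qed auto
    also have "\<dots> = (\<Sum>(A, B)\<in>?S M. of_nat (count A i + 1) * mfps_coeff f (add_mset i A) * mfps_coeff g B)"
      by (subst sum.reindex) (auto simp: inj_on_def case_prod_unfold)
    finally show ?thesis by (simp add: mfps_coeff_times mfps_coeff_deriv)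
  qed
  have "mfps_coeff (mfps_deriv i (f * g)) M
      = (\<Sum>(A, B)\<in>?S (add_mset i M). of_nat (count M i + 1) * (mfps_coeff f A * mfps_coeff g B))"
    by (simp add: mfps_coeff_deriv mfps_coeff_times sum_distrib_left case_prod_unfold)
  also have "\<dots> = (\<Sum>(A, B)\<in>?S (add_mset i M). of_nat (count A i) * mfps_coeff f A * mfps_coeff g B
      + of_nat (count B i) * mfps_coeff g B * mfps_coeff f A)"
  proof (rule sum.cong[OF refl], clarify)
    fix A B assume "A + B = add_mset i M"
    then have "count (A + B) i = count M i + 1" by simp
    then have "of_nat (count M i + 1) = (of_nat (count A i) + of_nat (count B i) :: 'a)"
      by (metis count_union of_nat_add)
    then show "of_nat (count M i + 1) * (mfps_coeff f A * mfps_coeff g B)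
        = of_nat (count A i) * mfps_coeff f A * mfps_coeff g B
          + of_nat (count B i) * mfps_coeff g B * mfps_coeff f A"
      by (simp add: algebra_simps)
  qed
  also have "\<dots> = (\<Sum>(A, B)\<in>?S (add_mset i M). of_nat (count A i) * mfps_coeff f A * mfps_coeff g B)
      + (\<Sum>(A, B)\<in>?S (add_mset i M). of_nat (count B i) * mfps_coeff g B * mfps_coeff f A)"
    by (simp add: case_prod_unfold sum.distrib)
  also have "(\<Sum>(A, B)\<in>?S (add_mset i M). of_nat (count B i) * mfps_coeff g B * mfps_coeff f A)
      = (\<Sum>(A, B)\<in>?S (add_mset i M). of_nat (count A i) * mfps_coeff g A * mfps_coeff f B)"
    by (rule sum.reindex_bij_witness[where i = prod.swap and j = prod.swap]) (auto simp: add.commute)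
  finally show "mfps_coeff (mfps_deriv i (f * g)) M
      = mfps_coeff (mfps_deriv i f * g + f * mfps_deriv i g) M"
    unfolding shift by (simp add: mult.commute)
qed

lemma mfps_deriv_minus [simp]: "mfps_deriv i (f - g) = mfps_deriv i f - mfps_deriv i g"
  by (rule mfps_ext) (simp add: mfps_coeff_deriv algebra_simps)

lemma mfps_deriv_sum [simp]: "mfps_deriv i (\<Sum>x\<in>A. f x) = (\<Sum>x\<in>A. mfps_deriv i (f x))"
  by (induction A rule: infinite_finite_induct) auto

lemma formal_functions_zero [simp, intro]: "0 \<in> formal_functions n"
  by (simp add: formal_functions_def)

lemma formal_functions_const [simp, intro]: "mfps_const r \<in> formal_functions n"
  by (simp add: formal_functions_def mfps_coeff_const)

lemma formal_functions_one [simp, intro]: "1 \<in> formal_functions n"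
  by (metis formal_functions_const mfps_const_simps(6))

lemma formal_functions_var [intro]: "i < n \<Longrightarrow> mfps_var i \<in> formal_functions n"
  by (simp add: formal_functions_def mfps_coeff_var)

lemma formal_functions_add [intro]:
  "f \<in> formal_functions n \<Longrightarrow> g \<in> formal_functions n \<Longrightarrow> f + g \<in> formal_functions n"
  by (auto simp: formal_functions_def) (metis add.right_neutral in_mono lessThan_iff)

lemma formal_functions_uminus [intro]: "f \<in> formal_functions n \<Longrightarrow> - f \<in> formal_functions n"
  by (auto simp: formal_functions_def)

lemma formal_functions_minus [intro]:
  "f \<in> formal_functions n \<Longrightarrow> g \<in> formal_functions n \<Longrightarrow> f - g \<in> formal_functions n"
  using formal_functions_add[of f n "- g"] formal_functions_uminus[of g n] by simp

lemma formal_functions_sum [intro]: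
  "(\<And>x. x \<in> A \<Longrightarrow> f x \<in> formal_functions n) \<Longrightarrow> (\<Sum>x\<in>A. f x) \<in> formal_functions n"
  by (induction A rule: infinite_finite_induct) auto

lemma formal_functions_times [intro]:
  assumes "f \<in> formal_functions n" "g \<in> formal_functions n"
  shows "f * g \<in> formal_functions n"
  unfolding formal_functions_def
proof (intro CollectI allI impI)
  fix M assume "mfps_coeff (f * g) M \<noteq> 0"
  then obtain A B where AB: "A + B = M" "mfps_coeff f A * mfps_coeff g B \<noteq> 0"
    unfolding mfps_coeff_times by (auto elim!: sum.not_neutral_contains_not_neutral)
  then have "mfps_coeff f A \<noteq> 0" "mfps_coeff g B \<noteq> 0" by auto
  then have "set_mset A \<subseteq> {..<n}" "set_mset B \<subseteq> {..<n}"
    using assms unfolding formal_functions_def by blast+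
  then show "set_mset M \<subseteq> {..<n}" by (simp flip: AB(1))
qed

lemma formal_functions_deriv [intro]:
  assumes "f \<in> formal_functions n"
  shows "mfps_deriv i f \<in> formal_functions n"
  unfolding formal_functions_def
proof (intro CollectI allI impI)
  fix M assume "mfps_coeff (mfps_deriv i f) M \<noteq> 0"
  then have "mfps_coeff f (add_mset i M) \<noteq> 0" by (auto simp: mfps_coeff_deriv)
  with assms have "set_mset (add_mset i M) \<subseteq> {..<n}" unfolding formal_functions_def by blast
  then show "set_mset M \<subseteq> {..<n}" by simp
qed

section \<open>Vector fields as derivations of the power series ring\<close>

definition vf_apply :: "nat \<Rightarrow> (nat \<Rightarrow> 'a::comm_ring_1 mfps) \<Rightarrow> 'a mfps \<Rightarrow> 'a mfps"
  where "vf_apply n F f = (\<Sum>a<n. F a * mfps_deriv a f)"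

lemma vf_apply_var [simp]: "a < n \<Longrightarrow> vf_apply n F (mfps_var a) = F a"
  by (simp add: vf_apply_def if_distrib cong: if_cong)

lemma vf_apply_cong: "(\<And>a. a < n \<Longrightarrow> F a = G a) \<Longrightarrow> vf_apply n F f = vf_apply n G f"
  by (simp add: vf_apply_def)

lemma vf_apply_add [simp]: "vf_apply n F (f + g) = vf_apply n F f + vf_apply n F g"
  by (simp add: vf_apply_def algebra_simps sum.distrib)

lemma vf_apply_zero [simp]: "vf_apply n F 0 = 0"
  by (simp add: vf_apply_def)

lemma vf_apply_const [simp]: "vf_apply n F (mfps_const r) = 0"
  by (simp add: vf_apply_def)

lemma vf_apply_const_mult [simp]:
  "vf_apply n F (mfps_const r * f) = mfps_const r * vf_apply n F f"
  unfolding vf_apply_def sum_distrib_left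
  by (intro sum.cong refl) (simp add: mult.left_commute)

lemma vf_apply_minus [simp]: "vf_apply n F (f - g) = vf_apply n F f - vf_apply n F g"
  by (simp add: vf_apply_def algebra_simps sum_subtractf)

lemma vf_apply_uminus [simp]: "vf_apply n F (- g) = - vf_apply n F g"
  using vf_apply_minus[of n F 0 g] by simp

lemma vf_apply_sum [simp]: "vf_apply n F (\<Sum>x\<in>A. f x) = (\<Sum>x\<in>A. vf_apply n F (f x))"
  by (induction A rule: infinite_finite_induct) auto

lemma vf_apply_times: "vf_apply n F (f * g) = vf_apply n F f * g + f * vf_apply n F g"
  by (simp add: vf_apply_def mfps_deriv_times algebra_simps sum.distrib sum_distrib_left)

lemma vf_apply_fields_minus: "vf_apply n (\<lambda>a. F a - G a) f = vf_apply n F f - vf_apply n G f"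
  by (simp add: vf_apply_def algebra_simps sum_subtractf)

text \<open>The second-order terms of the two compositions agree because partial derivatives
  commute, so a first-order operator remains.\<close>

lemma vf_apply_commutator:
  "vf_apply n F (vf_apply n G f) - vf_apply n G (vf_apply n F f)
    = vf_apply n (\<lambda>a. vf_apply n F (G a) - vf_apply n G (F a)) f"
proof -
  have *: "vf_apply n F (vf_apply n G f) = vf_apply n (\<lambda>a. vf_apply n F (G a)) f
      + (\<Sum>a<n. \<Sum>b<n. F a * (G b * mfps_deriv a (mfps_deriv b f)))" for F G
  proof -
    have "vf_apply n F (vf_apply n G f)
        = (\<Sum>b<n. vf_apply n F (G b) * mfps_deriv b f)
          + (\<Sum>b<n. G b * vf_apply n F (mfps_deriv b f))"
      by (simp add: vf_apply_def[of n G] vf_apply_times sum.distrib)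
    also have "(\<Sum>b<n. G b * vf_apply n F (mfps_deriv b f))
        = (\<Sum>a<n. \<Sum>b<n. F a * (G b * mfps_deriv a (mfps_deriv b f)))"
      unfolding vf_apply_def sum_distrib_left by (subst sum.swap) (simp add: mult_ac)
    finally show ?thesis by (simp add: vf_apply_def)
  qed
  have "(\<Sum>a<n. \<Sum>b<n. F a * (G b * mfps_deriv a (mfps_deriv b f)))
      = (\<Sum>a<n. \<Sum>b<n. G a * (F b * mfps_deriv a (mfps_deriv b f)))"
    by (subst sum.swap) (simp add: mult_ac mfps_deriv_commute)
  then show ?thesis
    unfolding *[of F G] *[of G F] vf_apply_fields_minus by simp
qed

lemma formal_functions_vf_apply [intro]:
  "(\<And>a. a < n \<Longrightarrow> F a \<in> formal_functions n) \<Longrightarrow> f \<in> formal_functions n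
    \<Longrightarrow> vf_apply n F f \<in> formal_functions n"
  unfolding vf_apply_def by blast

section \<open>Poisson brackets\<close>

lemma poisson_bracket_var_right:
  "b < n \<Longrightarrow> poisson_bracket n P f (mfps_var b) = (\<Sum>a<n. P a b * mfps_deriv a f)"
  by (simp add: poisson_bracket_def if_distrib cong: if_cong)

text \<open>Every property of the right argument of the bracket is inherited from vector fields
  through this identity; skewness then transfers it to the left argument.\<close>

lemma poisson_bracket_vf:
  "poisson_bracket n P f g = vf_apply n (\<lambda>b. poisson_bracket n P f (mfps_var b)) g"
proof -
  have "vf_apply n (\<lambda>b. poisson_bracket n P f (mfps_var b)) g
      = (\<Sum>b<n. (\<Sum>a<n. P a b * mfps_deriv a f) * mfps_deriv b g)"
    unfolding vf_apply_def by (rule sum.cong) (auto simp: poisson_bracket_var_right)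
  also have "\<dots> = poisson_bracket n P f g"
    unfolding poisson_bracket_def sum_distrib_right by (rule sum.swap)
  finally show ?thesis by simp
qed

lemma poisson_bracket_var_var:
  "a < n \<Longrightarrow> b < n \<Longrightarrow> poisson_bracket n P (mfps_var a) (mfps_var b) = P a b"
  by (simp add: poisson_bracket_var_right if_distrib cong: if_cong)

lemma formal_functions_bracket [intro]:
  "(\<And>a b. a < n \<Longrightarrow> b < n \<Longrightarrow> P a b \<in> formal_functions n) \<Longrightarrow> f \<in> formal_functions n
    \<Longrightarrow> g \<in> formal_functions n \<Longrightarrow> poisson_bracket n P f g \<in> formal_functions n"
  unfolding poisson_bracket_def by blast

locale poisson_structure =
  fixes n :: nat and P :: "'a::comm_ring_1 bivector"
  assumes skew: "P a b = - P b a"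
    and jacobi_coordinates: "a < n \<Longrightarrow> b < n \<Longrightarrow> c < n \<Longrightarrow>
      poisson_bracket n P (mfps_var a) (P b c) + poisson_bracket n P (mfps_var b) (P c a)
      + poisson_bracket n P (mfps_var c) (P a b) = 0"
begin

abbreviation pb :: "'a mfps \<Rightarrow> 'a mfps \<Rightarrow> 'a mfps"
  where "pb \<equiv> poisson_bracket n P"

lemma pb_skew: "pb f g = - pb g f"
proof -
  have "pb f g = (\<Sum>b<n. \<Sum>a<n. P a b * mfps_deriv a f * mfps_deriv b g)"
    unfolding poisson_bracket_def by (rule sum.swap)
  also have "\<dots> = (\<Sum>b<n. \<Sum>a<n. - (P b a * mfps_deriv b g * mfps_deriv a f))"
    by (intro sum.cong refl, subst skew) (simp add: mult_ac)
  finally show ?thesis by (simp add: poisson_bracket_def sum_negf)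
qed

lemma pb_add_right [simp]: "pb f (g + h) = pb f g + pb f h"
  by (subst (1 2 3) poisson_bracket_vf) simp
lemma pb_minus_right [simp]: "pb f (g - h) = pb f g - pb f h"
  by (subst (1 2 3) poisson_bracket_vf) simp
lemma pb_uminus_right [simp]: "pb f (- h) = - pb f h"
  by (subst (1 2) poisson_bracket_vf) simp
lemma pb_sum_right [simp]: "pb f (\<Sum>x\<in>A. g x) = (\<Sum>x\<in>A. pb f (g x))"
  by (subst (1 2) poisson_bracket_vf) simp
lemma pb_zero_right [simp]: "pb f 0 = 0"
  by (simp add: poisson_bracket_def)
lemma pb_const_right [simp]: "pb f (mfps_const r) = 0"
  by (simp add: poisson_bracket_def)
lemma pb_const_mult_right [simp]: "pb f (mfps_const r * g) = mfps_const r * pb f g"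
  by (subst (1 2) poisson_bracket_vf) simp
lemma pb_times_right: "pb f (g * h) = pb f g * h + g * pb f h"
  by (subst (1 2 3) poisson_bracket_vf) (rule vf_apply_times)
lemma pb_add_left [simp]: "pb (f + g) h = pb f h + pb g h"
  by (simp add: pb_skew[of _ h])
lemma pb_minus_left [simp]: "pb (f - g) h = pb f h - pb g h"
  by (simp add: pb_skew[of _ h])
lemma pb_uminus_left [simp]: "pb (- g) h = - pb g h"
  by (simp add: pb_skew[of _ h])
lemma pb_sum_left [simp]: "pb (\<Sum>x\<in>A. g x) h = (\<Sum>x\<in>A. pb (g x) h)"
  by (simp add: pb_skew[of _ h] sum_negf)
lemma pb_zero_left [simp]: "pb 0 g = 0"
  by (simp add: poisson_bracket_def)
lemma pb_const_left [simp]: "pb (mfps_const r) g = 0"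
  by (simp add: poisson_bracket_def)
lemma pb_const_mult_left [simp]: "pb (mfps_const r * g) h = mfps_const r * pb g h"
  by (simp add: pb_skew[of _ h])
lemma pb_times_left: "pb (f * g) h = pb f h * g + f * pb g h"
  by (simp add: pb_skew[of _ h] pb_times_right)

text \<open>The Jacobiator is a derivation in its last argument, because the commutator of two vector
  fields is a vector field, and it is cyclically symmetric; so it suffices to know that it vanishes
  on coordinates.\<close>

lemma pb_jacobi: "pb f (pb g h) = pb (pb f g) h + pb g (pb f h)"
proof -
  define J where "J = (\<lambda>f g h. pb f (pb g h) - pb g (pb f h) - pb (pb f g) h)"
  have cyc: "J f g h = J g h f" for f g h
  proof -
    have "pb g (pb h f) = - pb g (pb f h)"
      by (subst pb_skew[of h f]) simp
    moreover have "pb h (pb g f) = pb (pb f g) h"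
      using pb_skew[of h "pb f g"] by (subst pb_skew[of g f]) simp
    moreover have "pb (pb g h) f = - pb f (pb g h)"
      by (rule pb_skew)
    ultimately show ?thesis unfolding J_def by simp
  qed
  have vf: "J f g h = vf_apply n (\<lambda>a. J f g (mfps_var a)) h" for f g h
  proof -
    let ?F = "\<lambda>f b. pb f (mfps_var b)"
    have 1: "pb f h = vf_apply n (?F f) h" for f h by (rule poisson_bracket_vf)
    have "J f g h = vf_apply n (?F f) (vf_apply n (?F g) h) - vf_apply n (?F g) (vf_apply n (?F f) h)
        - vf_apply n (?F (pb f g)) h"
      unfolding J_def 1[symmetric] by simp
    also have "\<dots> = vf_apply n (\<lambda>a. vf_apply n (?F f) (?F g a) - vf_apply n (?F g) (?F f a)
        - ?F (pb f g) a) h"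
      by (simp only: vf_apply_commutator vf_apply_fields_minus)
    also have "\<dots> = vf_apply n (\<lambda>a. J f g (mfps_var a)) h"
      unfolding J_def 1[symmetric] by simp
    finally show ?thesis .
  qed
  have "J (mfps_var a) (mfps_var b) (mfps_var c) = 0" if "a < n" "b < n" "c < n" for a b c
    using jacobi_coordinates[OF that] that
      pb_skew[of "mfps_var c" "P a b"] skew[of c a]
    unfolding J_def by (simp add: poisson_bracket_var_var)
  then have "J (mfps_var a) (mfps_var b) h = 0" if "a < n" "b < n" for a b h
    using that by (subst vf) (simp add: vf_apply_def)
  then have "J (mfps_var b) h k = 0" if "b < n" for b h k
    using that by (subst vf, subst cyc[symmetric]) (simp add: vf_apply_def)
  then have "J h k q = 0" for h k q
    by (subst vf, subst cyc[symmetric]) (simp add: vf_apply_def)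
  from this[of f g h] show ?thesis unfolding J_def by (simp add: algebra_simps)
qed

end

section \<open>Weights\<close>

definition wt :: "(nat \<Rightarrow> nat) \<Rightarrow> nat multiset \<Rightarrow> nat"
  where "wt w M = (\<Sum>i\<in>#M. w i)"

lemma wt_simps [simp]: "wt w {#} = 0" "wt w (add_mset i M) = w i + wt w M"
    "wt w (M + N) = wt w M + wt w N"
  by (simp_all add: wt_def)

lemma wt_const_one [simp]: "wt (\<lambda>_. 1) M = size M" "wt (\<lambda>_. Suc 0) M = size M"
  by (induction M) auto

text \<open>Positive weights bound the degree, so in finitely many variables only finitely many
  monomials have a given weight.\<close>

lemma size_le_wt: "(\<And>i. 1 \<le> w i) \<Longrightarrow> size M \<le> wt w M"
proof (induction M)
  case (add i M)
  then show ?case using add.prems[of i] by (simp add: add_mono[of 1 "w i", simplified])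
qed simp

definition wt_proj :: "(nat \<Rightarrow> nat) \<Rightarrow> nat \<Rightarrow> 'a::comm_ring_1 mfps \<Rightarrow> 'a mfps"
  where "wt_proj w k f = Abs_mfps (\<lambda>M. if wt w M = k then mfps_coeff f M else 0)"

definition homog :: "(nat \<Rightarrow> nat) \<Rightarrow> nat \<Rightarrow> 'a::comm_ring_1 mfps \<Rightarrow> bool"
  where "homog w k f \<longleftrightarrow> (\<forall>M. mfps_coeff f M \<noteq> 0 \<longrightarrow> wt w M = k)"

lemma mfps_coeff_wt_proj: "mfps_coeff (wt_proj w k f) M = (if wt w M = k then mfps_coeff f M else 0)"
  by (simp add: wt_proj_def)

lemma wt_proj_simps [simp]:
  "wt_proj w k (f + g) = wt_proj w k f + wt_proj w k g"
  "wt_proj w k (f - g) = wt_proj w k f - wt_proj w k g"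
  "wt_proj w k (- f) = - wt_proj w k f"
  "wt_proj w k (mfps_const r * f) = mfps_const r * wt_proj w k f"
  "wt_proj w k 0 = 0"
  by (rule mfps_ext; simp add: mfps_coeff_wt_proj)+

lemma wt_proj_sum [simp]: "wt_proj w k (\<Sum>x\<in>A. f x) = (\<Sum>x\<in>A. wt_proj w k (f x))"
  by (induction A rule: infinite_finite_induct) auto

lemma wt_proj_eqI: "(\<And>k. wt_proj w k f = wt_proj w k g) \<Longrightarrow> f = g"
  by (rule mfps_ext) (metis mfps_coeff_wt_proj)

lemma homog_wt_proj [simp, intro]: "homog w k (wt_proj w k f)"
  by (simp add: homog_def mfps_coeff_wt_proj)

lemma wt_proj_homog: "homog w j f \<Longrightarrow> wt_proj w k f = (if k = j then f else 0)"
  by (rule mfps_ext) (auto simp: homog_def mfps_coeff_wt_proj)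

lemma homog_zero [simp, intro]: "homog w k 0"
  by (simp add: homog_def)

lemma homog_const [simp, intro]: "homog w 0 (mfps_const r)"
  by (simp add: homog_def mfps_coeff_const)

lemma homog_var [intro]: "homog w (w i) (mfps_var i)"
  by (simp add: homog_def mfps_coeff_var)

lemma homog_add [intro]: "homog w k f \<Longrightarrow> homog w k g \<Longrightarrow> homog w k (f + g)"
  unfolding homog_def by (metis add.right_neutral mfps_coeff_add)

lemma homog_uminus [intro]: "homog w k f \<Longrightarrow> homog w k (- f)"
  by (simp add: homog_def)

lemma homog_minus [intro]: "homog w k f \<Longrightarrow> homog w k g \<Longrightarrow> homog w k (f - g)"
  using homog_add[of w k f "- g"] by auto

lemma homog_sum [intro]: "(\<And>x. x \<in> A \<Longrightarrow> homog w k (f x)) \<Longrightarrow> homog w k (\<Sum>x\<in>A. f x)"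
  by (induction A rule: infinite_finite_induct) auto

lemma homog_const_mult [intro]: "homog w k f \<Longrightarrow> homog w k (mfps_const r * f)"
  unfolding homog_def by (metis mfps_coeff_const_mult mult_zero_right)

lemma homog_times [intro]:
  assumes "homog w j f" "homog w k g"
  shows "homog w (j + k) (f * g)"
  unfolding homog_def
proof (intro allI impI)
  fix M assume "mfps_coeff (f * g) M \<noteq> 0"
  then obtain A B where "A + B = M" "mfps_coeff f A * mfps_coeff g B \<noteq> 0"
    unfolding mfps_coeff_times by (auto elim!: sum.not_neutral_contains_not_neutral)
  moreover from this(2) have "mfps_coeff f A \<noteq> 0" "mfps_coeff g B \<noteq> 0" by auto
  then have "wt w A = j" "wt w B = k" using assms unfolding homog_def by auto
  ultimately show "wt w M = j + k" by auto
qed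

lemma homog_deriv: "homog w (k + w a) f \<Longrightarrow> homog w k (mfps_deriv a f)"
  unfolding homog_def mfps_coeff_deriv
  by (metis add.commute add_left_imp_eq mult_zero_right wt_simps(2))

lemma formal_functions_wt_proj [intro]:
  "f \<in> formal_functions n \<Longrightarrow> wt_proj w k f \<in> formal_functions n"
  by (simp add: formal_functions_def mfps_coeff_wt_proj)

lemma wt_proj_deriv: "wt_proj w k (mfps_deriv a f) = mfps_deriv a (wt_proj w (k + w a) f)"
  by (rule mfps_ext) (auto simp: mfps_coeff_wt_proj mfps_coeff_deriv)

lemma mfps_deriv_wt_proj_eq_0: "k < w a \<Longrightarrow> mfps_deriv a (wt_proj w k f) = 0"
  by (rule mfps_ext) (auto simp: mfps_coeff_wt_proj mfps_coeff_deriv)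

lemma wt_proj_times: "wt_proj w k (f * g) = (\<Sum>p\<le>k. wt_proj w p f * wt_proj w (k - p) g)"
proof (rule mfps_ext)
  fix M :: "nat multiset"
  let ?S = "{(A, B). A + B = M}"
  have "mfps_coeff (\<Sum>p\<le>k. wt_proj w p f * wt_proj w (k - p) g) M
      = (\<Sum>(A, B)\<in>?S. \<Sum>p\<le>k. (if wt w A = p \<and> wt w B = k - p then mfps_coeff f A * mfps_coeff g B else 0))"
    unfolding mfps_coeff_sum mfps_coeff_times case_prod_unfold
    by (subst sum.swap) (auto simp: mfps_coeff_wt_proj intro!: sum.cong)
  also have "\<dots> = (\<Sum>(A, B)\<in>?S. if wt w M = k then mfps_coeff f A * mfps_coeff g B else 0)"
  proof (rule sum.cong[OF refl], clarify)
    fix A B assume M: "M = A + B"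
    have "(\<Sum>p\<le>k. (if wt w A = p \<and> wt w B = k - p then mfps_coeff f A * mfps_coeff g B else 0))
        = (\<Sum>p\<le>k. (if wt w A = p then if wt w (A + B) = k then mfps_coeff f A * mfps_coeff g B else 0 else 0))"
      by (rule sum.cong) auto
    also have "\<dots> = (if wt w (A + B) = k then mfps_coeff f A * mfps_coeff g B else 0)"
      by auto
    finally show "(\<Sum>p\<le>k. (if wt w A = p \<and> wt w B = k - p then mfps_coeff f A * mfps_coeff g B else 0))
        = (if wt w (A + B) = k then mfps_coeff f A * mfps_coeff g B else 0)" .
  qed
  also have "\<dots> = mfps_coeff (wt_proj w k (f * g)) M"
    by (simp add: mfps_coeff_wt_proj mfps_coeff_times)
  finally show "mfps_coeff (wt_proj w k (f * g)) M
      = mfps_coeff (\<Sum>p\<le>k. wt_proj w p f * wt_proj w (k - p) g) M" by simp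
qed

lemma wt_proj_homog_times:
  assumes "homog w j h"
  shows "wt_proj w k (h * f) = (if j \<le> k then h * wt_proj w (k - j) f else 0)"
proof -
  have "wt_proj w k (h * f) = (\<Sum>p\<le>k. if p = j then h * wt_proj w (k - p) f else 0)"
    unfolding wt_proj_times by (rule sum.cong) (auto simp: wt_proj_homog[OF assms])
  then show ?thesis by auto
qed

text \<open>Since \<open>mfps_deriv a\<close> lowers the weight by \<open>w a\<close>, a field
  raises weights by \<open>d\<close> exactly if its component \<open>a\<close> has weight
  \<open>d + w a\<close>.\<close>

lemma wt_proj_vf_apply:
  assumes "\<And>a. a < n \<Longrightarrow> homog w (d + w a) (F a)"
  shows "wt_proj w (k + d) (vf_apply n F f) = vf_apply n F (wt_proj w k f)"
  unfolding vf_apply_def wt_proj_sum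
proof (rule sum.cong[OF refl])
  fix a assume "a \<in> {..<n}"
  then have "homog w (d + w a) (F a)" using assms by auto
  from wt_proj_homog_times[OF this, of "k + d"]
  show "wt_proj w (k + d) (F a * mfps_deriv a f) = F a * mfps_deriv a (wt_proj w k f)"
    by (auto simp: wt_proj_deriv mfps_deriv_wt_proj_eq_0)
qed

text \<open>The entry \<open>P a b\<close> makes up for the two derivatives except for a uniform
  loss of 2; hence the weights of the two arguments add up to \<open>k + 2\<close>. As weights are
  at least 1, the subtraction in \<open>w a + w b - 2\<close> is not truncated.\<close>

lemma wt_proj_bracket:
  assumes w: "\<And>a. 1 \<le> w a" and P: "\<And>a b. a < n \<Longrightarrow> b < n \<Longrightarrow> homog w (w a + w b - 2) (P a b)"
  shows "wt_proj w k (poisson_bracket n P f g)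
    = (\<Sum>p\<le>k + 2. poisson_bracket n P (wt_proj w p f) (wt_proj w (k + 2 - p) g))"
proof -
  have "wt_proj w k (P a b * mfps_deriv a f * mfps_deriv b g)
      = (\<Sum>p\<le>k + 2. P a b * mfps_deriv a (wt_proj w p f) * mfps_deriv b (wt_proj w (k + 2 - p) g))"
    (is "_ = sum ?t _") if ab: "a < n" "b < n" for a b
  proof -
    have w2: "w a + w b \<ge> 2" using w[of a] w[of b] by simp
    \<comment> \<open>A derivative annihilates the parts of too small a weight. These vanishing
      terms extend the range obtained from the product rule for weights to the full range up to
      \<open>k + 2\<close>.\<close>
    have zero: "?t p = 0" if "p < w a \<or> k + 2 - p < w b" for p
      using that by (auto simp: mfps_deriv_wt_proj_eq_0)
    show ?thesis
    proof (cases "w a + w b - 2 \<le> k")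
      case True
      define e where "e = k - (w a + w b - 2)"
      have "wt_proj w k (P a b * (mfps_deriv a f * mfps_deriv b g))
          = P a b * wt_proj w e (mfps_deriv a f * mfps_deriv b g)"
        using wt_proj_homog_times[OF P[OF ab]] True by (simp add: e_def)
      also have "\<dots> = (\<Sum>q\<le>e. P a b * mfps_deriv a (wt_proj w (q + w a) f)
          * mfps_deriv b (wt_proj w (e - q + w b) g))"
        by (simp add: wt_proj_times wt_proj_deriv sum_distrib_left mult.assoc)
      also have "\<dots> = (\<Sum>p\<in>{w a..e + w a}. ?t p)"
        by (rule sum.reindex_bij_witness[where i = "\<lambda>p. p - w a" and j = "\<lambda>q. q + w a"])
          (use True w2 in \<open>auto simp: e_def algebra_simps\<close>)
      also have "\<dots> = (\<Sum>p\<le>k + 2. ?t p)"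
      proof (rule sum.mono_neutral_left)
        show "\<forall>p\<in>{..k + 2} - {w a..e + w a}. ?t p = 0"
        proof
          fix p assume "p \<in> {..k + 2} - {w a..e + w a}"
          with True w2 have "p < w a \<or> k + 2 - p < w b" by (auto simp: e_def)
          then show "?t p = 0" by (rule zero)
        qed
      qed (use True w2 in \<open>auto simp: e_def\<close>)
      finally show ?thesis by (simp add: mult.assoc)
    next
      case False
      then have "wt_proj w k (P a b * (mfps_deriv a f * mfps_deriv b g)) = 0"
        using wt_proj_homog_times[OF P[OF ab]] by simp
      moreover have "sum ?t {..k + 2} = 0"
      proof (rule sum.neutral, intro ballI)
        fix p assume "p \<in> {..k + 2}"
        with False w2 have "p < w a \<or> k + 2 - p < w b" by auto
        then show "?t p = 0" by (rule zero)
      qed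
      ultimately show ?thesis by (simp add: mult.assoc)
    qed
  qed
  then have "wt_proj w k (poisson_bracket n P f g) = (\<Sum>a<n. \<Sum>b<n. \<Sum>p\<le>k + 2.
      P a b * mfps_deriv a (wt_proj w p f) * mfps_deriv b (wt_proj w (k + 2 - p) g))"
    by (simp add: poisson_bracket_def)
  also have "\<dots> = (\<Sum>a<n. \<Sum>p\<le>k + 2. \<Sum>b<n.
      P a b * mfps_deriv a (wt_proj w p f) * mfps_deriv b (wt_proj w (k + 2 - p) g))"
    by (intro sum.cong refl sum.swap)
  also have "\<dots> = (\<Sum>p\<le>k + 2. \<Sum>a<n. \<Sum>b<n.
      P a b * mfps_deriv a (wt_proj w p f) * mfps_deriv b (wt_proj w (k + 2 - p) g))"
    by (rule sum.swap)
  finally show ?thesis by (simp add: poisson_bracket_def)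
qed

section \<open>Monomials and linear forms\<close>

lemma mfps_coeff_mono: "mfps_coeff (\<Prod>i\<in>#M. mfps_var i) N = (if N = M then 1 else 0 :: 'a::comm_ring_1)"
proof (induction M arbitrary: N)
  case empty
  then show ?case by (simp add: mfps_coeff_one)
next
  case (add i M)
  have "mfps_coeff (mfps_var i * (\<Prod>i\<in>#M. mfps_var i) :: 'a mfps) N
     = (\<Sum>p\<in>{(A, B). A + B = N}. if p = ({#i#}, M) then 1 else 0)"
    unfolding mfps_coeff_times by (rule sum.cong) (auto simp: add.IH mfps_coeff_var split: if_splits)
  also have "\<dots> = (if N = add_mset i M then 1 else 0)"
    using finite_splittings[of N] by (auto simp: sum.delta)
  finally show ?case by simp
qed

lemma finite_multisets_bounded: "finite A \<Longrightarrow> finite {M. set_mset M \<subseteq> A \<and> size M \<le> k}"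
proof (induction k)
  case 0
  have "{M. set_mset M \<subseteq> A \<and> size M \<le> 0} \<subseteq> {{#}}" by auto
  then show ?case by (rule finite_subset) simp
next
  case (Suc k)
  let ?S = "{M. set_mset M \<subseteq> A \<and> size M \<le> k}"
  have "{M. set_mset M \<subseteq> A \<and> size M \<le> Suc k} \<subseteq> insert {#} (\<Union>a\<in>A. add_mset a ` ?S)"
  proof
    fix M assume "M \<in> {M. set_mset M \<subseteq> A \<and> size M \<le> Suc k}"
    then show "M \<in> insert {#} (\<Union>a\<in>A. add_mset a ` ?S)"
      by (cases M) auto
  qed
  then show ?case by (rule finite_subset) (use Suc in auto)
qed

lemma mfps_monomial_expansion:
  assumes "finite S" "\<And>M. mfps_coeff f M \<noteq> 0 \<Longrightarrow> M \<in> S"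
  shows "f = (\<Sum>M\<in>S. mfps_const (mfps_coeff f M) * (\<Prod>i\<in>#M. mfps_var i))"
proof (rule mfps_ext)
  fix N
  show "mfps_coeff f N = mfps_coeff (\<Sum>M\<in>S. mfps_const (mfps_coeff f M) * (\<Prod>i\<in>#M. mfps_var i)) N"
    using assms by (auto simp: mfps_coeff_mono if_distrib sum.delta' cong: if_cong)
qed

definition lin :: "nat \<Rightarrow> (nat \<Rightarrow> 'a::comm_ring_1) \<Rightarrow> 'a mfps"
  where "lin n u = (\<Sum>a<n. mfps_const (u a) * mfps_var a)"

lemma mfps_coeff_lin:
  "mfps_coeff (lin n u) M = (\<Sum>a<n. if M = {#a#} then u a else 0)"
  by (simp add: lin_def mfps_coeff_var if_distrib cong: if_cong)

lemma mfps_coeff_lin_single [simp]: "a < n \<Longrightarrow> mfps_coeff (lin n u) {#a#} = u a"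
  by (simp add: mfps_coeff_lin)

lemma formal_functions_lin [simp, intro]: "lin n u \<in> formal_functions n"
  by (auto simp: lin_def)

lemma homog_lin_degree [simp, intro]: "homog (\<lambda>_. 1) 1 (lin n u)"
  unfolding lin_def by (intro homog_sum homog_const_mult) (rule homog_var)

lemma lin_cong: "(\<And>a. a < n \<Longrightarrow> u a = v a) \<Longrightarrow> lin n u = lin n v"
  by (simp add: lin_def)

lemma lin_add: "lin n (\<lambda>a. u a + v a) = lin n u + lin n v"
  by (simp add: lin_def mfps_const_simps algebra_simps sum.distrib)

lemma lin_minus: "lin n (\<lambda>a. u a - v a) = lin n u - lin n v"
  by (simp add: lin_def mfps_const_simps algebra_simps sum_subtractf)

lemma lin_const_mult: "lin n (\<lambda>a. r * u a) = mfps_const r * lin n u"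
  by (simp add: lin_def mfps_const_simps sum_distrib_left mult.assoc)

lemma lin_sum: "lin n (\<lambda>a. \<Sum>x\<in>X. u x a) = (\<Sum>x\<in>X. lin n (u x))"
  unfolding lin_def mfps_const_sum sum_distrib_right by (rule sum.swap)

lemma lin_unit: "a < n \<Longrightarrow> lin n (\<lambda>b. if b = a then 1 else 0) = mfps_var a"
  by (simp add: lin_def if_distrib[of mfps_const] mfps_const_simps if_distrib[of "\<lambda>x. x * _"] cong: if_cong)

lemma lin_inject: "lin n u = lin n v \<longleftrightarrow> (\<forall>a<n. u a = v a)"
  by (metis lin_cong mfps_coeff_lin_single)

lemma degree_one_eq_lin:
  assumes "f \<in> formal_functions n"
  shows "wt_proj (\<lambda>_. 1) 1 f = lin n (\<lambda>a. mfps_coeff f {#a#})"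
proof (rule mfps_ext)
  fix M :: "nat multiset"
  consider (s) a where "M = {#a#}" | (n) "size M \<noteq> 1" using size_1_singleton_mset by blast
  then show "mfps_coeff (wt_proj (\<lambda>_. 1) 1 f) M = mfps_coeff (lin n (\<lambda>a. mfps_coeff f {#a#})) M"
  proof cases
    case s
    then show ?thesis using assms
      by (auto simp: mfps_coeff_wt_proj mfps_coeff_lin formal_functions_def)
  next
    case n
    then show ?thesis by (auto simp: mfps_coeff_wt_proj mfps_coeff_lin intro!: sum.neutral)
  qed
qed

lemma vf_apply_lin: "vf_apply n F (lin n u) = (\<Sum>a<n. mfps_const (u a) * F a)"
  by (simp add: lin_def)

section \<open>Linear vector fields\<close>

definition linear_op :: "nat \<Rightarrow> (nat \<Rightarrow> nat \<Rightarrow> 'a::comm_ring_1) \<Rightarrow> 'a mfps \<Rightarrow> 'a mfps"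
  where "linear_op n A = vf_apply n (\<lambda>a. lin n (A a))"

lemma linear_op_var [simp]: "a < n \<Longrightarrow> linear_op n A (mfps_var a) = lin n (A a)"
  by (simp add: linear_op_def)

lemma linear_op_lin: "linear_op n A (lin n u) = lin n (\<lambda>b. \<Sum>a<n. u a * A a b)"
  by (simp add: linear_op_def vf_apply_lin lin_sum lin_const_mult)

lemma linear_op_simps [simp]:
  "linear_op n A (f + g) = linear_op n A f + linear_op n A g"
  "linear_op n A (f - g) = linear_op n A f - linear_op n A g"
  "linear_op n A (mfps_const r * f) = mfps_const r * linear_op n A f"
  "linear_op n A (mfps_const r) = 0"
  "linear_op n A 0 = 0"
  "linear_op n A (- f) = - linear_op n A f"
  by (simp_all add: linear_op_def)

lemma linear_op_sum [simp]: "linear_op n A (\<Sum>x\<in>X. f x) = (\<Sum>x\<in>X. linear_op n A (f x))"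
  by (simp add: linear_op_def)

lemma linear_op_times: "linear_op n A (f * g) = linear_op n A f * g + f * linear_op n A g"
  by (simp add: linear_op_def vf_apply_times)

lemma wt_proj_linear_op_degree:
  "wt_proj (\<lambda>_. 1) k (linear_op n A f) = linear_op n A (wt_proj (\<lambda>_. 1) k f)"
  using wt_proj_vf_apply[of n "\<lambda>_. 1" 0 "\<lambda>a. lin n (A a)" k f] homog_lin_degree
  unfolding linear_op_def by auto

lemma formal_functions_linear_op [intro]:
  "f \<in> formal_functions n \<Longrightarrow> linear_op n A f \<in> formal_functions n"
  by (auto simp: linear_op_def)

section \<open>Generalised eigenvectors\<close>

text \<open>Inductive form of \<open>(L - r)^k f = 0\<close> for some \<open>k\<close>: each
  \<open>step\<close> is one more factor. Proofs go along the chain and need neither exponents nor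
  finite dimension.\<close>

inductive gen_eigen :: "('a::comm_ring_1 mfps \<Rightarrow> 'a mfps) \<Rightarrow> 'a \<Rightarrow> 'a mfps \<Rightarrow> bool" for L r where
  zero: "gen_eigen L r 0"
| step: "gen_eigen L r (L f - mfps_const r * f) \<Longrightarrow> gen_eigen L r f"

text \<open>A map intertwining \<open>L - r\<close> with \<open>L' - s\<close> carries the whole
  chain down to zero. It is applied to scalings, to projections onto a degree or weight, and to
  complex conjugation, where \<open>s\<close> is the conjugate of \<open>r\<close>.\<close>

lemma gen_eigen_intertwine:
  assumes "gen_eigen L r f" and T0: "T 0 = 0"
    and T: "\<And>f. T (L f - mfps_const r * f) = L' (T f) - mfps_const s * T f"
  shows "gen_eigen L' s (T f)"
  using assms(1) by induction (auto simp: T0 T intro: gen_eigen.intros)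

text \<open>The chains of \<open>f\<close> and \<open>g\<close> may differ in length. The induction
  follows that of \<open>f\<close>, while \<open>g\<close> is replaced by its image under
  \<open>L - r\<close>, which is again a generalised eigenvector.\<close>

lemma gen_eigen_add:
  assumes L: "\<And>f g. L (f + g) = L f + L g" and "gen_eigen L r f" "gen_eigen L r g"
  shows "gen_eigen L r (f + g)"
proof -
  have L0: "L 0 = 0" using L[of 0 0] by simp
  have step: "gen_eigen L r (L g - mfps_const r * g)" if "gen_eigen L r g" for g
    using that by cases (auto simp: L0 intro: gen_eigen.intros)
  show ?thesis
    using assms(2,3)
  proof (induction arbitrary: g)
    case zero
    then show ?case by simp
  next
    case (step f)
    from step.IH[OF \<open>\<And>g. gen_eigen L r g \<Longrightarrow> gen_eigen L r (L g - mfps_const r * g)\<close>[OF step.prems]]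
    have "gen_eigen L r (L (f + g) - mfps_const r * (f + g))"
      by (simp add: L algebra_simps)
    then show ?case by (rule gen_eigen.step)
  qed
qed

lemma gen_eigen_sum:
  assumes L: "\<And>f g. L (f + g) = L f + L g" and "\<And>x. x \<in> X \<Longrightarrow> gen_eigen L r (f x)"
  shows "gen_eigen L r (\<Sum>x\<in>X. f x)"
  using assms(2)
  by (induction X rule: infinite_finite_induct) (auto intro: gen_eigen.zero gen_eigen_add[of L, OF L])

lemma gen_eigen_const_mult:
  assumes L: "\<And>r f. L (mfps_const r * f) = mfps_const r * L f" and "gen_eigen L r f"
  shows "gen_eigen L r (mfps_const s * f)"
  using assms(2) by (rule gen_eigen_intertwine) (simp_all add: L right_diff_distrib mult.left_commute)

text \<open>A common frame for the product and the Poisson bracket, so that eigenvalue arguments and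
  the formal transformation treat both at once.\<close>

definition mfps_bilinear :: "('a::comm_ring_1 mfps \<Rightarrow> 'a mfps \<Rightarrow> 'a mfps) \<Rightarrow> bool"
  where "mfps_bilinear B \<longleftrightarrow>
    (\<forall>f g h. B (f + g) h = B f h + B g h \<and> B h (f + g) = B h f + B h g) \<and>
    (\<forall>r f g. B (mfps_const r * f) g = mfps_const r * B f g \<and>
      B f (mfps_const r * g) = mfps_const r * B f g)"

lemma mfps_bilinearD:
  assumes "mfps_bilinear B"
  shows "B (f + g) h = B f h + B g h" "B h (f + g) = B h f + B h g"
    "B (mfps_const r * f) h = mfps_const r * B f h" "B h (mfps_const r * f) = mfps_const r * B h f"
    "B 0 h = 0" "B h 0 = 0"
  using assms add_cancel_right_right[of "B 0 h" "B 0 h"] add_cancel_right_right[of "B h 0" "B h 0"]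
  unfolding mfps_bilinear_def by (auto, (metis add.right_neutral add_cancel_right_right)+)

lemma mfps_bilinear_sum:
  assumes "mfps_bilinear B"
  shows "B (\<Sum>x\<in>X. f x) h = (\<Sum>x\<in>X. B (f x) h)" "B h (\<Sum>x\<in>X. f x) = (\<Sum>x\<in>X. B h (f x))"
  by (induction X rule: infinite_finite_induct; simp add: mfps_bilinearD[OF assms])+

text \<open>By the Leibniz rule \<open>L - (r + s)\<close> sends \<open>B f g\<close> to
  \<open>B ((L - r) f) g + B f ((L - s) g)\<close>; in each summand one of the two chains has become
  shorter.\<close>

lemma gen_eigen_bilinear:
  assumes L: "\<And>f g. L (f + g) = L f + L g"
    and B: "mfps_bilinear B"
    and der: "\<And>f g. L (B f g) = B (L f) g + B f (L g)"
    and "gen_eigen L r f" "gen_eigen L s g"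
  shows "gen_eigen L (r + s) (B f g)"
proof -
  note B = mfps_bilinearD[OF B]
  have Bm: "B (f - g) h = B f h - B g h" "B h (f - g) = B h f - B h g" for f g h
    using B(1)[of "f - g" g h] B(2)[of h "f - g" g] by simp_all
  show ?thesis
    using assms(4,5)
  proof (induction arbitrary: g)
    case zero
    then show ?case by (simp add: B gen_eigen.zero)
  next
    case (step f)
    note IH = step.IH
    from step.prems show ?case
    proof induction
      case zero
      then show ?case by (simp add: B gen_eigen.zero)
    next
      case (step g)
      have "gen_eigen L (r + s) (B (L f - mfps_const r * f) g + B f (L g - mfps_const s * g))"
        by (intro gen_eigen_add[of L, OF L] IH step.IH gen_eigen.step[OF step.hyps])
      also have "B (L f - mfps_const r * f) g + B f (L g - mfps_const s * g)
          = L (B f g) - mfps_const (r + s) * B f g"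
        by (simp add: der Bm B mfps_const_simps distrib_right)
      finally show ?case by (rule gen_eigen.step)
    qed
  qed
qed

lemma gen_eigen_0_nilpotent:
  assumes "gen_eigen L 0 f" "L 0 = 0"
  shows "\<exists>k. (L ^^ k) f = 0"
  using assms(1)
proof induction
  case zero
  show ?case by (rule exI[of _ 0]) simp
next
  case (step f)
  then obtain k where "(L ^^ k) (L f) = 0" by (auto simp: mfps_const_simps)
  then show ?case by (intro exI[of _ "Suc k"]) (simp add: funpow_swap1)
qed

text \<open>On a generalised eigenspace for a nonzero eigenvalue \<open>L\<close> is invertible, and the preimage is
  a polynomial in \<open>L\<close> applied to the vector; so it inherits any property that is stable under \<open>L\<close>.\<close>

lemma gen_eigen_in_image:
  fixes L :: "'a::field mfps \<Rightarrow> 'a mfps"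
  assumes "gen_eigen L r f" "r \<noteq> 0" "f \<in> V"
    and L: "\<And>f g. L (f - g) = L f - L g" "\<And>r f. L (mfps_const r * f) = mfps_const r * L f"
    and V: "\<And>f g. f \<in> V \<Longrightarrow> g \<in> V \<Longrightarrow> f - g \<in> V" "\<And>r f. f \<in> V \<Longrightarrow> mfps_const r * f \<in> V"
      "\<And>f. f \<in> V \<Longrightarrow> L f \<in> V"
  shows "\<exists>g\<in>V. L g = f"
  using assms(1,3)
proof induction
  case zero
  then show ?case using L(1)[of 0 0] by (intro bexI[of _ 0]) auto
next
  case (step f)
  have "L f - mfps_const r * f \<in> V" using step.prems V by auto
  with step.IH obtain g where g: "g \<in> V" "L g = L f - mfps_const r * f" by auto
  \<comment> \<open>From \<open>L g = (L - r) f\<close> it follows that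
    \<open>L (f - g) = r f\<close>.\<close>
  have "L (mfps_const (1 / r) * (f - g)) = (mfps_const (1 / r) * mfps_const r) * f"
    by (simp add: L g mult.assoc)
  also have "\<dots> = f"
    using \<open>r \<noteq> 0\<close> by (simp add: mfps_const_simps(6) flip: mfps_const_simps(4))
  finally show ?case using step.prems g V by (intro bexI[of _ "mfps_const (1 / r) * (f - g)"]) auto
qed

section \<open>Functional calculus for linear vector fields\<close>

text \<open>All that is used of a Jordan matrix: it is upper triangular and its nonzero entries join
  indices with the same eigenvalue.\<close>

lemma jordan_matrix_entry_nonzero:
  assumes "i < sum_list (map fst xs)" "j < sum_list (map fst xs)" "jordan_matrix xs $$ (i, j) \<noteq> 0"
  shows "i \<le> j \<and> jordan_matrix xs $$ (i, i) = jordan_matrix xs $$ (j, j)"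
  using assms
proof (induction xs arbitrary: i j)
  case (Cons x xs)
  obtain k a where x: "x = (k, a)" by (cases x)
  let ?N = "sum_list (map fst xs)"
  have entry: "jordan_matrix (x # xs) $$ (i, j) = (if i < k \<and> j < k then jordan_block k a $$ (i, j)
      else if k \<le> i \<and> k \<le> j then jordan_matrix xs $$ (i - k, j - k) else 0)"
    if "i < k + ?N" "j < k + ?N" for i j
  proof -
    have "jordan_matrix (x # xs) $$ (i, j) = (if i < k then if j < k then jordan_block k a $$ (i, j)
        else 0\<^sub>m k ?N $$ (i, j - k) else if j < k then 0\<^sub>m ?N k $$ (i - k, j)
        else jordan_matrix xs $$ (i - k, j - k))"
      unfolding x jordan_matrix_Cons using that by (subst index_mat_four_block) simp_all
    moreover have "i - k < ?N" if "\<not> i < k" using that \<open>i < k + ?N\<close> by linarith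
    moreover have "j - k < ?N" if "\<not> j < k" using that \<open>j < k + ?N\<close> by linarith
    ultimately show ?thesis by (cases "i < k"; cases "j < k") simp_all
  qed
  have ij: "i < k + ?N" "j < k + ?N" using Cons.prems by (simp_all add: x)
  consider "i < k" "j < k" | "k \<le> i" "k \<le> j"
    using Cons.prems(3) unfolding entry[OF ij] by (auto split: if_splits)
  then show ?case
  proof cases
    case 1
    then show ?thesis using Cons.prems(3) ij by (simp add: entry split: if_splits)
  next
    case 2
    then have "i - k < ?N" "j - k < ?N" using ij by linarith+
    moreover have "jordan_matrix xs $$ (i - k, j - k) \<noteq> 0"
      using Cons.prems(3) 2 unfolding entry[OF ij] by auto
    ultimately have "i - k \<le> j - k
        \<and> jordan_matrix xs $$ (i - k, i - k) = jordan_matrix xs $$ (j - k, j - k)"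
      by (rule Cons.IH)
    then show ?thesis using 2 entry[OF ij(1) ij(1)] entry[OF ij(2) ij(2)] by auto
  qed
qed simp

text \<open>A linear vector field acts on the coefficient vectors of linear forms by the transpose of its
  matrix \<open>A\<close>: the columns of \<open>P\<close> are the coefficients of a Jordan basis of linear forms.\<close>

locale jordan_basis =
  fixes n :: nat and A P Q J :: "nat \<Rightarrow> nat \<Rightarrow> complex"
  assumes PQ: "a < n \<Longrightarrow> b < n \<Longrightarrow> (\<Sum>i<n. P a i * Q i b) = (if a = b then 1 else 0)"
    and QP: "i < n \<Longrightarrow> j < n \<Longrightarrow> (\<Sum>a<n. Q i a * P a j) = (if i = j then 1 else 0)"
    and AP: "a < n \<Longrightarrow> i < n \<Longrightarrow> (\<Sum>b<n. A b a * P b i) = (\<Sum>k<n. P a k * J k i)"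
    and J: "k < n \<Longrightarrow> i < n \<Longrightarrow> J k i \<noteq> 0 \<Longrightarrow> k \<le> i \<and> J k k = J i i"

lemma jordan_basis_exists:
  fixes A :: "nat \<Rightarrow> nat \<Rightarrow> complex"
  obtains P Q J where "jordan_basis n A P Q J"
proof -
  define B where "B = mat n n (\<lambda>(i, j). A j i)"
  have B: "B \<in> carrier_mat n n" by (simp add: B_def)
  obtain as where "char_poly B = (\<Prod>a\<leftarrow>as. [:- a, 1:])"
    using char_poly_factorized[OF B] by auto
  from jordan_nf_exists[OF B this] obtain xs where "jordan_nf B xs" ..
  then have "similar_mat B (jordan_matrix xs)" by (simp add: jordan_nf_def)
  from similar_matD[OF this] obtain n' P Q
    where *: "{B, jordan_matrix xs, P, Q} \<subseteq> carrier_mat n' n'" "P * Q = 1\<^sub>m n'" "Q * P = 1\<^sub>m n'"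
      "B = P * jordan_matrix xs * Q" by blast
  from * B have n': "n' = n" by auto
  define J where "J = jordan_matrix xs"
  have c: "J \<in> carrier_mat n n" "P \<in> carrier_mat n n" "Q \<in> carrier_mat n n"
    using * by (auto simp: n' J_def)
  have PQ: "P * Q = 1\<^sub>m n" and QP: "Q * P = 1\<^sub>m n" using * by (auto simp: n')
  have "B * P = P * J * (Q * P)"
    unfolding *(4) J_def[symmetric] using c by (simp add: assoc_mult_mat[of _ n n _ n _ n])
  then have BP: "B * P = P * J" using c QP by simp
  have len: "sum_list (map fst xs) = n" using c unfolding J_def by auto
  have prod: "(M * N) $$ (a, b) = (\<Sum>i<n. M $$ (a, i) * N $$ (i, b))"
    if "M \<in> carrier_mat n n" "N \<in> carrier_mat n n" "a < n" "b < n" for M N :: "complex mat" and a b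
    using that by (auto simp: scalar_prod_def lessThan_atLeast0)
  have "jordan_basis n A (\<lambda>a i. P $$ (a, i)) (\<lambda>i a. Q $$ (i, a)) (\<lambda>k i. J $$ (k, i))"
  proof
    fix a b assume ab: "a < n" "b < n"
    show "(\<Sum>i<n. P $$ (a, i) * Q $$ (i, b)) = (if a = b then 1 else 0)"
      "(\<Sum>i<n. Q $$ (a, i) * P $$ (i, b)) = (if a = b then 1 else 0)"
      using prod[OF c(2,3) ab] prod[OF c(3,2) ab] PQ QP ab by auto
    show "(\<Sum>i<n. A i a * P $$ (i, b)) = (\<Sum>k<n. P $$ (a, k) * J $$ (k, b))"
      using prod[OF B c(2) ab] prod[OF c(2,1) ab] BP ab by (simp add: B_def)
    show "a \<le> b \<and> J $$ (a, a) = J $$ (b, b)" if "J $$ (a, b) \<noteq> 0"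
      using jordan_matrix_entry_nonzero[of a xs b] ab that by (simp add: len J_def)
  qed
  then show ?thesis by (rule that)
qed

context jordan_basis
begin

abbreviation v :: "nat \<Rightarrow> complex mfps" where "v i \<equiv> lin n (\<lambda>a. P a i)"
abbreviation L :: "complex mfps \<Rightarrow> complex mfps" where "L \<equiv> linear_op n A"

lemma lin_in_basis: "lin n u = (\<Sum>i<n. mfps_const (\<Sum>a<n. Q i a * u a) * v i)"
proof -
  have "(\<Sum>i<n. (\<Sum>b<n. Q i b * u b) * P a i) = u a" if "a < n" for a
  proof -
    have "(\<Sum>i<n. (\<Sum>b<n. Q i b * u b) * P a i) = (\<Sum>b<n. u b * (\<Sum>i<n. P a i * Q i b))"
      unfolding sum_distrib_left sum_distrib_right by (subst sum.swap) (simp add: mult_ac)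
    also have "\<dots> = u a" using that by (simp add: PQ if_distrib cong: if_cong)
    finally show ?thesis .
  qed
  then have "lin n u = lin n (\<lambda>a. \<Sum>i<n. (\<Sum>b<n. Q i b * u b) * P a i)"
    by (intro lin_cong) simp
  then show ?thesis by (simp add: lin_sum lin_const_mult)
qed

lemma basis_coefficients_unique:
  assumes "(\<Sum>i<n. mfps_const (c i) * v i) = (\<Sum>i<n. mfps_const (d i) * v i)" "j < n"
  shows "c j = d j"
proof -
  have *: "(\<Sum>a<n. Q j a * mfps_coeff (\<Sum>i<n. mfps_const (c i) * v i) {#a#}) = c j" for c
  proof -
    have "(\<Sum>a<n. Q j a * mfps_coeff (\<Sum>i<n. mfps_const (c i) * v i) {#a#})
        = (\<Sum>i<n. c i * (\<Sum>a<n. Q j a * P a i))"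
      by (simp add: sum_distrib_left) (subst sum.swap, simp add: mult_ac)
    also have "\<dots> = c j" using \<open>j < n\<close> by (simp add: QP if_distrib cong: if_cong)
    finally show ?thesis .
  qed
  show ?thesis using *[of c] *[of d] assms(1) by simp
qed

lemma L_basis: "i < n \<Longrightarrow> L (v i) = (\<Sum>k<n. mfps_const (J k i) * v k)"
proof -
  assume "i < n"
  then have "L (v i) = lin n (\<lambda>b. \<Sum>k<n. J k i * P b k)"
    unfolding linear_op_lin using AP by (intro lin_cong) (simp add: mult_ac)
  then show ?thesis by (simp add: lin_sum lin_const_mult)
qed

text \<open>\<open>fc f\<close> is the matrix of the linear vector field that acts as \<open>f \<lambda>\<close> on the generalised
  eigenspace of \<open>L\<close> for the eigenvalue \<open>\<lambda>\<close>; for \<open>f = id\<close> it is the semisimple part.\<close>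

definition fc :: "(complex \<Rightarrow> complex) \<Rightarrow> nat \<Rightarrow> nat \<Rightarrow> complex"
  where "fc f = (\<lambda>a b. \<Sum>i<n. Q i a * f (J i i) * P b i)"

lemma fc_basis: "i < n \<Longrightarrow> linear_op n (fc f) (v i) = mfps_const (f (J i i)) * v i"
proof -
  assume i: "i < n"
  have "(\<Sum>a<n. P a i * fc f a b) = f (J i i) * P b i" for b
  proof -
    have "(\<Sum>a<n. P a i * fc f a b) = (\<Sum>j<n. f (J j j) * P b j * (\<Sum>a<n. Q j a * P a i))"
      unfolding fc_def sum_distrib_left by (subst sum.swap) (simp add: mult_ac)
    also have "\<dots> = f (J i i) * P b i" using i by (simp add: QP if_distrib cong: if_cong)
    finally show ?thesis .
  qed
  then show ?thesis by (simp add: linear_op_lin lin_const_mult)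
qed

text \<open>\<open>L - J i i\<close> maps \<open>v i\<close> to a combination of earlier basis
  vectors with the same eigenvalue, to which the induction hypothesis applies.\<close>

lemma gen_eigen_basis: "i < n \<Longrightarrow> gen_eigen L (J i i) (v i)"
proof (induction i rule: less_induct)
  case (less i)
  have "L (v i) - mfps_const (J i i) * v i
      = (\<Sum>k<n. mfps_const (J k i) * v k) - (\<Sum>k<n. mfps_const (if k = i then J i i else 0) * v k)"
    using less.prems by (simp add: L_basis if_distrib[of mfps_const] mfps_const_simps
        if_distrib[of "\<lambda>x. x * _"] cong: if_cong)
  also have "\<dots> = (\<Sum>k<n. mfps_const (J k i - (if k = i then J i i else 0)) * v k)"
    by (simp add: mfps_const_simps algebra_simps sum_subtractf)
  also have "gen_eigen L (J i i) \<dots>"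
  proof (rule gen_eigen_sum)
    fix k assume k: "k \<in> {..<n}"
    show "gen_eigen L (J i i) (mfps_const (J k i - (if k = i then J i i else 0)) * v k)"
    proof (cases "k = i \<or> J k i = 0")
      case True
      then have "J k i - (if k = i then J i i else 0) = 0" by auto
      then show ?thesis by (simp add: mfps_const_simps gen_eigen.zero)
    next
      case False
      with J[of k i] k less.prems have "k < i" "J k k = J i i" by auto
      with less.IH[of k] k have "gen_eigen L (J i i) (v k)" by auto
      then show ?thesis by (intro gen_eigen_const_mult) auto
    qed
  qed simp
  finally show ?case by (rule gen_eigen.step)
qed

text \<open>If \<open>k\<close> is the largest index with a wrong eigenvalue and a nonzero
  coefficient, triangularity leaves \<open>c k * (J k k - r)\<close> as the coefficient of
  \<open>(L - r) f\<close> at \<open>v k\<close>. The next vector of the chain has no such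
  coefficient, a contradiction.\<close>

lemma gen_eigen_coefficients:
  assumes "gen_eigen L r f" "f = (\<Sum>i<n. mfps_const (c i) * v i)" "i < n" "J i i \<noteq> r"
  shows "c i = 0"
  using assms
proof (induction arbitrary: c i)
  case zero
  then show ?case using basis_coefficients_unique[of c "\<lambda>_. 0" i] by (simp add: mfps_const_simps)
next
  case (step f)
  define d where "d = (\<lambda>k. (\<Sum>i<n. c i * J k i) - r * c k)"
  have "L f = (\<Sum>k<n. \<Sum>i<n. mfps_const (c i * J k i) * v k)"
    unfolding step.prems(1)
    by (simp add: L_basis mfps_const_simps sum_distrib_left mult.assoc) (rule sum.swap)
  then have "L f - mfps_const r * f = (\<Sum>k<n. mfps_const (d k) * v k)"
    unfolding step.prems(1)
    by (simp add: d_def mfps_const_simps mfps_const_sum left_diff_distrib sum_subtractf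
        sum_distrib_left sum_distrib_right mult.assoc)
  note d0 = step.IH[OF this]
  show ?case
  proof (rule ccontr)
    define S where "S = {k. k < n \<and> J k k \<noteq> r \<and> c k \<noteq> 0}"
    assume "c i \<noteq> 0"
    then have "i \<in> S" using step.prems by (simp add: S_def)
    moreover have fin: "finite S" by (simp add: S_def)
    ultimately have "Max S \<in> S" by (intro Max_in) auto
    define k where "k = Max S"
    have k: "k < n" "J k k \<noteq> r" "c k \<noteq> 0" using \<open>Max S \<in> S\<close> by (auto simp: k_def S_def)
    have ck: "c i * J k i = (if i = k then c k * J k k else 0)" if "i < n" for i
    proof (rule ccontr)
      assume *: "\<not> ?thesis"
      then have "i \<noteq> k" "c i \<noteq> 0" "J k i \<noteq> 0" by (auto split: if_splits)
      with J[of k i] k \<open>i < n\<close> have "k < i" "i \<in> S" by (auto simp: S_def)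
      then show False using Max_ge[OF fin, of i] by (simp add: k_def)
    qed
    have "(\<Sum>i<n. c i * J k i) = (\<Sum>i<n. if i = k then c k * J k k else 0)"
      by (intro sum.cong refl ck) simp
    then have "(\<Sum>i<n. c i * J k i) = c k * J k k" using k(1) by simp
    moreover have "d k = 0" by (rule d0[OF k(1,2)])
    ultimately have "c k * (J k k - r) = 0" unfolding d_def by (simp add: right_diff_distrib mult.commute)
    with k show False by simp
  qed
qed

text \<open>Frees \<open>fc f\<close> from the chosen Jordan basis. Brackets, weight components and
  conjugates of basis vectors are no basis vectors, but they are generalised eigenvectors.\<close>

lemma fc_gen_eigen:
  assumes "gen_eigen L r (lin n u)"
  shows "linear_op n (fc f) (lin n u) = mfps_const (f r) * lin n u"
proof -
  define c where "c = (\<lambda>i. \<Sum>a<n. Q i a * u a)"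
  have u: "lin n u = (\<Sum>i<n. mfps_const (c i) * v i)" unfolding c_def by (rule lin_in_basis)
  have "linear_op n (fc f) (lin n u) = (\<Sum>i<n. mfps_const (c i) * (mfps_const (f (J i i)) * v i))"
    unfolding u by (simp add: fc_basis)
  also have "\<dots> = (\<Sum>i<n. mfps_const (c i) * (mfps_const (f r) * v i))"
  proof (intro sum.cong refl)
    fix i assume "i \<in> {..<n}"
    then have "f (J i i) = f r \<or> c i = 0" using gen_eigen_coefficients[OF assms u, of i] by auto
    then show "mfps_const (c i) * (mfps_const (f (J i i)) * v i)
        = mfps_const (c i) * (mfps_const (f r) * v i)"
      by (auto simp: mfps_const_simps)
  qed
  also have "\<dots> = mfps_const (f r) * lin n u"
    unfolding u by (simp add: sum_distrib_left mult.left_commute)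
  finally show ?thesis .
qed

lemma gen_eigen_degree_one:
  "gen_eigen L r f \<Longrightarrow> gen_eigen L r (wt_proj (\<lambda>_. 1) k f)"
  by (erule gen_eigen_intertwine) (simp_all add: wt_proj_linear_op_degree[simplified])

text \<open>\<open>L\<close> annihilates constants, so \<open>L - r\<close> acts on them as the
  scalar \<open>- r\<close>. This handles the constant brackets of symplectic variables.\<close>

lemma gen_eigen_const:
  assumes "gen_eigen L r f" "f = mfps_const d"
  shows "r = 0 \<or> d = 0"
  using assms
proof (induction arbitrary: d)
  case zero
  then show ?case by (metis mfps_coeff_const mfps_coeff_zero)
next
  case (step f)
  have "L f - mfps_const r * f = mfps_const (- (r * d))"
    by (simp add: step.prems mfps_const_simps)
  from step.IH[OF this] show ?case by auto
qed

text \<open>On basis vectors both sides multiply the bracket by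
  \<open>f (r + s) = f r + f s\<close>. The bracket is affine: its linear part is a generalised
  eigenvector for \<open>r + s\<close>, and a nonzero constant part forces \<open>r + s = 0\<close>,
  where \<open>f\<close> vanishes by additivity. Identity and complex conjugation are the additive
  functions to which this is applied.\<close>

lemma fc_derivation:
  assumes B: "mfps_bilinear B" and der: "\<And>f g. L (B f g) = B (L f) g + B f (L g)"
    and lin: "\<And>u w. \<exists>d x. B (lin n u) (lin n w) = mfps_const d + lin n x"
    and f: "\<And>r s. f (r + s) = f r + f s"
  shows "linear_op n (fc f) (B (lin n u) (lin n w))
    = B (linear_op n (fc f) (lin n u)) (lin n w) + B (lin n u) (linear_op n (fc f) (lin n w))"
proof -
  let ?S = "linear_op n (fc f)"
  note Bs = mfps_bilinearD[OF B] mfps_bilinear_sum[OF B]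
  have basis: "?S (B (v i) (v j)) = B (?S (v i)) (v j) + B (v i) (?S (v j))"
    if ij: "i < n" "j < n" for i j
  proof -
    let ?r = "J i i + J j j"
    obtain d x where dx: "B (v i) (v j) = mfps_const d + lin n x" using lin by blast
    have ge: "gen_eigen L ?r (B (v i) (v j))"
      by (rule gen_eigen_bilinear[where L = L and B = B])
        (use ij B der gen_eigen_basis in auto)
    have "gen_eigen L ?r (wt_proj (\<lambda>_. 1) 0 (mfps_const d + lin n x))"
      "gen_eigen L ?r (wt_proj (\<lambda>_. 1) 1 (mfps_const d + lin n x))"
      using gen_eigen_degree_one[OF ge] unfolding dx by blast+
    then have "gen_eigen L ?r (mfps_const d)" "gen_eigen L ?r (lin n x)"
      using wt_proj_homog[OF homog_lin_degree, of _ n x]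
        wt_proj_homog[OF homog_const, of "\<lambda>_. 1" _ d]
      by simp_all
    then have "?S (lin n x) = mfps_const (f ?r) * lin n x" "?r = 0 \<or> d = 0"
      using fc_gen_eigen gen_eigen_const[OF _ refl] by blast+
    moreover have "f 0 = 0" using f[of 0 0] by simp
    ultimately have "?S (B (v i) (v j)) = mfps_const (f ?r) * B (v i) (v j)"
      unfolding dx by (auto simp: distrib_left mfps_const_simps)
    then show ?thesis using ij by (simp add: fc_basis Bs f mfps_const_simps distrib_right)
  qed
  show ?thesis
    by (subst (1 2 3 4 5 6) lin_in_basis)
      (simp add: Bs basis distrib_left sum.distrib sum_distrib_left)
qed

text \<open>A nonzero \<open>J k i\<close> joins equal eigenvalues, so \<open>fc f\<close> is scalar
  on each block of \<open>L\<close>.\<close>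

lemma fc_commute: "linear_op n (fc f) (L (lin n u)) = L (linear_op n (fc f) (lin n u))"
proof -
  have "linear_op n (fc f) (L (v i)) = L (linear_op n (fc f) (v i))" if "i < n" for i
  proof -
    have "mfps_const (J k i) * (mfps_const (f (J k k)) * v k)
        = mfps_const (f (J i i)) * (mfps_const (J k i) * v k)" if "k < n" for k
      using J[OF that \<open>i < n\<close>] by (cases "J k i = 0") (auto simp: mfps_const_simps mult.left_commute)
    then show ?thesis using that
      by (simp add: L_basis fc_basis sum_distrib_left)
  qed
  then show ?thesis by (subst (1 2) lin_in_basis) simp
qed

text \<open>In the Jordan basis \<open>fc f\<close> is diagonal, so only the diagonal of
  \<open>J\<close> survives. For \<open>f = cnj\<close> the value is the sum of the squared moduli
  of the eigenvalues.\<close>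

lemma fc_trace: "(\<Sum>a<n. \<Sum>b<n. A a b * fc f b a) = (\<Sum>i<n. f (J i i) * J i i)"
proof -
  have "(\<Sum>a<n. \<Sum>b<n. A a b * fc f b a)
      = (\<Sum>b<n. \<Sum>a<n. \<Sum>i<n. f (J i i) * (Q i b * (A a b * P a i)))"
    unfolding fc_def sum_distrib_left by (subst sum.swap) (simp add: mult_ac)
  also have "\<dots> = (\<Sum>b<n. \<Sum>i<n. f (J i i) * (Q i b * (\<Sum>a<n. A a b * P a i)))"
    unfolding sum_distrib_left by (intro sum.cong refl sum.swap)
  also have "\<dots> = (\<Sum>b<n. \<Sum>i<n. \<Sum>k<n. f (J i i) * (Q i b * (P b k * J k i)))"
    by (simp add: AP sum_distrib_left)
  also have "\<dots> = (\<Sum>i<n. \<Sum>b<n. \<Sum>k<n. f (J i i) * (Q i b * (P b k * J k i)))"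
    by (rule sum.swap)
  also have "\<dots> = (\<Sum>i<n. \<Sum>k<n. f (J i i) * J k i * (\<Sum>b<n. Q i b * P b k))"
      proof (rule sum.cong[OF refl])
    fix i
    show "(\<Sum>b<n. \<Sum>k<n. f (J i i) * (Q i b * (P b k * J k i)))
        = (\<Sum>k<n. f (J i i) * J k i * (\<Sum>b<n. Q i b * P b k))"
      unfolding sum_distrib_left by (subst sum.swap) (simp add: mult_ac)
  qed
  also have "\<dots> = (\<Sum>i<n. f (J i i) * J i i)"
    by (simp add: QP if_distrib cong: if_cong)
  finally show ?thesis .
qed

lemma nilpotent_if_eigenvalues_0:
  assumes "\<And>i. i < n \<Longrightarrow> J i i = 0"
  shows "gen_eigen L 0 (lin n u)"
proof (subst lin_in_basis, rule gen_eigen_sum)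
  fix i assume "i \<in> {..<n}"
  then have "gen_eigen L 0 (v i)" using gen_eigen_basis[of i] assms[of i] by simp
  then show "gen_eigen L 0 (mfps_const (\<Sum>a<n. Q i a * u a) * v i)"
    by (intro gen_eigen_const_mult) auto
qed simp

text \<open>Without its diagonal, \<open>L\<close> is strictly triangular in the Jordan basis:
  \<open>v i\<close> is killed by every power above \<open>i\<close>, hence all basis vectors by the
  power \<open>n\<close>.\<close>

lemma nilpotent_part:
  "((\<lambda>f. L f - linear_op n (fc (\<lambda>x. x)) f) ^^ n) (lin n u) = 0"
proof -
  define D where "D = (\<lambda>f. L f - linear_op n (fc (\<lambda>x. x)) f)"
  have D: "D (f + g) = D f + D g" "D (mfps_const r * f) = mfps_const r * D f" "D 0 = 0" for f g r
    by (simp_all add: D_def right_diff_distrib)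
  have Dk: "(D ^^ k) (f + g) = (D ^^ k) f + (D ^^ k) g"
      "(D ^^ k) (mfps_const r * f) = mfps_const r * (D ^^ k) f" "(D ^^ k) 0 = 0" for f g r k
    by (induction k; simp add: D)+
  have Dsum: "(D ^^ k) (\<Sum>x\<in>X. f x) = (\<Sum>x\<in>X. (D ^^ k) (f x))" for k f and X :: "nat set"
    by (induction X rule: infinite_finite_induct) (auto simp: Dk)
  have "(D ^^ k) (v i) = 0" if "i < n" "i < k" for i k
    using that
  proof (induction i arbitrary: k rule: less_induct)
    case (less i)
    then obtain k' where k: "k = Suc k'" "i \<le> k'" by (cases k) auto
    define c where "c = (\<lambda>k. J k i - (if k = i then J i i else 0))"
    have "D (v i) = (\<Sum>k<n. mfps_const (J k i) * v k)
        - (\<Sum>k<n. mfps_const (if k = i then J i i else 0) * v k)"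
      using less.prems by (simp add: D_def L_basis fc_basis if_distrib[of mfps_const] mfps_const_simps
          if_distrib[of "\<lambda>x. x * _"] cong: if_cong)
    also have "\<dots> = (\<Sum>k<n. mfps_const (c k) * v k)"
      by (simp add: c_def mfps_const_simps algebra_simps sum_subtractf)
    finally have "(D ^^ k) (v i) = (\<Sum>j<n. mfps_const (c j) * (D ^^ k') (v j))"
      by (simp add: k funpow_swap1 Dsum Dk)
    also have "\<dots> = 0"
    proof (rule sum.neutral, intro ballI)
      fix j assume j: "j \<in> {..<n}"
      show "mfps_const (c j) * (D ^^ k') (v j) = 0"
      proof (cases "c j = 0")
        case False
        then have "j \<noteq> i" "J j i \<noteq> 0" by (auto simp: c_def split: if_splits)
        with J[of j i] j less.prems have "j < i" by auto
        with less.IH[of j k'] j k show ?thesis by simp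
      qed (simp add: mfps_const_simps)
    qed
    finally show ?case .
  qed
  then show ?thesis
    unfolding D_def[symmetric] by (subst lin_in_basis) (simp add: Dsum Dk)
qed

text \<open>The Jordan basis diagonalises the action on coefficient vectors, which is the transpose
  of the matrix; hence the transposes of \<open>Q\<close> and \<open>P\<close> in the
  similarity.\<close>

lemma fc_diagonalizable: "\<exists>D. diagonal_mat D \<and> similar_mat (mat n n (\<lambda>(a, b). fc f a b)) D"
proof (intro exI conjI)
  let ?D = "mat n n (\<lambda>(i, j). if i = j then f (J i i) else 0)"
  let ?P = "mat n n (\<lambda>(i, j). Q j i)" and ?Q = "mat n n (\<lambda>(i, j). P j i)"
  show "diagonal_mat ?D" by (auto simp: diagonal_mat_def)
  show "similar_mat (mat n n (\<lambda>(a, b). fc f a b)) ?D"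
  proof (rule similar_matI[where P = ?P and Q = ?Q and n = n])
    have "(\<Sum>i<n. Q i a * P b i) = (if a = b then 1 else 0)" if "a < n" "b < n" for a b
      using PQ[OF that(2,1)] by (auto simp: mult.commute)
    then show "?P * ?Q = 1\<^sub>m n"
      by (intro eq_matI) (auto simp: scalar_prod_def lessThan_atLeast0[symmetric])
    have "(\<Sum>a<n. P a i * Q j a) = (if i = j then 1 else 0)" if "i < n" "j < n" for i j
      using QP[OF that(2,1)] by (auto simp: mult.commute)
    then show "?Q * ?P = 1\<^sub>m n"
      by (intro eq_matI) (auto simp: scalar_prod_def lessThan_atLeast0[symmetric])
    have "?P * ?D = mat n n (\<lambda>(a, i). Q i a * f (J i i))"
      by (rule eq_matI) (auto simp: scalar_prod_def lessThan_atLeast0[symmetric] if_distrib cong: if_cong)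
    then show "mat n n (\<lambda>(a, b). fc f a b) = ?P * ?D * ?Q"
      by (intro eq_matI) (auto simp: scalar_prod_def lessThan_atLeast0[symmetric] fc_def)
  qed auto
qed

end

section \<open>Change of the ground field\<close>

definition mfps_map :: "('a \<Rightarrow> 'b) \<Rightarrow> 'a mfps \<Rightarrow> 'b mfps"
  where "mfps_map h f = Abs_mfps (\<lambda>M. h (mfps_coeff f M))"

lemma mfps_coeff_map [simp]: "mfps_coeff (mfps_map h f) M = h (mfps_coeff f M)"
  by (simp add: mfps_map_def)

locale coeff_hom =
  fixes h :: "'a::comm_ring_1 \<Rightarrow> 'b::comm_ring_1"
  assumes hom_add: "h (a + b) = h a + h b" and hom_mult: "h (a * b) = h a * h b"
    and hom_one: "h 1 = 1"
begin

lemma hom_zero: "h 0 = 0"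
  using hom_add[of 0 0] by simp

lemma hom_uminus: "h (- a) = - h a"
  using hom_add[of a "- a"] hom_zero by (simp add: eq_neg_iff_add_eq_0 add.commute)

lemma hom_minus: "h (a - b) = h a - h b"
  using hom_add[of a "- b"] by (simp add: hom_uminus)

lemma hom_sum: "h (\<Sum>x\<in>X. f x) = (\<Sum>x\<in>X. h (f x))"
  by (induction X rule: infinite_finite_induct) (simp_all add: hom_zero hom_add)

lemma hom_of_nat: "h (of_nat k) = of_nat k"
  by (induction k) (simp_all add: hom_zero hom_add hom_one)

lemmas hom_simps = hom_zero hom_one hom_add hom_mult hom_uminus hom_minus hom_sum hom_of_nat

lemma map_simps:
  "mfps_map h (f + g) = mfps_map h f + mfps_map h g"
  "mfps_map h (f - g) = mfps_map h f - mfps_map h g"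
  "mfps_map h (- f) = - mfps_map h f"
  "mfps_map h (f * g) = mfps_map h f * mfps_map h g"
  "mfps_map h 0 = 0" "mfps_map h 1 = 1"
  "mfps_map h (mfps_const r) = mfps_const (h r)"
  "mfps_map h (mfps_var i) = mfps_var i"
  "mfps_map h (mfps_deriv i f) = mfps_deriv i (mfps_map h f)"
  by (rule mfps_ext; simp add: hom_simps mfps_coeff_times mfps_coeff_one mfps_coeff_const
      mfps_coeff_var mfps_coeff_deriv case_prod_unfold)+

lemma map_sum: "mfps_map h (\<Sum>x\<in>X. f x) = (\<Sum>x\<in>X. mfps_map h (f x))"
  by (induction X rule: infinite_finite_induct) (simp_all add: map_simps)

lemma map_lin: "mfps_map h (lin n u) = lin n (\<lambda>a. h (u a))"
  by (simp add: lin_def map_sum map_simps)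

lemma map_linear_op: "mfps_map h (linear_op n A f) = linear_op n (\<lambda>a b. h (A a b)) (mfps_map h f)"
  by (simp add: linear_op_def vf_apply_def map_sum map_simps map_lin)

lemma map_bracket:
  "mfps_map h (poisson_bracket n P f g)
    = poisson_bracket n (\<lambda>a b. mfps_map h (P a b)) (mfps_map h f) (mfps_map h g)"
  by (simp add: poisson_bracket_def map_sum map_simps)

lemma map_formal: "f \<in> formal_functions n \<Longrightarrow> mfps_map h f \<in> formal_functions n"
  unfolding formal_functions_def
proof (intro CollectI allI impI)
  fix M assume f: "f \<in> {f. \<forall>M. mfps_coeff f M \<noteq> 0 \<longrightarrow> set_mset M \<subseteq> {..<n}}"
    and "mfps_coeff (mfps_map h f) M \<noteq> 0"
  then have "mfps_coeff f M \<noteq> 0" using hom_zero by (cases "mfps_coeff f M = 0") simp_all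
  with f show "set_mset M \<subseteq> {..<n}" by blast
qed

lemma map_homog: "homog w k f \<Longrightarrow> homog w k (mfps_map h f)"
  using hom_zero unfolding homog_def by (metis mfps_coeff_map)

lemma map_wt_proj: "mfps_map h (wt_proj w k f) = wt_proj w k (mfps_map h f)"
  by (rule mfps_ext) (simp add: mfps_coeff_wt_proj hom_zero)

end

lemma coeff_hom_field_inverse:
  fixes h :: "'a::field \<Rightarrow> 'b::field"
  assumes "coeff_hom h"
  shows "inj h" "h (1 / a) = 1 / h a"
proof -
  interpret coeff_hom h by fact
  have nz: "h a \<noteq> 0" if "a \<noteq> 0" for a
    using hom_mult[of a "1 / a"] that hom_one by (metis mult_zero_left nonzero_mult_div_cancel_left
        times_divide_eq_right mult.right_neutral zero_neq_one)
  show "inj h"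
  proof (rule injI)
    fix a b assume "h a = h b"
    then show "a = b" using nz[of "a - b"] by (auto simp: hom_minus)
  qed
  show "h (1 / a) = 1 / h a"
  proof (cases "a = 0")
    case False
    then have "h (1 / a) * h a = 1" by (simp add: hom_one flip: hom_mult)
    then show ?thesis using nz[OF False] by (simp add: field_simps)
  qed (simp add: hom_zero)
qed

lemma coeff_hom_to_complex: "coeff_hom (to_complex :: 'k::real_or_complex \<Rightarrow> complex)"
  by unfold_locales (rule to_complex_add to_complex_mult to_complex_one)+

lemma coeff_hom_cnj: "coeff_hom cnj"
  by unfold_locales simp_all

text \<open>A \<open>\<bbbK>\<close>-linear left inverse of the embedding into the complex numbers (the real part, if
  \<open>\<bbbK> = \<real>\<close>): it turns complex solutions of linear equations over \<open>\<bbbK>\<close> into solutions over \<open>\<bbbK>\<close>.\<close>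

definition retract :: "complex \<Rightarrow> 'k::real_or_complex"
  where "retract z = inv_into UNIV to_complex
    (if range (to_complex :: 'k \<Rightarrow> complex) = UNIV then z else complex_of_real (Re z))"

lemma retract:
  fixes a :: "'k::real_or_complex"
  shows "retract (to_complex a) = a" "retract (x + y) = (retract x + retract y :: 'k)"
    "retract (to_complex a * x) = a * retract x"
proof -
  interpret coeff_hom "to_complex :: 'k \<Rightarrow> complex" by (rule coeff_hom_to_complex)
  have inj: "inj (to_complex :: 'k \<Rightarrow> complex)"
    by (rule coeff_hom_field_inverse) (rule coeff_hom_to_complex)
  let ?t = "to_complex :: 'k \<Rightarrow> complex"
  let ?p = "\<lambda>z. if range ?t = UNIV then z else complex_of_real (Re z)"
  have re: "complex_of_real (Re (?t a)) = ?t a" if "range ?t \<noteq> UNIV" for a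
    using that range_to_complex[where 'a='k] by (metis Reals_cases Re_complex_of_real rangeI)
  have t: "?t (retract z) = ?p z" for z
  proof -
    have "?p z \<in> range ?t" using range_to_complex[where 'a='k] by auto
    then show ?thesis unfolding retract_def by (simp add: f_inv_into_f)
  qed
  have p: "?p (?t a) = ?t a" "?p (x + y) = ?p x + ?p y" "?p (?t a * x) = ?t a * ?p x" for a x y
  proof -
    show "?p (?t a) = ?t a" "?p (x + y) = ?p x + ?p y" using re by auto
    show "?p (?t a * x) = ?t a * ?p x"
    proof (cases "range ?t = UNIV")
      case False
      from re[OF this, of a] have "Re (?t a * x) = Re (?t a) * Re x"
        by (metis Im_complex_of_real Re_complex_of_real diff_zero mult_zero_left times_complex.sel(1))
      then have "complex_of_real (Re (?t a * x)) = ?t a * complex_of_real (Re x)"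
        by (simp add: re[OF False])
      then show ?thesis by simp
    qed simp
  qed
  show "retract (?t a) = a" by (rule injD[OF inj]) (simp only: t p)
  show "retract (x + y) = (retract x + retract y :: 'k)"
    by (rule injD[OF inj]) (simp only: t p hom_add)
  show "retract (?t a * x) = a * retract x"
    by (rule injD[OF inj]) (simp only: t p hom_mult)
qed

abbreviation complexify :: "'k::real_or_complex mfps \<Rightarrow> complex mfps"
  where "complexify \<equiv> mfps_map to_complex"

lemma retract_zero: "retract 0 = (0 :: 'k::real_or_complex)"
  using retract(2)[of 0 0, where 'k='k] by simp

lemma retract_sum: "retract (\<Sum>x\<in>X. f x) = (\<Sum>x\<in>X. retract (f x) :: 'k::real_or_complex)"
  by (induction X rule: infinite_finite_induct) (simp_all add: retract_zero retract)

text \<open>\<open>retract\<close> is linear over the ground field but not multiplicative. Products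
  are therefore respected only when one factor already comes from the ground field, as the
  coefficients of the equations do.\<close>

lemma map_retract:
  fixes f :: "'k::real_or_complex mfps"
  shows "mfps_map retract (complexify f) = f"
    "mfps_map retract (g + h) = (mfps_map retract g + mfps_map retract h :: 'k mfps)"
    "mfps_map retract (complexify f * g) = f * mfps_map retract g"
    "mfps_map retract (mfps_deriv i g) = (mfps_deriv i (mfps_map retract g) :: 'k mfps)"
    "mfps_map retract 0 = (0 :: 'k mfps)"
proof -
  interpret coeff_hom "to_complex :: 'k \<Rightarrow> complex" by (rule coeff_hom_to_complex)
  have nat: "retract (of_nat j * z) = (of_nat j * retract z :: 'k)" for j z
    using retract(3)[of "of_nat j :: 'k"] by (simp add: hom_of_nat)
  show "mfps_map retract (complexify f) = f" by (rule mfps_ext) (simp add: retract)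
  show "mfps_map retract (g + h) = (mfps_map retract g + mfps_map retract h :: 'k mfps)"
    by (rule mfps_ext) (simp add: retract)
  show "mfps_map retract 0 = (0 :: 'k mfps)"
    by (rule mfps_ext) (simp add: retract_zero)
  show "mfps_map retract (complexify f * g) = f * mfps_map retract g"
    by (rule mfps_ext) (simp add: retract_sum retract mfps_coeff_times case_prod_unfold)
  show "mfps_map retract (mfps_deriv i g) = (mfps_deriv i (mfps_map retract g) :: 'k mfps)"
    by (rule mfps_ext) (simp only: mfps_coeff_map mfps_coeff_deriv nat)
qed

lemma map_retract_sum:
  "mfps_map retract (\<Sum>x\<in>X. f x) = (\<Sum>x\<in>X. mfps_map retract (f x) :: 'k::real_or_complex mfps)"
  by (induction X rule: infinite_finite_induct) (simp_all add: map_retract)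

lemma map_retract_bracket:
  fixes f :: "'k::real_or_complex mfps"
  shows "mfps_map retract (poisson_bracket n (\<lambda>a b. complexify (P a b)) (complexify f) g)
    = poisson_bracket n P f (mfps_map retract g)"
proof -
  interpret coeff_hom "to_complex :: 'k \<Rightarrow> complex" by (rule coeff_hom_to_complex)
  show ?thesis
    by (simp add: poisson_bracket_def map_retract_sum map_retract flip: map_simps)
qed

lemma map_retract_formal:
  assumes "f \<in> formal_functions n"
  shows "(mfps_map retract f :: 'k::real_or_complex mfps) \<in> formal_functions n"
  unfolding formal_functions_def
proof (intro CollectI allI impI)
  fix M assume "mfps_coeff (mfps_map retract f :: 'k mfps) M \<noteq> 0"
  then have "mfps_coeff f M \<noteq> 0" using retract_zero[where 'k='k] by (cases "mfps_coeff f M = 0") simp_all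
  with assms show "set_mset M \<subseteq> {..<n}" unfolding formal_functions_def by blast
qed

section \<open>The canonical Poisson structure\<close>

lemma coord_wedge_skew: "coord_wedge a b p q = - coord_wedge a b q p"
  unfolding coord_wedge_def minus_diff_eq by (simp only: conj_commute)

lemma times_coord_wedge:
  "f * coord_wedge a b p q = (if p = a \<and> q = b then f else 0) - (if p = b \<and> q = a then f else 0)"
proof -
  have "f * ((if A then 1 else 0) - (if B then 1 else 0)) = (if A then f else 0) - (if B then f else 0)"
    for A B by simp
  then show ?thesis unfolding coord_wedge_def of_bool_def .
qed

lemma canonical_bivector_skew: "canonical_bivector l m c p q = - canonical_bivector l m c q p"
proof -
  have *: "(\<Sum>i<l. coord_wedge i (l + i) p q) = - (\<Sum>i<l. coord_wedge i (l + i) q p :: 'a mfps)"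
    unfolding sum_negf[symmetric] by (intro sum.cong refl coord_wedge_skew)
  have "(\<Sum>i<m. \<Sum>j<m. \<Sum>k<m.
      mfps_const (c i j k) * mfps_var (2*l + k) * coord_wedge (2*l + i) (2*l + j) p q)
    = - (\<Sum>i<m. \<Sum>j<m. \<Sum>k<m.
      mfps_const (c i j k) * mfps_var (2*l + k) * coord_wedge (2*l + i) (2*l + j) q p)"
    unfolding sum_negf[symmetric]
    by (intro sum.cong refl) (subst coord_wedge_skew, simp)
  then show ?thesis unfolding canonical_bivector_def * by simp
qed

text \<open>Formulated with structure constants instead of a Lie algebra, so that the theory can be
  instantiated both over the ground field and with the complexified constants.\<close>

locale lie_poisson =
  fixes l m :: nat and c :: "nat \<Rightarrow> nat \<Rightarrow> nat \<Rightarrow> 'a::field_char_0"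
  assumes c_skew: "i < m \<Longrightarrow> j < m \<Longrightarrow> k < m \<Longrightarrow> c i j k = - c j i k"
    and c_jacobi: "i < m \<Longrightarrow> j < m \<Longrightarrow> k < m \<Longrightarrow> q < m \<Longrightarrow>
      (\<Sum>p<m. c j k p * c i p q + c k i p * c j p q + c i j p * c k p q) = 0"
begin

abbreviation n :: nat where "n \<equiv> 2 * l + m"
abbreviation P :: "'a bivector" where "P \<equiv> canonical_bivector l m c"
text \<open>Indices from \<open>n\<close> on also get weight 2, so that positivity of the weights
  holds for every index.\<close>

definition W :: "nat \<Rightarrow> nat" where "W a = (if a < 2 * l then 1 else 2)"

definition z_bracket :: "nat \<Rightarrow> nat \<Rightarrow> 'a mfps"
  where "z_bracket i j = (\<Sum>k<m. mfps_const (c i j k) * mfps_var (2*l + k))"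

lemma W_bounds [simp]: "1 \<le> W a" "Suc 0 \<le> W a" "W a \<le> 2" "W a \<noteq> 0"
  by (simp_all add: W_def)

text \<open>Each entry is met twice in the double sum, once as \<open>(i, j)\<close> and once as
  \<open>(j, i)\<close>. Skewness of \<open>c\<close> makes the two contributions equal, and the
  factor 1/2 removes the doubling.\<close>

lemma canonical_bivector_lie_part:
  "mfps_const (1/2) * (\<Sum>i<m. \<Sum>j<m. \<Sum>k<m.
      mfps_const (c i j k) * mfps_var (2*l + k) * coord_wedge (2*l + i) (2*l + j) p q)
    = (if 2*l \<le> p \<and> p < n \<and> 2*l \<le> q \<and> q < n then z_bracket (p - 2*l) (q - 2*l) else 0)"
proof -
  have "(\<Sum>i<m. \<Sum>j<m. \<Sum>k<m.
      mfps_const (c i j k) * mfps_var (2*l + k) * coord_wedge (2*l + i) (2*l + j) p q)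
    = (\<Sum>i<m. \<Sum>j<m. z_bracket i j * coord_wedge (2*l + i) (2*l + j) p q)"
    by (simp add: z_bracket_def sum_distrib_right)
  also have "\<dots> = (\<Sum>i<m. \<Sum>j<m. if p = 2*l + i \<and> q = 2*l + j then z_bracket i j else 0)
      - (\<Sum>i<m. \<Sum>j<m. if p = 2*l + j \<and> q = 2*l + i then z_bracket i j else 0)"
    unfolding sum_subtractf[symmetric] times_coord_wedge ..
  finally have *: "(\<Sum>i<m. \<Sum>j<m. \<Sum>k<m.
      mfps_const (c i j k) * mfps_var (2*l + k) * coord_wedge (2*l + i) (2*l + j) p q)
    = (\<Sum>i<m. \<Sum>j<m. if p = 2*l + i \<and> q = 2*l + j then z_bracket i j else 0)
      - (\<Sum>i<m. \<Sum>j<m. if p = 2*l + j \<and> q = 2*l + i then z_bracket i j else 0)" .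
  show ?thesis
  proof (cases "2*l \<le> p \<and> p < n \<and> 2*l \<le> q \<and> q < n")
    case True
    define i0 j0 where "i0 = p - 2*l" and "j0 = q - 2*l"
    have pq: "p = 2*l + i0" "q = 2*l + j0" "i0 < m" "j0 < m"
      using True by (auto simp: i0_def j0_def)
    have delta: "(\<Sum>i<m. \<Sum>j<m. if i = a \<and> j = b then z_bracket i j else 0) = z_bracket a b"
      if "a < m" "b < m" for a b
    proof -
      have "(\<Sum>j<m. if i = a \<and> j = b then z_bracket i j else 0)
          = (if i = a then z_bracket a b else 0)" for i
        using that by (cases "i = a") simp_all
      then show ?thesis using that by simp
    qed
    have "(\<Sum>i<m. \<Sum>j<m. if p = 2*l + i \<and> q = 2*l + j then z_bracket i j else 0) = z_bracket i0 j0"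
      unfolding delta[OF pq(3,4), symmetric] using pq(1,2) by (intro sum.cong refl) auto
    moreover have "(\<Sum>i<m. \<Sum>j<m. if p = 2*l + j \<and> q = 2*l + i then z_bracket i j else 0)
        = z_bracket j0 i0"
      unfolding delta[OF pq(4,3), symmetric] using pq(1,2) by (intro sum.cong refl) auto
    moreover have "z_bracket j0 i0 = - z_bracket i0 j0"
      unfolding z_bracket_def sum_negf[symmetric]
      using c_skew[OF pq(4,3)] by (intro sum.cong refl) (auto simp: mfps_const_simps)
    ultimately have "mfps_const (1/2) * (\<Sum>i<m. \<Sum>j<m. \<Sum>k<m.
        mfps_const (c i j k) * mfps_var (2*l + k) * coord_wedge (2*l + i) (2*l + j) p q)
      = mfps_const (1/2) * (z_bracket i0 j0 + z_bracket i0 j0)"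
      unfolding * using pq by simp
    also have "\<dots> = (mfps_const (1/2) + mfps_const (1/2)) * z_bracket i0 j0"
      by (simp add: distrib_left distrib_right)
    also have "mfps_const (1/2) + mfps_const (1/2) = (1 :: 'a mfps)"
      by (simp add: mfps_const_simps(6) flip: mfps_const_simps(1))
    finally show ?thesis using True by (simp add: i0_def j0_def)
  next
    case False
    then have "(\<Sum>i<m. \<Sum>j<m. if p = 2*l + i \<and> q = 2*l + j then z_bracket i j else 0) = 0"
      "(\<Sum>i<m. \<Sum>j<m. if p = 2*l + j \<and> q = 2*l + i then z_bracket i j else 0) = 0"
      by (auto intro!: sum.neutral)
    then show ?thesis unfolding * if_not_P[OF False] by simp
  qed
qed

lemma canonical_bivector_symplectic_part:
  "(\<Sum>i<l. coord_wedge i (l + i) p q)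
    = ((if p < l \<and> q = l + p then 1 else 0) - (if q < l \<and> p = l + q then 1 else 0) :: 'a mfps)"
proof -
  have "(\<Sum>i<l. coord_wedge i (l + i) p q) = (\<Sum>i<l. if i = p then if q = l + p then 1 else 0 else 0)
      - (\<Sum>i<l. if i = q then if p = l + q then 1 else 0 else (0 :: 'a mfps))"
    unfolding sum_subtractf[symmetric]
  proof (intro sum.cong refl)
    fix i
    show "coord_wedge i (l + i) p q = (if i = p then if q = l + p then 1 else 0 else 0)
        - (if i = q then if p = l + q then 1 else 0 else (0 :: 'a mfps))"
    proof -
      have "(if p = i \<and> q = l + i then 1 else 0)
          = (if i = p then if q = l + p then 1 else 0 else (0 :: 'a mfps))"
        "(if p = l + i \<and> q = i then 1 else 0)
          = (if i = q then if p = l + q then 1 else 0 else (0 :: 'a mfps))" by auto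
      then show ?thesis using times_coord_wedge[of "1 :: 'a mfps" i "l + i" p q] by (simp only: mult_1)
    qed
  qed
  then show ?thesis by auto
qed

lemma P_eq: "P p q = (if p < l \<and> q = l + p then 1 else 0) - (if q < l \<and> p = l + q then 1 else 0)
    + (if 2*l \<le> p \<and> p < n \<and> 2*l \<le> q \<and> q < n then z_bracket (p - 2*l) (q - 2*l) else 0)"
  unfolding canonical_bivector_def canonical_bivector_lie_part canonical_bivector_symplectic_part ..

lemma P_mixed: "p < 2*l \<Longrightarrow> 2*l \<le> q \<Longrightarrow> P p q = 0" "p < 2*l \<Longrightarrow> 2*l \<le> q \<Longrightarrow> P q p = 0"
  by (auto simp: P_eq)

lemma P_zz: "i < m \<Longrightarrow> j < m \<Longrightarrow> P (2*l + i) (2*l + j) = z_bracket i j"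
  by (auto simp: P_eq)

lemma P_xy: "p < 2*l \<Longrightarrow> \<exists>r. P p q = mfps_const r"
proof -
  assume "p < 2*l"
  then have "P p q = mfps_const ((if p < l \<and> q = l + p then 1 else 0)
      - (if q < l \<and> p = l + q then 1 else 0))"
    by (auto simp: P_eq mfps_const_simps)
  then show ?thesis ..
qed

lemma formal_z_bracket: "z_bracket i j \<in> formal_functions n"
  unfolding z_bracket_def by (intro formal_functions_sum formal_functions_times) auto

lemma formal_P: "P p q \<in> formal_functions n"
  by (auto simp: P_eq intro!: formal_functions_add formal_functions_minus formal_z_bracket)

lemma poisson_bracket_var_z_bracket:
  assumes "a < n"
  shows "poisson_bracket n P (mfps_var a) (z_bracket i j)
    = (\<Sum>k<m. mfps_const (c i j k) * P a (2*l + k))"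
  unfolding z_bracket_def by (subst poisson_bracket_vf) (simp add: poisson_bracket_var_var assms)

lemma poisson_bracket_var_const: "poisson_bracket n P f (mfps_const r) = 0"
  by (simp add: poisson_bracket_def)

sublocale poisson_structure n P
proof
  show "P a b = - P b a" for a b by (rule canonical_bivector_skew)
  fix a b d assume abd: "a < n" "b < n" "d < n"
  \<comment> \<open>One symplectic index makes every term of the cyclic sum vanish by itself:
    \<open>P b d\<close> is constant if \<open>b\<close> or \<open>d\<close> is symplectic, and
    otherwise it involves only Lie algebra variables, which commute with the symplectic variable
    \<open>a\<close>.\<close>
  have xy: "poisson_bracket n P (mfps_var a) (P b d) = 0"
    if "a < 2*l \<or> b < 2*l \<or> d < 2*l" "a < n" "b < n" "d < n" for a b d
  proof (cases "b < 2*l \<or> d < 2*l")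
    case True
    then obtain r where "P b d = mfps_const r"
      using P_xy[of b d] P_xy[of d b] canonical_bivector_skew[of l m c b d]
      by (metis mfps_const_simps(3))
    then show ?thesis by (simp add: poisson_bracket_var_const)
  next
    case False
    then have "P b d = z_bracket (b - 2*l) (d - 2*l)" using that by (auto simp: P_eq)
    then show ?thesis using that False by (simp add: poisson_bracket_var_z_bracket P_mixed)
  qed
  show "poisson_bracket n P (mfps_var a) (P b d) + poisson_bracket n P (mfps_var b) (P d a)
      + poisson_bracket n P (mfps_var d) (P a b) = 0"
  proof (cases "a < 2*l \<or> b < 2*l \<or> d < 2*l")
    case True
    then show ?thesis using xy abd by auto
  next
    case False
    define i j k where "i = a - 2*l" and "j = b - 2*l" and "k = d - 2*l"
    have ijk: "a = 2*l + i" "b = 2*l + j" "d = 2*l + k" "i < m" "j < m" "k < m"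
      using False abd by (auto simp: i_def j_def k_def)
    have *: "poisson_bracket n P (mfps_var (2*l + i)) (P (2*l + j) (2*l + k))
        = (\<Sum>q<m. mfps_const (\<Sum>p<m. c j k p * c i p q) * mfps_var (2*l + q))"
      if "i < m" "j < m" "k < m" for i j k
    proof -
      have "poisson_bracket n P (mfps_var (2*l + i)) (P (2*l + j) (2*l + k))
          = (\<Sum>p<m. \<Sum>q<m. mfps_const (c j k p * c i p q) * mfps_var (2*l + q))"
        using that by (simp add: P_zz poisson_bracket_var_z_bracket)
          (simp add: z_bracket_def sum_distrib_left mfps_const_simps mult.assoc)
      then show ?thesis by (subst (asm) sum.swap) (simp add: mfps_const_sum sum_distrib_right)
    qed
    have J: "mfps_const (\<Sum>p<m. c j k p * c i p q) * mfps_var (2*l + q)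
        + mfps_const (\<Sum>p<m. c k i p * c j p q) * mfps_var (2*l + q)
        + mfps_const (\<Sum>p<m. c i j p * c k p q) * mfps_var (2*l + q) = 0" if "q < m" for q
    proof -
      have "(\<Sum>p<m. c j k p * c i p q) + (\<Sum>p<m. c k i p * c j p q) + (\<Sum>p<m. c i j p * c k p q) = 0"
        using c_jacobi[OF ijk(4-6) that] by (simp add: sum.distrib)
      then show ?thesis by (simp flip: distrib_right mfps_const_simps(1)) (simp add: mfps_const_simps)
    qed
    show ?thesis
      unfolding ijk(1-3) *[OF ijk(4-6)] *[OF ijk(5,6,4)] *[OF ijk(6,4,5)] sum.distrib[symmetric]
      by (rule sum.neutral) (use J in blast)
  qed
qed

lemma pb_var_var: "a < n \<Longrightarrow> b < n \<Longrightarrow> pb (mfps_var a) (mfps_var b) = P a b"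
  by (rule poisson_bracket_var_var)

lemma formal_pb: "f \<in> formal_functions n \<Longrightarrow> g \<in> formal_functions n \<Longrightarrow> pb f g \<in> formal_functions n"
  by (intro formal_functions_bracket formal_P)

lemma homog_z_bracket: "homog W 2 (z_bracket i j)"
  unfolding z_bracket_def
proof (intro homog_sum homog_const_mult)
  fix k
  show "homog W 2 (mfps_var (2*l + k))" using homog_var[of W "2*l + k"] by (simp add: W_def)
qed

lemma homog_P: "homog W (W p + W q - 2) (P p q)"
proof -
  have 1: "homog w 0 (1 :: 'a mfps)" for w by (metis homog_const mfps_const_simps(6))
  show ?thesis
    by (cases "p < 2*l"; cases "q < 2*l")
      (auto simp: P_eq W_def homog_z_bracket[simplified] 1 intro!: homog_minus)
qed

lemma wt_proj_pb: "wt_proj W k (pb f g) = (\<Sum>p\<le>k + 2. pb (wt_proj W p f) (wt_proj W (k + 2 - p) g))"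
  by (rule wt_proj_bracket) (auto intro: homog_P)

lemma homog_pb_var:
  assumes "homog W (i + 2) f" "a < n"
  shows "homog W (i + W a) (pb f (mfps_var a))"
  unfolding poisson_bracket_var_right[OF assms(2)]
proof (rule homog_sum)
  fix b
  have "homog W (i + 2 - W b) (mfps_deriv b f)"
  proof (rule homog_deriv)
    have "i + 2 - W b + W b = i + 2" by (simp add: W_def)
    then show "homog W (i + 2 - W b + W b) f" using assms(1) by (simp only:)
  qed
  from homog_times[OF homog_P this] have "homog W (W b + W a - 2 + (i + 2 - W b)) (P b a * mfps_deriv b f)" .
  moreover have "W b + W a - 2 + (i + 2 - W b) = i + W a"
    by (auto simp: W_def)
  ultimately show "homog W (i + W a) (P b a * mfps_deriv b f)" by (simp only:)
qed

text \<open>A function of weight \<open>i + 2\<close> generates a field that raises weights by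
  \<open>i\<close>; weight 2 is thus the case in which the field preserves weights.\<close>

lemma wt_proj_pb_homog:
  assumes "homog W (i + 2) f"
  shows "wt_proj W (k + i) (pb f g) = pb f (wt_proj W k g)"
  by (subst (1 2) poisson_bracket_vf)
    (intro wt_proj_vf_apply homog_pb_var assms)

lemma wt_proj_pb_weight_2: "homog W 2 f \<Longrightarrow> wt_proj W k (pb f g) = pb f (wt_proj W k g)"
  using wt_proj_pb_homog[of 0 f k g] by (simp add: numeral_2_eq_2)

lemma weight_1_degree_1: "homog W 1 f \<Longrightarrow> homog (\<lambda>_. 1) 1 f"
  unfolding homog_def wt_const_one
proof (intro allI impI)
  fix M assume *: "\<forall>M. mfps_coeff f M \<noteq> 0 \<longrightarrow> wt W M = 1" "mfps_coeff f M \<noteq> 0"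
  then have "wt W M = 1" by blast
  then show "size M = 1" using size_le_wt[of W M] by (cases M) auto
qed

lemma weight_2_deriv_z:
  assumes "homog W 2 f" "2*l \<le> b"
  shows "\<exists>r. mfps_deriv b f = mfps_const r"
proof -
  have "homog W 0 (mfps_deriv b f)" by (rule homog_deriv) (use assms in \<open>simp add: W_def numeral_2_eq_2\<close>)
  then have "mfps_deriv b f = mfps_const (mfps_coeff (mfps_deriv b f) {#})"
  proof (intro mfps_ext)
    fix M
    have "wt W M = 0 \<Longrightarrow> M = {#}" using size_le_wt[of W M] by simp
    then show "mfps_coeff (mfps_deriv b f) M = mfps_coeff (mfps_const (mfps_coeff (mfps_deriv b f) {#})) M"
      using \<open>homog W 0 (mfps_deriv b f)\<close> unfolding homog_def by (auto simp: mfps_coeff_const)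
  qed
  then show ?thesis ..
qed

text \<open>Row \<open>a\<close> is the linear part of component \<open>a\<close> of the Hamiltonian
  field. For functions of weight 2 this is the entire field.\<close>

definition ham_matrix :: "'a mfps \<Rightarrow> nat \<Rightarrow> nat \<Rightarrow> 'a"
  where "ham_matrix f a b = mfps_coeff (pb f (mfps_var a)) {#b#}"

text \<open>A symplectic component has weight 1 and therefore degree 1. In a Lie algebra component
  only derivatives by Lie algebra variables occur; for weight 2 these are constants, multiplied by
  linear entries of \<open>P\<close>.\<close>

lemma weight_2_hamiltonian_linear:
  assumes f: "f \<in> formal_functions n" "homog W 2 f" and a: "a < n"
  shows "pb f (mfps_var a) = lin n (ham_matrix f a)"
proof -
  have "homog (\<lambda>_. 1) 1 (pb f (mfps_var a))"
  proof (cases "a < 2*l")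
    case True
    then show ?thesis using homog_pb_var[of 0 f a] f a
      by (intro weight_1_degree_1) (simp add: W_def numeral_2_eq_2)
  next
    case False
    show ?thesis unfolding poisson_bracket_var_right[OF a]
    proof (rule homog_sum)
      fix b assume b: "b \<in> {..<n}"
      show "homog (\<lambda>_. 1) 1 (P b a * mfps_deriv b f)"
      proof (cases "b < 2*l")
        case True
        then show ?thesis using False by (simp add: P_mixed)
      next
        case bz: False
        have z: "homog (\<lambda>_. 1) 1 (P b a)"
          using False bz unfolding P_eq z_bracket_def
          by (auto intro!: homog_sum homog_const_mult homog_var[of "\<lambda>_. Suc 0", simplified])
        obtain r where "mfps_deriv b f = mfps_const r" using weight_2_deriv_z[OF f(2), of b] bz by auto
        then show ?thesis using homog_const_mult[OF z, of r] by (simp add: mult.commute)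
      qed
    qed
  qed
  moreover have "pb f (mfps_var a) \<in> formal_functions n" using a f by (intro formal_pb) auto
  moreover have "lin n (ham_matrix f a) = lin n (\<lambda>b. mfps_coeff (pb f (mfps_var a)) {#b#})"
    by (intro lin_cong) (simp add: ham_matrix_def)
  ultimately show ?thesis
    using degree_one_eq_lin[of "pb f (mfps_var a)" n] wt_proj_homog[of "\<lambda>_. 1" 1 "pb f (mfps_var a)" 1]
    by simp
qed

lemma weight_2_linear_op:
  assumes "f \<in> formal_functions n" "homog W 2 f"
  shows "pb f g = linear_op n (ham_matrix f) g"
  unfolding linear_op_def
  by (subst poisson_bracket_vf) (intro vf_apply_cong weight_2_hamiltonian_linear assms)

lemma mfps_bilinear_pb: "mfps_bilinear pb"
  by (simp add: mfps_bilinear_def)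

text \<open>Symplectic entries of \<open>P\<close> are constant and the others linear. This is the
  affine shape required by \<open>fc_derivation\<close>.\<close>

lemma pb_lin_lin: "\<exists>d x. pb (lin n u) (lin n w) = mfps_const d + lin n x"
proof -
  have "\<exists>d x. P a b = mfps_const d + lin n x" for a b
  proof (cases "a < 2*l")
    case True
    then obtain r where "P a b = mfps_const r" using P_xy by blast
    then have "P a b = mfps_const r + lin n (\<lambda>_. 0)" by (simp add: lin_def mfps_const_simps)
    then show ?thesis by blast
  next
    case False
    have "\<exists>x. z_bracket i j = lin n x" for i j
    proof -
      have "homog (\<lambda>_. 1) 1 (z_bracket i j)" unfolding z_bracket_def
        by (auto intro!: homog_sum homog_const_mult homog_var[of "\<lambda>_. Suc 0", simplified])
      then show ?thesis using degree_one_eq_lin[OF formal_z_bracket, of i j]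
          wt_proj_homog[of "\<lambda>_. 1" 1 "z_bracket i j" 1] by (auto intro: sym)
    qed
    then obtain x where "(if 2*l \<le> a \<and> a < n \<and> 2*l \<le> b \<and> b < n
        then z_bracket (a - 2*l) (b - 2*l) else 0) = lin n x"
      by (metis (mono_tags) lin_minus diff_self)
    then have "P a b = mfps_const (0 - (if b < l \<and> a = l + b then 1 else 0)) + lin n x"
      using False by (auto simp: P_eq mfps_const_simps)
    then show ?thesis by blast
  qed
  then obtain d x where dx: "P a b = mfps_const (d a b) + lin n (x a b)" for a b by metis
  have "pb (lin n u) (lin n w) = (\<Sum>b<n. \<Sum>a<n. mfps_const (w b) * (mfps_const (u a) * P a b))"
    by (simp add: lin_def poisson_bracket_var_var sum_distrib_left)
  also have "\<dots> = mfps_const (\<Sum>b<n. \<Sum>a<n. w b * (u a * d a b))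
      + lin n (\<lambda>k. \<Sum>b<n. \<Sum>a<n. w b * (u a * x a b k))"
    by (simp add: dx mfps_const_simps mfps_const_sum lin_sum lin_const_mult distrib_left sum.distrib)
  finally show ?thesis by blast
qed

end

section \<open>Engel's theorem and perfect ideals\<close>

locale fd_lie_algebra = lie_algebra scale br + finite_dimensional_vector_space scale Basis
  for scale :: "'k::field \<Rightarrow> 'g::ab_group_add \<Rightarrow> 'g" and br and Basis
begin

lemma br_zero [simp]: "br 0 x = 0" "br x 0 = 0"
  using br_add_left[of 0 0 x] br_add_right[of x 0 0] by simp_all

lemma br_skew: "br x y = - br y x"
proof -
  have "br x x + br x y + (br y x + br y y) = 0"
    using br_self[of "x + y"] unfolding br_add_left br_add_right by (simp only: ac_simps)
  then have "br x y + br y x = 0" by (simp add: br_self)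
  then show ?thesis by (simp only: eq_neg_iff_add_eq_0)
qed

lemma br_uminus [simp]: "br (- x) y = - br x y" "br x (- y) = - br x y"
  using br_add_left[of x "- x" y] br_add_right[of x y "- y"] by (simp_all add: eq_neg_iff_add_eq_0 add.commute)

lemma br_leibniz: "br x (br y z) = br (br x y) z + br y (br x z)"
proof -
  have "br x (br y z) = - br y (br z x) - br z (br x y)"
    using jacobi[of x y z] by (simp add: algebra_simps eq_neg_iff_add_eq_0)
  then show ?thesis using br_skew[of z x] br_skew[of z "br x y"] by simp
qed

definition subalgebra :: "'g set \<Rightarrow> bool"
  where "subalgebra L \<longleftrightarrow> subspace L \<and> (\<forall>x\<in>L. \<forall>y\<in>L. br x y \<in> L)"

definition ad_nilpotent :: "'g \<Rightarrow> bool"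
  where "ad_nilpotent x \<longleftrightarrow> (\<forall>y. \<exists>k. (br x ^^ k) y = 0)"

lemma span_insert_subspace:
  assumes "subspace M" "x \<in> span (insert y M)"
  obtains a z where "z \<in> M" "x = scale a y + z"
proof -
  from assms(2) obtain a where "x - scale a y \<in> span M" by (auto simp: span_insert)
  then have "x - scale a y \<in> M" using assms(1) by (simp add: span_eq_iff[THEN iffD2])
  then show ?thesis using that[of "x - scale a y" a] by simp
qed

lemma dim_less_subspace:
  assumes "subspace S" "subspace T" "S \<subset> T"
  shows "dim S < dim T"
  using assms by (intro dim_psubset) (simp add: span_eq_iff[THEN iffD2])

text \<open>In finite dimension a member of largest dimension is maximal for inclusion.\<close>

lemma maximal_subspace:
  assumes "P {0}" "\<And>M. P M \<Longrightarrow> subspace M" "\<And>M. P M \<Longrightarrow> M \<subseteq> V"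
  obtains M where "P M" "\<And>M'. P M' \<Longrightarrow> M \<subseteq> M' \<Longrightarrow> M' = M"
proof -
  have "\<exists>M. P M \<and> (\<forall>M'. P M' \<longrightarrow> dim M' \<le> dim M)"
    using assms(1) by (rule ex_has_greatest_nat[of P _ dim "Suc dimension"])
      (auto simp: less_Suc_eq_le intro: dim_subset_UNIV)
  then obtain M where M: "P M" "\<And>M'. P M' \<Longrightarrow> dim M' \<le> dim M" by blast
  show ?thesis
  proof (rule that[OF M(1)])
    fix M' assume "P M'" "M \<subseteq> M'"
    then show "M' = M" using dim_less_subspace[of M M'] M assms(2) by force
  qed
qed

text \<open>A relative form of Engel's theorem for the adjoint representation: speaking of \<open>U \<subset> V\<close>
  instead of \<open>V/U\<close> avoids quotients in the induction.\<close>

theorem engel_relative: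
  assumes "subalgebra L" "\<And>x. x \<in> L \<Longrightarrow> ad_nilpotent x"
    and "subspace U" "subspace V" "U \<subset> V"
    and "\<And>x v. x \<in> L \<Longrightarrow> v \<in> V \<Longrightarrow> br x v \<in> V" "\<And>x u. x \<in> L \<Longrightarrow> u \<in> U \<Longrightarrow> br x u \<in> U"
  shows "\<exists>v\<in>V - U. \<forall>x\<in>L. br x v \<in> U"
  using assms
proof (induction "dim L" arbitrary: L U V rule: less_induct)
  case less
  note L = less.prems(1,2) and UV = less.prems(3-7)
  have sL: "subspace L" using L by (simp add: subalgebra_def)
  have U0: "0 \<in> U" using UV(1) by (rule subspace_0)
  show ?case
  proof (cases "L = {0}")
    case True
    from UV obtain v where "v \<in> V - U" by blast
    then show ?thesis using True U0 by auto
  next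
    case False
    obtain M where M: "subalgebra M \<and> M \<subset> L"
      and max: "\<And>M'. subalgebra M' \<and> M' \<subset> L \<Longrightarrow> M \<subseteq> M' \<Longrightarrow> M' = M"
    proof (rule maximal_subspace[of "\<lambda>M. subalgebra M \<and> M \<subset> L" L])
      show "subalgebra {0} \<and> {0} \<subset> L"
        using False subspace_0[OF sL] by (auto simp: subalgebra_def)
    qed (auto simp: subalgebra_def)
    have sM: "subspace M" and MinL: "M \<subset> L" using M by (auto simp: subalgebra_def)
    have dM: "dim M < dim L" by (rule dim_less_subspace) fact+
    \<comment> \<open>The induction hypothesis for \<open>M\<close> acting on \<open>L\<close>
      relative to \<open>M\<close> itself gives an element that normalises \<open>M\<close>. By
      maximality it spans \<open>L\<close> together with \<open>M\<close>.\<close>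
    have "\<exists>y\<in>L - M. \<forall>x\<in>M. br x y \<in> M"
      by (rule less.hyps[OF dM]) (use M L sM sL MinL in \<open>auto simp: subalgebra_def\<close>)
    then obtain y where y: "y \<in> L" "y \<notin> M" "\<And>x. x \<in> M \<Longrightarrow> br x y \<in> M" by blast
    let ?M' = "span (insert y M)"
    have M'L: "?M' \<subseteq> L" using y MinL sL by (intro span_minimal) auto
    have "subalgebra ?M'"
      unfolding subalgebra_def
    proof (intro conjI ballI)
      fix p q assume "p \<in> ?M'" "q \<in> ?M'"
      then obtain a u b w where pq: "u \<in> M" "p = scale a y + u" "w \<in> M" "q = scale b y + w"
        using span_insert_subspace[OF sM] by metis
      have yM: "br y x \<in> M" if "x \<in> M" for x
        using y(3)[OF that] br_skew[of y x] subspace_neg[OF sM] by simp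
      have "br p q = scale a (br y w) + scale b (br u y) + br u w"
        by (simp add: pq br_add_left br_add_right br_scale_left br_scale_right br_self)
      moreover have "br u w \<in> M" using M pq by (auto simp: subalgebra_def)
      ultimately have "br p q \<in> M"
        using pq y(3) yM by (auto intro!: subspace_add[OF sM] subspace_scale[OF sM])
      then show "br p q \<in> ?M'" by (auto intro: span_base)
    qed simp
    moreover have "M \<subseteq> ?M'" "?M' \<noteq> M" using y(2) span_superset[of "insert y M"] by auto
    ultimately have LM: "?M' = L" using max[of ?M'] M'L by blast
    have "\<exists>v\<in>V - U. \<forall>x\<in>M. br x v \<in> U"
      by (rule less.hyps[OF dM]) (use M L MinL UV in \<open>auto simp: subset_iff psubset_eq\<close>)
    then obtain v where v: "v \<in> V" "v \<notin> U" "\<And>x. x \<in> M \<Longrightarrow> br x v \<in> U" by blast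
    \<comment> \<open>Since \<open>y\<close> normalises \<open>M\<close>, applying
      \<open>br y\<close> repeatedly keeps the vector annihilated by \<open>M\<close> modulo
      \<open>U\<close>. As \<open>y\<close> acts nilpotently, the sequence enters \<open>U\<close>;
      its last member outside \<open>U\<close> is annihilated by \<open>y\<close> as well.\<close>
    define w where "w = (\<lambda>k. (br y ^^ k) v)"
    have w: "w k \<in> V \<and> (\<forall>x\<in>M. br x (w k) \<in> U)" for k
    proof (induction k)
      case (Suc k)
      have "br x (w (Suc k)) \<in> U" if "x \<in> M" for x
      proof -
        have "br x (w (Suc k)) = br (br x y) (w k) + br y (br x (w k))"
          unfolding w_def by (simp add: br_leibniz[of x y])
        then show ?thesis using Suc y that UV(1,5) by (auto intro: subspace_add)
      qed
      moreover have "w (Suc k) \<in> V" using Suc y UV by (simp add: w_def)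
      ultimately show ?case by blast
    qed (use v in \<open>simp add: w_def\<close>)
    obtain k where "w k = 0" using L(2)[OF y(1)] unfolding ad_nilpotent_def w_def by blast
    then have "w k \<in> U" using U0 by simp
    define j where "j = (LEAST k. w k \<in> U)"
    have j: "w j \<in> U" unfolding j_def by (rule LeastI) fact
    moreover have "w 0 \<notin> U" using v by (simp add: w_def)
    ultimately obtain i where i: "j = Suc i" by (cases j) auto
    have "w i \<notin> U" unfolding i[unfolded j_def] using not_less_Least[of i "\<lambda>k. w k \<in> U"] i j_def by simp
    moreover have "br x (w i) \<in> U" if "x \<in> L" for x
    proof -
      from that LM obtain a u where "u \<in> M" "x = scale a y + u"
        using span_insert_subspace[OF sM] by metis
      moreover have "br y (w i) \<in> U" using j i by (simp add: w_def)
      ultimately show ?thesis using w[of i] UV(1)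
        by (auto simp: br_add_left br_scale_left intro!: subspace_add subspace_scale)
    qed
    ultimately show ?thesis using w[of i] by blast
  qed
qed

text \<open>Take a maximal proper invariant subspace \<open>U\<close> of \<open>J\<close>. Engel's
  theorem gives a vector outside \<open>U\<close> that \<open>J\<close> moves into \<open>U\<close>;
  together with \<open>U\<close> it spans \<open>J\<close>, so all brackets lie in \<open>U\<close>,
  against perfectness.\<close>

lemma perfect_ad_nilpotent_trivial:
  assumes "subalgebra J" "derived_algebra J = J" "\<And>x. x \<in> J \<Longrightarrow> ad_nilpotent x"
  shows "J = {0}"
proof (rule ccontr)
  assume J0: "J \<noteq> {0}"
  have sJ: "subspace J" using assms(1) by (simp add: subalgebra_def)
  let ?P = "\<lambda>U. subspace U \<and> U \<subset> J \<and> (\<forall>x\<in>J. \<forall>u\<in>U. br x u \<in> U)"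
  obtain U where U: "?P U" and max: "\<And>U'. ?P U' \<Longrightarrow> U \<subseteq> U' \<Longrightarrow> U' = U"
  proof (rule maximal_subspace[of ?P J])
    show "?P {0}" using J0 subspace_0[OF sJ] by auto
    show "\<And>M. ?P M \<Longrightarrow> subspace M" "\<And>M. ?P M \<Longrightarrow> M \<subseteq> J" by blast+
    fix U assume "?P U" "\<And>U'. ?P U' \<Longrightarrow> U \<subseteq> U' \<Longrightarrow> U' = U"
    then show thesis by (rule that)
  qed
  have "\<exists>v\<in>J - U. \<forall>x\<in>J. br x v \<in> U"
    by (rule engel_relative) (use assms U sJ in \<open>auto simp: subalgebra_def\<close>)
  then obtain v where v: "v \<in> J" "v \<notin> U" "\<And>x. x \<in> J \<Longrightarrow> br x v \<in> U" by blast
  let ?U' = "span (insert v U)"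
  have brU: "br x y \<in> U" if "x \<in> J" "y \<in> ?U'" for x y
  proof -
    from that U obtain a u where "u \<in> U" "y = scale a v + u"
      using span_insert_subspace[of U y v] by metis
    then show ?thesis using U v that
      by (auto simp: br_add_right br_scale_right intro!: subspace_add subspace_scale)
  qed
  have "?U' \<subseteq> J" using v U sJ by (intro span_minimal) auto
  moreover have "U \<subseteq> ?U'" "?U' \<noteq> U" using v(2) span_superset[of "insert v U"] by auto
  ultimately have "?U' = J"
    using max[of ?U'] brU by (metis (no_types, lifting) psubsetI span_superset subset_iff subspace_span insert_subset)
  then have "derived_algebra J \<subseteq> U"
    unfolding derived_algebra_def using U brU by (intro span_minimal) auto
  with U show False using assms(2) by blast
qed

lemma lie_ideal_derived:
  assumes "lie_ideal I"
  shows "lie_ideal (derived_algebra I)" "derived_algebra I \<subseteq> I"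
proof -
  have sI: "subspace I" and I: "\<And>x y. y \<in> I \<Longrightarrow> br x y \<in> I" using assms by (auto simp: lie_ideal_def)
  show "derived_algebra I \<subseteq> I"
    unfolding derived_algebra_def using sI I by (intro span_minimal) auto
  show "lie_ideal (derived_algebra I)"
    unfolding lie_ideal_def
  proof (intro conjI allI ballI)
    show "subspace (derived_algebra I)" unfolding derived_algebra_def by (rule subspace_span)
    fix x y assume "y \<in> derived_algebra I"
    then have "y \<in> span {br x y |x y. x \<in> I \<and> y \<in> I}" by (simp add: derived_algebra_def)
    then show "br x y \<in> derived_algebra I"
    proof (induction rule: span_induct)
      case base
      show ?case
        by (auto simp: subspace_def br_add_right br_scale_right derived_algebra_def
            intro: span_add span_scale span_zero)
    next
      case (step y)
      then obtain a b where ab: "a \<in> I" "b \<in> I" "y = br a b" by blast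
      show ?case unfolding ab(3) br_leibniz[of x a b] derived_algebra_def
        using ab I by (intro span_add span_base) blast+
    qed
  qed
qed

text \<open>The derived series of \<open>I\<close> consists of ideals and becomes stationary by
  dimension. Its last term is perfect, and nonzero because \<open>I\<close> is not solvable.\<close>

lemma semisimple_perfect_ideal:
  assumes "semisimple" "lie_ideal I" "I \<noteq> {0}"
  obtains J where "lie_ideal J" "J \<subseteq> I" "J \<noteq> {0}" "derived_algebra J = J"
proof -
  define D where "D = (\<lambda>k. (derived_algebra ^^ k) I)"
  have D: "lie_ideal (D k) \<and> D k \<subseteq> I" for k
    by (induction k) (use assms lie_ideal_derived in \<open>auto simp: D_def\<close>)
  have D0: "D k \<noteq> {0}" for k using assms by (auto simp: semisimple_def solvable_def D_def)
  obtain k where k: "\<And>j. dim (D k) \<le> dim (D j)"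
    using ex_has_least_nat[of "\<lambda>_. True" 0 "\<lambda>k. dim (D k)"] by auto
  have DS: "D (Suc k) = derived_algebra (D k)" by (simp add: D_def)
  have "D (Suc k) = D k"
    using dim_less_subspace[of "D (Suc k)" "D k"] k[of "Suc k"] D[of k] D[of "Suc k"]
      lie_ideal_derived[of "D k"]
    unfolding DS by (auto simp: lie_ideal_def)
  then show ?thesis using that[of "D k"] D[of k] D0[of k] DS by simp
qed

end

section \<open>The Killing form\<close>

definition mat_mult :: "nat \<Rightarrow> (nat \<Rightarrow> nat \<Rightarrow> 'a::comm_ring_1) \<Rightarrow> (nat \<Rightarrow> nat \<Rightarrow> 'a) \<Rightarrow> nat \<Rightarrow> nat \<Rightarrow> 'a"
  where "mat_mult n A B = (\<lambda>a b. \<Sum>i<n. A a i * B i b)"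

definition trace_prod :: "nat \<Rightarrow> (nat \<Rightarrow> nat \<Rightarrow> 'a::comm_ring_1) \<Rightarrow> (nat \<Rightarrow> nat \<Rightarrow> 'a) \<Rightarrow> 'a"
  where "trace_prod n A B = (\<Sum>a<n. \<Sum>b<n. A a b * B b a)"

lemma trace_prod_sym: "trace_prod n A B = trace_prod n B A"
  unfolding trace_prod_def by (subst sum.swap) (simp add: mult.commute)

lemma trace_prod_minus_left:
  "trace_prod n (\<lambda>a b. A a b - A' a b) B = trace_prod n A B - trace_prod n A' B"
  by (simp add: trace_prod_def left_diff_distrib sum_subtractf)

lemma trace_prod_add_left:
  "trace_prod n (\<lambda>a b. A a b + A' a b) B = trace_prod n A B + trace_prod n A' B"
  by (simp add: trace_prod_def distrib_right sum.distrib)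

lemma trace_prod_scale_left:
  "trace_prod n (\<lambda>a b. r * A a b) B = r * trace_prod n A B"
  by (simp add: trace_prod_def sum_distrib_left mult.assoc)

lemma trace_prod_cong:
  "(\<And>a b. a < n \<Longrightarrow> b < n \<Longrightarrow> A a b = A' a b) \<Longrightarrow> trace_prod n A B = trace_prod n A' B"
  by (simp add: trace_prod_def)

lemma trace_prod_zero_left: "trace_prod n (\<lambda>a b. 0) B = 0"
  by (simp add: trace_prod_def)

lemma trace_prod_sum_left:
  "trace_prod n (\<lambda>a b. \<Sum>x\<in>X. A x a b) B = (\<Sum>x\<in>X. trace_prod n (A x) B)"
  by (induction X rule: infinite_finite_induct)
    (simp_all add: trace_prod_zero_left trace_prod_add_left)

lemma trace_prod_mat_mult: "trace_prod n (mat_mult n A B) C = trace_prod n A (mat_mult n B C)"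
  unfolding trace_prod_def mat_mult_def sum_distrib_left sum_distrib_right
  by (rule sum.cong[OF refl], subst sum.swap) (simp add: mult_ac)

text \<open>Cyclicity of the trace lets a commutator be moved to the other factor. Invariance of the
  Killing form, innerness of derivations and Cartan's criterion all rest on this.\<close>

lemma trace_prod_commutator:
  "trace_prod n (\<lambda>a b. mat_mult n Z E a b - mat_mult n E Z a b) Y
    = trace_prod n E (\<lambda>a b. mat_mult n Y Z a b - mat_mult n Z Y a b)"
proof -
  have "trace_prod n (mat_mult n Z E) Y = trace_prod n E (mat_mult n Y Z)"
    by (metis trace_prod_mat_mult trace_prod_sym)
  moreover have "trace_prod n (mat_mult n E Z) Y = trace_prod n E (mat_mult n Z Y)"
    by (rule trace_prod_mat_mult)
  ultimately show ?thesis
    by (simp only: trace_prod_minus_left trace_prod_sym[of n E])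
qed

text \<open>Composition of operators reverses the matrix product, as rows are components. This
  determines the order of the factors in the commutators below.\<close>

lemma linear_op_linear_op_var:
  "a < n \<Longrightarrow> linear_op n A (linear_op n B (mfps_var a)) = lin n (mat_mult n B A a)"
  by (simp add: linear_op_lin mat_mult_def)

context lie_poisson
begin

definition zform :: "(nat \<Rightarrow> 'a) \<Rightarrow> 'a mfps"
  where "zform u = (\<Sum>i<m. mfps_const (u i) * mfps_var (2*l + i))"

lemma zform_formal [simp, intro]: "zform u \<in> formal_functions n"
  unfolding zform_def by (intro formal_functions_sum formal_functions_times) auto

lemma zform_homog [simp, intro]: "homog W 2 (zform u)"
  unfolding zform_def
proof (intro homog_sum homog_const_mult)
  fix i
  show "homog W 2 (mfps_var (2*l + i))" using homog_var[of W "2*l + i"] by (simp add: W_def)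
qed

lemma mfps_coeff_zform: "i < m \<Longrightarrow> mfps_coeff (zform u) {#2*l + i#} = u i"
  by (simp add: zform_def mfps_coeff_var if_distrib cong: if_cong)

lemma zform_var: "i < m \<Longrightarrow> zform (\<lambda>j. if j = i then 1 else 0) = mfps_var (2*l + i)"
  by (simp add: zform_def if_distrib[of mfps_const] mfps_const_simps if_distrib[of "\<lambda>x. x * _"] cong: if_cong)

lemma zform_add: "zform (\<lambda>i. u i + v i) = zform u + zform v"
  by (simp add: zform_def mfps_const_simps distrib_right sum.distrib)

lemma zform_minus: "zform (\<lambda>i. u i - v i) = zform u - zform v"
  by (simp add: zform_def mfps_const_simps left_diff_distrib sum_subtractf)

lemma zform_sum: "zform (\<lambda>i. \<Sum>x\<in>X. u x i) = (\<Sum>x\<in>X. zform (u x))"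
  unfolding zform_def mfps_const_sum sum_distrib_right by (rule sum.swap)

lemma zform_scale: "zform (\<lambda>i. r * u i) = mfps_const r * zform u"
  by (simp add: zform_def mfps_const_simps sum_distrib_left mult.assoc)

lemma pb_zform_zform:
  "pb (zform u) (zform v) = zform (\<lambda>k. \<Sum>i<m. \<Sum>j<m. u i * v j * c i j k)"
proof -
  have "pb (zform u) (zform v)
      = (\<Sum>j<m. \<Sum>i<m. mfps_const (v j) * (mfps_const (u i) * z_bracket i j))"
    by (simp add: zform_def poisson_bracket_var_var P_zz sum_distrib_left)
  also have "\<dots> = (\<Sum>j<m. \<Sum>i<m. zform (\<lambda>k. u i * v j * c i j k))"
    by (intro sum.cong refl)
      (simp add: z_bracket_def zform_def sum_distrib_left mfps_const_simps mult_ac)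
  also have "\<dots> = zform (\<lambda>k. \<Sum>j<m. \<Sum>i<m. u i * v j * c i j k)"
    unfolding zform_sum ..
  finally show ?thesis by (subst (asm) sum.swap) simp
qed

lemma pb_zform_xy: "a < 2*l \<Longrightarrow> pb (zform u) (mfps_var a) = 0"
  by (simp add: zform_def poisson_bracket_var_var P_mixed)

lemma ham_matrix_add: "ham_matrix (f + g) = (\<lambda>a b. ham_matrix f a b + ham_matrix g a b)"
  by (simp add: ham_matrix_def fun_eq_iff)

lemma ham_matrix_sum: "ham_matrix (\<Sum>x\<in>X. f x) = (\<lambda>a b. \<Sum>x\<in>X. ham_matrix (f x) a b)"
  by (simp add: ham_matrix_def fun_eq_iff)

lemma ham_matrix_scale: "ham_matrix (mfps_const r * f) = (\<lambda>a b. r * ham_matrix f a b)"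
  by (simp add: ham_matrix_def fun_eq_iff)

lemma ham_matrix_xy: "k < 2*l \<Longrightarrow> b < n \<Longrightarrow> ham_matrix (mfps_var k) b a = 0"
  using P_xy[of k b] by (auto simp: ham_matrix_def poisson_bracket_var_var mfps_coeff_const)

text \<open>On \<open>zform\<close>s this is the Killing form of the Lie algebra: their fields
  vanish on symplectic variables and map Lie algebra variables to such forms, so the trace over all
  \<open>n\<close> coordinates is the trace over the adjoint block.\<close>

definition killing :: "'a mfps \<Rightarrow> 'a mfps \<Rightarrow> 'a"
  where "killing f g = trace_prod n (ham_matrix f) (ham_matrix g)"

lemma killing_sym: "killing f g = killing g f"
  unfolding killing_def by (rule trace_prod_sym)

lemma killing_add_left: "killing (f + g) h = killing f h + killing g h"
  unfolding killing_def ham_matrix_add by (rule trace_prod_add_left)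

lemma killing_scale_left: "killing (mfps_const r * f) h = r * killing f h"
  unfolding killing_def ham_matrix_scale by (rule trace_prod_scale_left)

lemma killing_zero_left: "killing 0 h = 0"
  using killing_scale_left[of 0 0 h] by (simp add: mfps_const_simps)

lemma killing_sum_left: "killing (\<Sum>x\<in>X. f x) h = (\<Sum>x\<in>X. killing (f x) h)"
  by (induction X rule: infinite_finite_induct) (simp_all add: killing_zero_left killing_add_left)

text \<open>For a derivation \<open>E\<close> of the bracket, the field of \<open>E f\<close> is the
  commutator of \<open>E\<close> with the field of \<open>f\<close>; the product of matrices appears
  in reversed order.\<close>

lemma ham_matrix_derivation:
  assumes f: "f \<in> formal_functions n" "homog W 2 f"
    and E: "\<And>a. a < n \<Longrightarrow> linear_op n E (pb f (mfps_var a))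
      = pb (linear_op n E f) (mfps_var a) + pb f (linear_op n E (mfps_var a))"
    and "a < n" "b < n"
  shows "ham_matrix (linear_op n E f) a b
    = mat_mult n (ham_matrix f) E a b - mat_mult n E (ham_matrix f) a b"
proof -
  have "pb (linear_op n E f) (mfps_var a)
      = linear_op n E (linear_op n (ham_matrix f) (mfps_var a))
        - linear_op n (ham_matrix f) (linear_op n E (mfps_var a))"
    using E[OF \<open>a < n\<close>] by (simp only: weight_2_linear_op[OF f] add_diff_cancel)
  then show ?thesis
    unfolding linear_op_linear_op_var[OF \<open>a < n\<close>] ham_matrix_def[of "linear_op n E f"]
    using \<open>b < n\<close> by simp
qed

lemma ham_matrix_bracket:
  assumes f: "f \<in> formal_functions n" "homog W 2 f" and g: "g \<in> formal_functions n" "homog W 2 g"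
    and "a < n" "b < n"
  shows "ham_matrix (pb f g) a b
    = mat_mult n (ham_matrix g) (ham_matrix f) a b - mat_mult n (ham_matrix f) (ham_matrix g) a b"
proof -
  have "linear_op n (ham_matrix f) = pb f"
    using weight_2_linear_op[OF f] by (simp add: fun_eq_iff)
  from ham_matrix_derivation[OF g, of "ham_matrix f" a b, unfolded this, OF pb_jacobi assms(5,6)]
  show ?thesis .
qed

lemma killing_invariant:
  assumes f: "f \<in> formal_functions n" "homog W 2 f" and g: "g \<in> formal_functions n" "homog W 2 g"
    and h: "h \<in> formal_functions n" "homog W 2 h"
  shows "killing (pb f g) h = killing f (pb g h)"
proof -
  let ?F = "ham_matrix f" and ?G = "ham_matrix g" and ?H = "ham_matrix h"
  have "killing (pb f g) h = trace_prod n (\<lambda>a b. mat_mult n ?G ?F a b - mat_mult n ?F ?G a b) ?H"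
    unfolding killing_def by (intro trace_prod_cong ham_matrix_bracket f g)
  also have "\<dots> = trace_prod n (\<lambda>a b. mat_mult n ?H ?G a b - mat_mult n ?G ?H a b) ?F"
    by (subst trace_prod_commutator) (rule trace_prod_sym)
  also have "\<dots> = killing (pb g h) f"
    unfolding killing_def by (intro trace_prod_cong ham_matrix_bracket[symmetric] g h)
  finally show ?thesis by (simp add: killing_sym)
qed

text \<open>The functional sending \<open>z\<close> to the trace of \<open>D\<close> against the
  field of \<open>z\<close> is represented by some \<open>t\<close>, as the Killing form is
  nondegenerate. The difference \<open>E\<close> of \<open>D\<close> and the inner derivation of
  \<open>t\<close> then has trace 0 against all inner derivations, which forces \<open>E = 0\<close>
  by invariance.\<close>

lemma derivation_inner:
  assumes nondeg: "\<And>u. (\<And>j. j < m \<Longrightarrow> killing (zform u) (mfps_var (2*l + j)) = 0) \<Longrightarrow> zform u = 0"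
    and D: "\<And>a b. a < n \<Longrightarrow> b < n \<Longrightarrow> linear_op n D (pb (mfps_var a) (mfps_var b))
      = pb (linear_op n D (mfps_var a)) (mfps_var b) + pb (mfps_var a) (linear_op n D (mfps_var b))"
    and D_xy: "\<And>a. a < 2*l \<Longrightarrow> linear_op n D (mfps_var a) = 0"
    and D_z: "\<And>i. i < m \<Longrightarrow> \<exists>u. linear_op n D (mfps_var (2*l + i)) = zform u"
  shows "\<exists>t. \<forall>a<n. linear_op n D (mfps_var a) = pb (zform t) (mfps_var a)"
proof -
  let ?z = "\<lambda>i. mfps_var (2*l + i) :: 'a mfps"
  have z: "?z i \<in> formal_functions n" "homog W 2 (?z i)" if "i < m" for i
    using zform_formal[of "\<lambda>j. if j = i then 1 else 0"] zform_homog[of "\<lambda>j. if j = i then 1 else 0"]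
    by (simp_all only: zform_var[OF that])
  \<comment> \<open>The Gram matrix of the Killing form; a kernel vector would be a nonzero element
    of the radical.\<close>
  define K where "K = mat m m (\<lambda>(j, i). killing (?z i) (?z j))"
  have K: "K \<in> carrier_mat m m" by (simp add: K_def)
  have Kv: "(K *\<^sub>v vec m u) $ j = killing (zform u) (?z j)" if "j < m" for u j
    using that by (simp add: K_def scalar_prod_def lessThan_atLeast0[symmetric] zform_def killing_sum_left
        killing_scale_left mult.commute)
  have "det K \<noteq> 0"
  proof
    assume "det K = 0"
    then obtain v where v: "v \<in> carrier_vec m" "v \<noteq> 0\<^sub>v m" "K *\<^sub>v v = 0\<^sub>v m"
      using det_0_iff_vec_prod_zero_field[OF K] by blast
    have vv: "v = vec m (\<lambda>i. v $ i)" using v(1) by auto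
    have "zform (\<lambda>i. v $ i) = 0"
      by (rule nondeg) (metis Kv v(3) vv index_zero_vec(1))
    then have "v $ i = 0" if "i < m" for i
      using mfps_coeff_zform[OF that, of "\<lambda>i. v $ i"] by simp
    then have "v = 0\<^sub>v m" using v(1) by auto
    with v(2) show False ..
  qed
  from det_non_zero_imp_unit[OF K this, of undefined] obtain K' where
    K': "K' \<in> carrier_mat m m" "K * K' = 1\<^sub>m m"
    by (auto simp: Units_def ring_mat_def)
  define d where "d = vec m (\<lambda>j. trace_prod n D (ham_matrix (?z j)))"
  have d: "d \<in> carrier_vec m" by (simp add: d_def)
  define t where "t = (\<lambda>i. (K' *\<^sub>v d) $ i)"
  have "vec m t = K' *\<^sub>v d" using K' d by (auto simp: t_def)
  then have "K *\<^sub>v vec m t = d" using K K' d by (simp flip: assoc_mult_mat_vec)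
  then have t: "killing (zform t) (?z j) = trace_prod n D (ham_matrix (?z j))" if "j < m" for j
    using Kv[OF that, of t] that by (simp add: d_def)
  define E where "E = (\<lambda>a b. D a b - ham_matrix (zform t) a b)"
  have E: "linear_op n E f = linear_op n D f - pb (zform t) f" for f
    unfolding weight_2_linear_op[OF zform_formal zform_homog] E_def linear_op_def lin_minus
    by (rule vf_apply_fields_minus)
  have Eder: "linear_op n E (pb (mfps_var a) (mfps_var b))
      = pb (linear_op n E (mfps_var a)) (mfps_var b) + pb (mfps_var a) (linear_op n E (mfps_var b))"
    if "a < n" "b < n" for a b
    unfolding E D[OF that] pb_jacobi[of "zform t"] by simp
  have E0: "trace_prod n E (ham_matrix (?z j)) = 0" if "j < m" for j
    using t[OF that] unfolding E_def killing_def by (simp add: trace_prod_minus_left)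
  have E0': "trace_prod n E (ham_matrix (zform u)) = 0" for u
  proof -
    have "trace_prod n (ham_matrix (zform u)) E = (\<Sum>i<m. u i * trace_prod n (ham_matrix (?z i)) E)"
      unfolding zform_def ham_matrix_sum ham_matrix_scale trace_prod_sum_left trace_prod_scale_left ..
    also have "\<dots> = 0" by (rule sum.neutral) (use E0 in \<open>auto simp: trace_prod_sym[of n _ E]\<close>)
    finally show ?thesis by (simp add: trace_prod_sym)
  qed
  have "linear_op n E (mfps_var a) = 0" if a: "a < n" for a
  proof (cases "a < 2*l")
    case True
    show ?thesis unfolding E D_xy[OF True] pb_zform_xy[OF True] by simp
  next
    case False
    define i where "i = a - 2*l"
    have i: "a = 2*l + i" "i < m" using False a by (auto simp: i_def)
    obtain u where u: "linear_op n D (?z i) = zform u" using D_z[OF i(2)] by blast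
    define u' where "u' = (\<lambda>k. \<Sum>p<m. \<Sum>j<m. t p * (if j = i then 1 else 0) * c p j k)"
    define w where "w = (\<lambda>k. u k - u' k)"
    have "pb (zform t) (?z i) = zform u'"
      unfolding zform_var[OF i(2), symmetric] u'_def by (rule pb_zform_zform)
    then have w: "linear_op n E (?z i) = zform w"
      unfolding E u w_def zform_minus by (simp only:)
    have "zform w = 0"
    proof (rule nondeg)
      fix j assume j: "j < m"
      \<comment> \<open>The field of \<open>E z_i\<close> is a commutator. Moving it across the
        trace leaves \<open>E\<close> against the field of \<open>{z_i, z_j}\<close>, which is 0 by
        \<open>E0'\<close>.\<close>
      have "killing (zform w) (?z j)
          = trace_prod n (\<lambda>a b. mat_mult n (ham_matrix (?z i)) E a b
              - mat_mult n E (ham_matrix (?z i)) a b) (ham_matrix (?z j))"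
        unfolding killing_def w[symmetric]
        by (intro trace_prod_cong ham_matrix_derivation z i Eder) (use i in auto)
      also have "\<dots> = trace_prod n (ham_matrix (pb (?z i) (?z j))) E"
        by (subst trace_prod_commutator, subst trace_prod_sym[of n E])
          (intro trace_prod_cong ham_matrix_bracket[symmetric] z i j)
      also have "pb (?z i) (?z j) = zform (c i j)"
        using i j by (simp add: pb_var_var P_zz z_bracket_def zform_def)
      finally show "killing (zform w) (?z j) = 0" using E0' by (simp add: trace_prod_sym)
    qed
    then show ?thesis by (simp add: i w)
  qed
  then show ?thesis unfolding E by auto
qed

end

section \<open>Cartan's criterion\<close>

context lie_poisson
begin

lemma zform_cong: "(\<And>i. i < m \<Longrightarrow> u i = v i) \<Longrightarrow> zform u = zform v"
  by (simp add: zform_def)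

lemma ham_matrix_zero: "ham_matrix 0 = (\<lambda>a b. 0)"
  by (simp add: ham_matrix_def fun_eq_iff)

lemma zform_lin: "\<exists>w. zform u = lin n w"
proof -
  have "homog (\<lambda>_. 1) 1 (zform u)" unfolding zform_def
    by (auto intro!: homog_sum homog_const_mult homog_var[of "\<lambda>_. Suc 0", simplified])
  then show ?thesis using degree_one_eq_lin[OF zform_formal, of u]
      wt_proj_homog[of "\<lambda>_. 1" 1 "zform u" 1] by (auto intro: sym)
qed

lemma zform_eq_0: "zform u = 0 \<longleftrightarrow> (\<forall>i<m. u i = 0)"
proof
  assume "zform u = 0"
  then show "\<forall>i<m. u i = 0" using mfps_coeff_zform[of _ u] by simp
qed (simp add: zform_def mfps_const_simps)

end

section \<open>The Lie algebra as linear functions, its complexification, and the nondegenerate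
  Killing form\<close>

locale semisimple_lie_poisson = lie_algebra scale br
  for scale :: "'k::real_or_complex \<Rightarrow> 'g::ab_group_add \<Rightarrow> 'g" and br +
  fixes l m :: nat and e :: "nat \<Rightarrow> 'g" and c :: "nat \<Rightarrow> nat \<Rightarrow> nat \<Rightarrow> 'k"
  assumes constants: "structure_constants m e c" and semisimple: semisimple
begin

lemma basis: "inj_on e {..<m}" "independent (e ` {..<m})" "span (e ` {..<m}) = UNIV"
    and br_basis: "i < m \<Longrightarrow> j < m \<Longrightarrow> br (e i) (e j) = (\<Sum>k<m. scale (c i j k) (e k))"
  using constants by (auto simp: structure_constants_def)

sublocale fd_lie_algebra scale br "e ` {..<m}"
  by unfold_locales (simp_all add: basis)

definition coord :: "'g \<Rightarrow> nat \<Rightarrow> 'k"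
  where "coord x i = representation (e ` {..<m}) x (e i)"

lemma coord_simps [simp]:
  "coord (x + y) i = coord x i + coord y i" "coord (scale a x) i = a * coord x i"
  "coord 0 i = 0" "coord (- x) i = - coord x i"
  by (simp_all add: coord_def representation_add representation_scale representation_zero
      representation_neg basis)

lemma coord_sum [simp]: "coord (\<Sum>x\<in>X. f x) i = (\<Sum>x\<in>X. coord (f x) i)"
  by (induction X rule: infinite_finite_induct) simp_all

lemma coord_basis: "i < m \<Longrightarrow> j < m \<Longrightarrow> coord (e i) j = (if j = i then 1 else 0)"
  using inj_onD[OF basis(1), of i j] by (auto simp: coord_def representation_basis basis)

lemma coord_expansion: "x = (\<Sum>i<m. scale (coord x i) (e i))"
proof -
  have "(\<Sum>b\<in>e ` {..<m}. scale (representation (e ` {..<m}) x b) b) = x"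
    by (rule sum_representation_eq) (simp_all add: basis)
  then show ?thesis by (simp add: sum.reindex[OF basis(1)] coord_def)
qed

lemma coord_combination: "i < m \<Longrightarrow> coord (\<Sum>k<m. scale (a k) (e k)) i = a i"
  by (simp add: coord_basis if_distrib cong: if_cong)

lemma br_sum: "br (\<Sum>x\<in>X. f x) y = (\<Sum>x\<in>X. br (f x) y)" "br y (\<Sum>x\<in>X. f x) = (\<Sum>x\<in>X. br y (f x))"
  by (induction X rule: infinite_finite_induct; simp add: br_add_left br_add_right)+

lemma coord_br_basis: "i < m \<Longrightarrow> j < m \<Longrightarrow> k < m \<Longrightarrow> coord (br (e i) (e j)) k = c i j k"
  by (simp only: br_basis coord_combination)

lemma coord_br:
  assumes "k < m"
  shows "coord (br x y) k = (\<Sum>i<m. \<Sum>j<m. coord x i * coord y j * c i j k)"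
proof -
  have "br x y = (\<Sum>i<m. scale (coord x i) (br (e i) y))"
    by (subst coord_expansion[of x]) (simp only: br_sum br_scale_left)
  moreover have "br (e i) y = (\<Sum>j<m. scale (coord y j) (br (e i) (e j)))" for i
    by (subst coord_expansion[of y]) (simp only: br_sum br_scale_right)
  ultimately have "br x y = (\<Sum>i<m. \<Sum>j<m. scale (coord x i) (scale (coord y j) (br (e i) (e j))))"
    by (simp only: scale_sum_right)
  then show ?thesis using assms by (simp add: coord_br_basis mult.assoc)
qed

sublocale lie_poisson l m c
proof
  fix i j k assume "i < m" "j < m" "k < m"
  then show "c i j k = - c j i k"
    using br_skew[of "e i" "e j"] by (metis coord_br_basis coord_simps(4))
next
  fix i j k q assume *: "i < m" "j < m" "k < m" "q < m"
  have J: "coord (br (e i) (br (e j) (e k))) q = (\<Sum>p<m. c j k p * c i p q)"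
    if "i < m" "j < m" "k < m" for i j k
    using that \<open>q < m\<close>
    by (subst br_basis[of j k]) (simp_all add: br_sum br_scale_right coord_br_basis)
  have "coord (br (e i) (br (e j) (e k)) + br (e j) (br (e k) (e i)) + br (e k) (br (e i) (e j))) q = 0"
    by (simp only: jacobi coord_simps)
  then show "(\<Sum>p<m. c j k p * c i p q + c k i p * c j p q + c i j p * c k p q) = 0"
    using * by (simp add: J sum.distrib)
qed

text \<open>Identifies the Lie algebra with the linear functions of the Lie algebra variables, on
  which the Poisson bracket is the Lie bracket. It connects the abstract ideals with traces of
  matrices.\<close>

definition emb :: "'g \<Rightarrow> 'k mfps"
  where "emb x = zform (coord x)"

lemma emb_br: "emb (br x y) = pb (emb x) (emb y)"
  unfolding emb_def pb_zform_zform by (intro zform_cong coord_br)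

lemma emb_eq_0: "emb x = 0 \<longleftrightarrow> x = 0"
proof
  assume "emb x = 0"
  then have "coord x i = 0" if "i < m" for i using that by (simp add: emb_def zform_eq_0)
  then show "x = 0" by (subst coord_expansion) simp
qed (simp add: emb_def zform_eq_0)

lemma emb_simps [simp]: "emb (x + y) = emb x + emb y" "emb (scale a x) = mfps_const a * emb x"
    "emb 0 = 0"
proof -
  show "emb (x + y) = emb x + emb y"
    unfolding emb_def zform_add[symmetric] by (rule zform_cong) simp
  show "emb (scale a x) = mfps_const a * emb x"
    unfolding emb_def zform_scale[symmetric] by (rule zform_cong) simp
qed (simp add: emb_def zform_eq_0)

lemma emb_basis: "i < m \<Longrightarrow> emb (e i) = mfps_var (2*l + i)"
  unfolding emb_def by (subst zform_var[symmetric]) (auto simp: zform_def coord_basis intro!: sum.cong)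

lemma emb_combination: "emb (\<Sum>k<m. scale (u k) (e k)) = zform u"
  unfolding emb_def zform_def
  by (intro sum.cong refl) (simp only: coord_combination lessThan_iff)

lemma emb_formal [simp, intro]: "emb x \<in> formal_functions n" and emb_homog [simp, intro]: "homog W 2 (emb x)"
  by (simp_all add: emb_def zform_formal)

sublocale tc: coeff_hom "to_complex :: 'k \<Rightarrow> complex"
  by (rule coeff_hom_to_complex)

text \<open>The complexification enters only through its structure constants, which inherit skewness
  and the Jacobi identity; no complex Lie algebra is built.\<close>

sublocale CC: lie_poisson l m "\<lambda>i j k. to_complex (c i j k)"
proof
  fix i j k assume "i < m" "j < m" "k < m"
  then show "to_complex (c i j k) = - to_complex (c j i k)"
    using c_skew by (metis tc.hom_uminus)
next
  fix i j k q assume "i < m" "j < m" "k < m" "q < m"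
  from c_jacobi[OF this]
  have "to_complex (\<Sum>p<m. c j k p * c i p q + c k i p * c j p q + c i j p * c k p q) = 0"
    by (simp add: tc.hom_zero)
  then show "(\<Sum>p<m. to_complex (c j k p) * to_complex (c i p q)
      + to_complex (c k i p) * to_complex (c j p q) + to_complex (c i j p) * to_complex (c k p q)) = 0"
    by (simp add: tc.hom_simps)
qed

lemma complexify_P: "complexify (P a b) = CC.P a b"
  by (simp add: P_eq CC.P_eq z_bracket_def CC.z_bracket_def tc.map_simps tc.map_sum)

lemma complexify_pb: "complexify (pb f g) = CC.pb (complexify f) (complexify g)"
  by (simp add: tc.map_bracket complexify_P)

lemma complexify_ham_matrix: "to_complex (ham_matrix f a b) = CC.ham_matrix (complexify f) a b"
  by (simp add: ham_matrix_def CC.ham_matrix_def tc.map_simps flip: complexify_pb mfps_coeff_map)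
    (simp add: complexify_pb tc.map_simps)

lemma complexify_zform: "complexify (zform u) = CC.zform (\<lambda>i. to_complex (u i))"
  by (simp add: zform_def CC.zform_def tc.map_sum tc.map_simps)

lemma complexify_eq_0: "complexify f = 0 \<Longrightarrow> f = 0"
  using map_retract(1)[of f] map_retract(5) by metis

lemma complexify_killing: "CC.killing (complexify f) (complexify g) = to_complex (killing f g)"
  by (simp add: CC.killing_def killing_def trace_prod_def tc.hom_simps complexify_ham_matrix)

text \<open>Cartan's criterion. For an element \<open>x\<close> of a perfect ideal in the kernel of the Killing form let
  \<open>S\<close> act on each generalised eigenspace of \<open>ad x\<close> as the conjugate eigenvalue. Conjugation being
  additive and generalised eigenspaces multiplying like their eigenvalues add up, \<open>S\<close> is a derivation; hence the trace of \<open>ad x \<circ> S\<close>, which is the sum of the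
  \<open>\<bar>\<lambda>\<bar>\<^sup>2\<close>, vanishes.\<close>

theorem killing_nondegenerate:
  assumes "\<And>j. j < m \<Longrightarrow> killing (zform u) (mfps_var (2*l + j)) = 0"
  shows "zform u = 0"
proof (rule ccontr)
  assume "zform u \<noteq> 0"
  \<comment> \<open>The radical of the Killing form. It is an ideal by invariance, so if nonzero it
    contains a nonzero perfect ideal \<open>J\<close>, on which Engel's theorem will give the
    contradiction.\<close>
  define K where "K = {x. \<forall>y. killing (emb x) (emb y) = 0}"
  have killing_emb: "killing f (emb y) = (\<Sum>j<m. coord y j * killing f (mfps_var (2*l + j)))" for f y
  proof -
    have "killing (emb y) f = (\<Sum>j<m. coord y j * killing (mfps_var (2*l + j)) f)"
      by (simp add: emb_def zform_def killing_sum_left killing_scale_left)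
    then show ?thesis by (simp only: killing_sym[of f])
  qed
  define x0 where "x0 = (\<Sum>k<m. scale (u k) (e k))"
  have x0: "emb x0 = zform u" by (simp add: x0_def emb_combination)
  then have "x0 \<in> K" using assms by (simp add: K_def killing_emb)
  moreover have "x0 \<noteq> 0" using x0 \<open>zform u \<noteq> 0\<close> emb_simps(3) by metis
  ultimately have "K \<noteq> {0}" by blast
  moreover have "lie_ideal K"
    unfolding lie_ideal_def subspace_def K_def
    by (auto simp: killing_add_left killing_scale_left killing_zero_left emb_br)
      (metis (no_types, lifting) emb_br emb_formal emb_homog killing_invariant pb_skew killing_scale_left
        mfps_const_simps(3,6) mult_minus1 mult_zero_right)
  ultimately obtain J where J: "lie_ideal J" "J \<subseteq> K" "J \<noteq> {0}" "derived_algebra J = J"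
    using semisimple_perfect_ideal[OF semisimple] by metis
  have "ad_nilpotent x" if x: "x \<in> J" for x
  proof -
    let ?X = "complexify (emb x)"
    let ?A = "CC.ham_matrix ?X"
    have emb: "complexify (emb y) \<in> formal_functions n" "homog W 2 (complexify (emb y))" for y
      by (auto intro: tc.map_formal tc.map_homog)
    have L: "linear_op n ?A f = CC.pb ?X f" for f
      using CC.weight_2_linear_op[OF emb] by simp
    obtain P' Q' J' where "jordan_basis n ?A P' Q' J'" by (rule jordan_basis_exists)
    then interpret JB: jordan_basis n ?A P' Q' J' .
    define S where "S = JB.fc cnj"
    have S: "linear_op n S (CC.pb (lin n u) (lin n w))
        = CC.pb (linear_op n S (lin n u)) (lin n w) + CC.pb (lin n u) (linear_op n S (lin n w))" for u w
      unfolding S_def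
    proof (rule JB.fc_derivation[OF CC.mfps_bilinear_pb _ CC.pb_lin_lin])
      show "linear_op n ?A (CC.pb f g) = CC.pb (linear_op n ?A f) g + CC.pb f (linear_op n ?A g)" for f g
        unfolding L by (rule CC.pb_jacobi)
    qed simp
    define \<phi> where "\<phi> = (\<lambda>y. trace_prod n (CC.ham_matrix (complexify (emb y))) S)"
    \<comment> \<open>The trace of \<open>S\<close> against the field of \<open>br a b\<close> is,
      up to sign, the Killing form of \<open>S b\<close> with \<open>a\<close>, and \<open>a\<close>
      is in the radical.\<close>
    have \<phi>_br: "\<phi> (br a b) = 0" if ab: "a \<in> J" "b \<in> J" for a b
    proof -
      let ?B = "complexify (emb b)" and ?C = "complexify (emb a)"
      obtain w where w: "?B = lin n w"
        using CC.zform_lin[of "\<lambda>i. to_complex (coord b i)"] by (auto simp: emb_def complexify_zform)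
      have "\<phi> (br a b) = trace_prod n (\<lambda>p q. mat_mult n (CC.ham_matrix ?B) (CC.ham_matrix ?C) p q
          - mat_mult n (CC.ham_matrix ?C) (CC.ham_matrix ?B) p q) S"
        unfolding \<phi>_def emb_br complexify_pb by (intro trace_prod_cong CC.ham_matrix_bracket emb)
      also have "\<dots> = trace_prod n (CC.ham_matrix ?C) (\<lambda>p q. mat_mult n S (CC.ham_matrix ?B) p q
          - mat_mult n (CC.ham_matrix ?B) S p q)"
        by (rule trace_prod_commutator)
      also have "\<dots> = - trace_prod n (\<lambda>p q. mat_mult n (CC.ham_matrix ?B) S p q
          - mat_mult n S (CC.ham_matrix ?B) p q) (CC.ham_matrix ?C)"
        by (subst trace_prod_sym) (simp add: trace_prod_minus_left)
      also have "\<dots> = - trace_prod n (CC.ham_matrix (linear_op n S ?B)) (CC.ham_matrix ?C)"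
      proof -
        have "linear_op n S (CC.pb ?B (mfps_var p)) = CC.pb (linear_op n S ?B) (mfps_var p)
            + CC.pb ?B (linear_op n S (mfps_var p))" if "p < n" for p
          using S[of w "\<lambda>q. if q = p then 1 else 0"] unfolding lin_unit[OF that] w .
        then have "CC.ham_matrix (linear_op n S ?B) p q = mat_mult n (CC.ham_matrix ?B) S p q
          - mat_mult n S (CC.ham_matrix ?B) p q" if "p < n" "q < n" for p q
          by (intro CC.ham_matrix_derivation emb that)
        then show ?thesis by (simp cong: trace_prod_cong)
      qed
      also have "\<dots> = - CC.killing (linear_op n S ?B) ?C" by (simp add: CC.killing_def)
      also have "CC.killing (linear_op n S ?B) ?C = 0"
      proof -
        \<comment> \<open>\<open>S b\<close> has complex coefficients and need not lie in the image
          of \<open>emb\<close>, so the vanishing is checked on coordinates and extended linearly. A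
          symplectic coordinate has a constant field, whose \<open>ham_matrix\<close> is 0.\<close>
        have "CC.killing (mfps_var k) ?C = 0" if "k < n" for k
        proof (cases "k < 2*l")
          case True
          have "CC.killing (mfps_var k) ?C = trace_prod n (\<lambda>p q. 0) (CC.ham_matrix ?C)"
            unfolding CC.killing_def by (intro trace_prod_cong CC.ham_matrix_xy True)
          then show ?thesis by (simp add: trace_prod_zero_left)
        next
          case False
          then have j: "k = 2*l + (k - 2*l)" "k - 2*l < m" using that by auto
          have "mfps_var k = complexify (emb (e (k - 2*l)))"
            by (subst j(1)) (simp add: emb_basis[OF j(2)] tc.map_simps)
          then have "CC.killing (mfps_var k) ?C = to_complex (killing (emb (e (k - 2*l))) (emb a))"
            by (simp add: complexify_killing)
          also have "killing (emb (e (k - 2*l))) (emb a) = 0"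
            using ab(1) J(2) by (subst killing_sym) (auto simp: K_def)
          finally show ?thesis by (simp add: tc.hom_zero)
        qed
        then show ?thesis unfolding w linear_op_lin
          by (simp add: lin_def CC.killing_sum_left CC.killing_scale_left)
      qed
      finally show ?thesis by simp
    qed
    \<comment> \<open>Here perfectness enters: the vanishing of \<open>\<phi>\<close> on brackets
      extends to \<open>x\<close> itself.\<close>
    have "x \<in> span {br a b |a b. a \<in> J \<and> b \<in> J}"
      using x J(4) by (simp add: derived_algebra_def)
    then have "\<phi> x = 0"
    proof (induction rule: span_induct)
      case base
      show ?case
        by (auto simp: subspace_def \<phi>_def tc.map_simps CC.ham_matrix_add CC.ham_matrix_scale
            CC.ham_matrix_zero trace_prod_add_left trace_prod_scale_left trace_prod_zero_left)
    next
      case (step y)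
      then show ?case using \<phi>_br by auto
    qed
    then have "(\<Sum>i<n. cnj (J' i i) * J' i i) = 0"
      using JB.fc_trace[of cnj] unfolding \<phi>_def trace_prod_def S_def by simp
    then have "complex_of_real (\<Sum>i<n. (cmod (J' i i))\<^sup>2) = 0"
      by (simp add: complex_norm_square mult.commute del: of_real_power)
    then have "(\<Sum>i<n. (cmod (J' i i))\<^sup>2) = 0" by (simp only: of_real_eq_0_iff)
    then have eig: "J' i i = 0" if "i < n" for i
      using that by (simp add: sum_nonneg_eq_0_iff)
    show "ad_nilpotent x"
      unfolding ad_nilpotent_def
    proof
      fix y
      obtain w where w: "complexify (emb y) = lin n w"
        using CC.zform_lin[of "\<lambda>i. to_complex (coord y i)"] by (auto simp: emb_def complexify_zform)
      obtain k where k: "(linear_op n ?A ^^ k) (lin n w) = 0"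
        using gen_eigen_0_nilpotent[OF JB.nilpotent_if_eigenvalues_0[OF eig]] by auto
      have "complexify (emb ((br x ^^ j) y)) = (linear_op n ?A ^^ j) (lin n w)" for j
        by (induction j) (simp_all add: w emb_br complexify_pb L)
      then have "emb ((br x ^^ k) y) = 0" using k complexify_eq_0 by metis
      then show "\<exists>k. (br x ^^ k) y = 0" using emb_eq_0 by blast
    qed
  qed
  moreover have "subalgebra J" using J(1) by (auto simp: lie_ideal_def subalgebra_def)
  ultimately show False using perfect_ad_nilpotent_trivial[of J] J by blast
qed

end

section \<open>The semisimple part of a quadratic Hamiltonian\<close>

lemma sum_lessThan_add: "(\<Sum>a<p + q. f a) = (\<Sum>a<p. f a) + (\<Sum>i<q. f (p + i :: nat) :: 'a::comm_monoid_add)"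
  by (induction q) (simp_all add: add.assoc)

lemma linear_op_cong:
  "(\<And>a b. a < n \<Longrightarrow> b < n \<Longrightarrow> A a b = B a b) \<Longrightarrow> linear_op n A f = linear_op n B f"
  unfolding linear_op_def by (intro vf_apply_cong lin_cong) auto

context lie_poisson
begin

lemma lin_split: "lin n u = lin (2*l) u + zform (\<lambda>i. u (2*l + i))"
  unfolding lin_def zform_def by (rule sum_lessThan_add)

lemma wt_proj_lin: "wt_proj W k (lin n u :: 'a mfps) = lin n (\<lambda>a. if W a = k then u a else 0)"
proof -
  have "wt_proj W k (mfps_const (u a) * mfps_var a)
      = mfps_const (if W a = k then u a else 0) * (mfps_var a :: 'a mfps)" for a
    using wt_proj_homog[OF homog_var, of W k a, where 'a = 'a] by (auto simp: mfps_const_simps)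
  then show ?thesis unfolding lin_def by simp
qed

lemma homog_lin_zform:
  assumes "homog W 2 (lin n u)"
  shows "lin n u = zform (\<lambda>i. u (2*l + i))"
proof -
  have "lin n u = lin n (\<lambda>a. if W a = 2 then u a else 0)"
    using wt_proj_homog[OF assms, of 2] by (simp add: wt_proj_lin)
  also have "\<dots> = lin (2*l) (\<lambda>a. 0) + zform (\<lambda>i. u (2*l + i))"
    unfolding lin_split by (intro arg_cong2[of _ _ _ _ "(+)"] lin_cong zform_cong) (auto simp: W_def)
  finally show ?thesis by (simp add: lin_def mfps_const_simps)
qed

lemma homog_lin_xy:
  assumes "homog W 1 (lin n u :: 'a mfps)"
  shows "lin n u = (lin (2*l) u :: 'a mfps)"
proof -
  have "lin n u = lin n (\<lambda>a. if W a = 1 then u a else 0)"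
    using wt_proj_homog[OF assms, of 1] by (simp add: wt_proj_lin)
  also have "\<dots> = lin (2*l) u + zform (\<lambda>i. 0)"
    unfolding lin_split by (intro arg_cong2[of _ _ _ _ "(+)"] lin_cong zform_cong) (auto simp: W_def)
  finally show ?thesis by (simp add: zform_def mfps_const_simps)
qed

text \<open>Each symplectic index has exactly one conjugate partner, and the sign of the bracket
  cancels the sign in the sum.\<close>

lemma symplectic_identity:
  assumes "a < 2*l"
  shows "(\<Sum>i<l. P i a * F (l + i) - P (l + i) a * F i) = F a"
proof -
  have "(\<Sum>i<l. P i a * F (l + i)) = (\<Sum>i<l. if a = l + i then F a else 0)"
    using assms by (intro sum.cong refl) (auto simp: P_eq)
  moreover have "(\<Sum>i<l. P (l + i) a * F i) = (\<Sum>i<l. if i = a then - F a else 0)"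
    using assms by (intro sum.cong refl) (auto simp: P_eq)
  ultimately have "(\<Sum>i<l. P i a * F (l + i) - P (l + i) a * F i)
      = (\<Sum>i<l. if a = l + i then F a else 0) - (\<Sum>i<l. if i = a then - F a else 0)"
    by (simp only: sum_subtractf)
  also have "\<dots> = F a"
  proof (cases "a < l")
    case True
    then have "(\<Sum>i<l. if a = l + i then F a else 0) = 0" by (intro sum.neutral) auto
    then show ?thesis using True by simp
  next
    case False
    have "(\<Sum>i<l. if a = l + i then F a else 0) = (\<Sum>i<l. if i = a - l then F a else 0)"
      using False by (intro sum.cong refl) auto
    then show ?thesis using False assms by simp
  qed
  finally show ?thesis .
qed

text \<open>Bracketing with the conjugate variable recovers a partial derivative, so symplectic
  derivatives of a function can be read off its Hamiltonian field.\<close>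

lemma pb_var_dual:
  assumes b: "b < 2*l"
  shows "pb f (mfps_var (if b < l then l + b else b - l)) = (if b < l then 1 else - 1) * mfps_deriv b f"
proof -
  have "P b' (if b < l then l + b else b - l) = (if b' = b then if b < l then 1 else - 1 else 0)" for b'
      using b by (auto simp: P_eq)
  then have "P b' (if b < l then l + b else b - l) * g
        = (if b' = b then (if b < l then 1 else - 1) * g else 0)" for b' g
      by simp
  then have "pb f (mfps_var (if b < l then l + b else b - l))
        = (\<Sum>b'<n. if b' = b then (if b < l then 1 else - 1) * mfps_deriv b f else 0)"
      using b by (subst poisson_bracket_var_right) (auto intro!: sum.cong)
  also have "\<dots> = (if b < l then 1 else - 1) * mfps_deriv b f" using b by simp
  finally show ?thesis .
qed

text \<open>The symplectic derivatives of \<open>f\<close> vanish, so weight 2 makes it linear in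
  the Lie algebra variables. It then lies in the radical of the Killing form.\<close>

lemma weight_2_casimir:
  assumes nondeg: "\<And>u. (\<And>j. j < m \<Longrightarrow> killing (zform u) (mfps_var (2*l + j)) = 0) \<Longrightarrow> zform u = 0"
    and f: "f \<in> formal_functions n" "homog W 2 f" and c: "\<And>a. a < n \<Longrightarrow> pb f (mfps_var a) = 0"
  shows "f = 0"
proof -
  have xy: "mfps_deriv b f = 0" if b: "b < 2*l" for b
  proof -
    have "(if b < l then 1 else - 1) * mfps_deriv b f = 0"
      unfolding pb_var_dual[OF b, symmetric] by (rule c) (use b in auto)
    then show ?thesis by (simp split: if_splits)
  qed
  have supp: "\<exists>i<m. M = {#2*l + i#}" if M: "mfps_coeff f M \<noteq> 0" for M
  proof -
    have z: "2*l \<le> b" if b: "b \<in># M" for b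
    proof (rule ccontr)
      assume "\<not> 2*l \<le> b"
      then have "mfps_coeff (mfps_deriv b f) (M - {#b#}) = 0" using xy by simp
      then have "of_nat (count (M - {#b#}) b + 1) * mfps_coeff f M = 0"
        using b by (simp add: mfps_coeff_deriv)
      then show False using M by (metis add_is_0 mult_eq_0_iff of_nat_eq_0_iff one_neq_zero)
    qed
    have "wt W M = 2 * size M" using z
    proof (induction M)
      case (add x M)
      then have "2*l \<le> x" "wt W M = 2 * size M" by auto
      moreover from this have "W x = 2" by (simp add: W_def)
      ultimately show ?case by simp
    qed simp
    then have "size M = 1" using f(2) M by (auto simp: homog_def)
    then obtain b where "M = {#b#}" using size_1_singleton_mset by blast
    then show ?thesis using z[of b] f(1) M
      by (auto simp: formal_functions_def intro!: exI[of _ "b - 2*l"])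
  qed
  have fz: "f = zform (\<lambda>i. mfps_coeff f {#2*l + i#})"
  proof (rule mfps_ext)
    fix M
    have *: "mfps_coeff (zform u) M = (\<Sum>i<m. if M = {#2*l + i#} then u i else 0)" for u
      by (simp add: zform_def mfps_coeff_var if_distrib cong: if_cong)
    show "mfps_coeff f M = mfps_coeff (zform (\<lambda>i. mfps_coeff f {#2*l + i#})) M"
    proof (cases "mfps_coeff f M = 0")
      case True
      moreover have "(\<Sum>i<m. if M = {#2*l + i#} then mfps_coeff f {#2*l + i#} else 0) = 0"
        by (rule sum.neutral) (use True in auto)
      ultimately show ?thesis unfolding * by simp
    next
      case False
      then obtain i where "i < m" "M = {#2*l + i#}" using supp by blast
      then show ?thesis unfolding * by simp
    qed
  qed
  have "ham_matrix f a b = 0" if "a < n" for a b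
    using c[OF that] by (simp add: ham_matrix_def)
  then have "killing f g = 0" for g
    unfolding killing_def trace_prod_def by simp
  then show ?thesis using nondeg[of "\<lambda>i. mfps_coeff f {#2*l + i#}"] fz by simp
qed

end

section \<open>The semisimple part of a weight-preserving field: complex construction and
  descent\<close>

locale weight_2_hamiltonian = semisimple_lie_poisson scale br l m e c
  for scale :: "'k::real_or_complex \<Rightarrow> 'g::ab_group_add \<Rightarrow> 'g" and br l m e c +
  fixes h :: "'k mfps"
  assumes h: "h \<in> formal_functions (2*l + m)" "homog (lie_poisson.W l) 2 h"
begin

abbreviation hC :: "complex mfps" where "hC \<equiv> complexify h"
abbreviation A :: "nat \<Rightarrow> nat \<Rightarrow> complex" where "A \<equiv> CC.ham_matrix hC"

lemma hC: "hC \<in> formal_functions n" "homog W 2 hC"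
  by (rule tc.map_formal[OF h(1)], rule tc.map_homog[OF h(2)])

text \<open>One Jordan basis is chosen once and for all, because the interpretation below needs
  fixed terms as its parameters.\<close>

definition jordan_data :: "(nat \<Rightarrow> nat \<Rightarrow> complex) \<times> (nat \<Rightarrow> nat \<Rightarrow> complex) \<times> (nat \<Rightarrow> nat \<Rightarrow> complex)"
  where "jordan_data = (SOME (P, Q, J). jordan_basis n A P Q J)"

sublocale JB: jordan_basis n A "fst jordan_data" "fst (snd jordan_data)" "snd (snd jordan_data)"
proof -
  obtain P Q J where "jordan_basis n A P Q J" by (rule jordan_basis_exists)
  then have "\<exists>t. case t of (P, Q, J) \<Rightarrow> jordan_basis n A P Q J" by auto
  from someI_ex[OF this]
  show "jordan_basis n A (fst jordan_data) (fst (snd jordan_data)) (snd (snd jordan_data))"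
    unfolding jordan_data_def by (simp add: case_prod_unfold)
qed

definition SC :: "nat \<Rightarrow> nat \<Rightarrow> complex" where "SC = JB.fc (\<lambda>x. x)"

lemma L_eq: "linear_op n A f = CC.pb hC f"
  using CC.weight_2_linear_op[OF hC] by simp

lemma SC_derivation: "linear_op n SC (CC.pb (lin n u) (lin n w))
    = CC.pb (linear_op n SC (lin n u)) (lin n w) + CC.pb (lin n u) (linear_op n SC (lin n w))"
  unfolding SC_def
proof (rule JB.fc_derivation[OF CC.mfps_bilinear_pb _ CC.pb_lin_lin])
  show "linear_op n A (CC.pb f g) = CC.pb (linear_op n A f) g + CC.pb f (linear_op n A g)" for f g
    unfolding L_eq by (rule CC.pb_jacobi)
qed simp

text \<open>The field of \<open>h\<close> preserves weights, so the weight projections preserve its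
  generalised eigenspaces, on each of which \<open>SC\<close> is scalar.\<close>

lemma SC_wt_proj: "wt_proj W k (linear_op n SC (lin n u)) = linear_op n SC (wt_proj W k (lin n u))"
proof -
  have "wt_proj W k (linear_op n SC (JB.v i)) = linear_op n SC (wt_proj W k (JB.v i))"
    if i: "i < n" for i
  proof -
    have "gen_eigen JB.L (snd (snd jordan_data) i i) (wt_proj W k (JB.v i))"
    proof (rule gen_eigen_intertwine[OF JB.gen_eigen_basis[OF i]])
      show "wt_proj W k (JB.L f - mfps_const r * f) = JB.L (wt_proj W k f) - mfps_const r * wt_proj W k f"
        for f r using CC.wt_proj_pb_weight_2[OF hC(2), of k f] by (simp add: L_eq)
    qed simp
    then show ?thesis
      unfolding SC_def CC.wt_proj_lin JB.fc_basis[OF i] wt_proj_simps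
      by (subst JB.fc_gen_eigen) (simp_all add: CC.wt_proj_lin)
  qed
  then show ?thesis by (subst (1 2) JB.lin_in_basis) simp
qed

text \<open>Over the reals \<open>S\<close> is real, since complex conjugation permutes the generalised
  eigenspaces.\<close>

lemma SC_real:
  assumes "a < n" "b < n"
  shows "SC a b \<in> range (to_complex :: 'k \<Rightarrow> complex)"
proof (cases "range (to_complex :: 'k \<Rightarrow> complex) = UNIV")
  case False
  then have R: "range (to_complex :: 'k \<Rightarrow> complex) = \<real>" using range_to_complex by blast
  interpret cn: coeff_hom cnj by (rule coeff_hom_cnj)
  let ?c = "mfps_map cnj"
  have real: "?c (complexify f) = complexify f" for f :: "'k mfps"
  proof (rule mfps_ext)
    fix M
    have "to_complex (mfps_coeff f M) \<in> \<real>" using R by blast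
    then show "mfps_coeff (?c (complexify f)) M = mfps_coeff (complexify f) M"
      by (simp add: Reals_cnj_iff)
  qed
  have cc: "?c (?c f) = f" for f by (rule mfps_ext) simp
  have cL: "?c (JB.L f) = JB.L (?c f)" for f
  proof -
    have "?c (CC.P a b) = CC.P a b" for a b
      using real[of "P a b"] by (simp only: complexify_P)
    then show ?thesis unfolding L_eq cn.map_bracket by (simp only: real)
  qed
  define S' where "S' = (\<lambda>a b. cnj (SC a b))"
  have S': "linear_op n S' f = ?c (linear_op n SC (?c f))" for f
    by (simp add: cn.map_linear_op S'_def cc)
  have "linear_op n S' (JB.v i) = linear_op n SC (JB.v i)" if i: "i < n" for i
  proof -
    let ?r = "snd (snd jordan_data) i i"
    have "gen_eigen JB.L (cnj ?r) (?c (JB.v i))"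
      by (rule gen_eigen_intertwine[OF JB.gen_eigen_basis[OF i]]) (simp_all only: cn.map_simps cL)
    then have "linear_op n SC (?c (JB.v i)) = mfps_const (cnj ?r) * ?c (JB.v i)"
      unfolding cn.map_lin SC_def by (rule JB.fc_gen_eigen)
    then have "linear_op n S' (JB.v i) = mfps_const ?r * JB.v i"
      unfolding S' by (simp only: cn.map_simps cc complex_cnj_cnj)
    then show ?thesis using JB.fc_basis[OF i, of "\<lambda>x. x"] by (simp add: SC_def)
  qed
  then have "linear_op n S' (lin n u) = linear_op n SC (lin n u)" for u
    by (subst (1 2) JB.lin_in_basis) simp
  from this[of "\<lambda>b. if b = a then 1 else 0"] have "lin n (S' a) = lin n (SC a)"
    using assms by (simp add: lin_unit)
  then have "S' a b = SC a b" using assms by (simp add: lin_inject)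
  then have "SC a b \<in> \<real>" by (simp add: S'_def Reals_cnj_iff)
  then show ?thesis by (simp add: R)
qed simp

definition S :: "nat \<Rightarrow> nat \<Rightarrow> 'k" where "S a b = retract (SC a b)"

lemma to_complex_S: "a < n \<Longrightarrow> b < n \<Longrightarrow> to_complex (S a b) = SC a b"
  using SC_real[of a b] by (auto simp: S_def retract)

lemma complexify_S: "complexify (linear_op n S f) = linear_op n SC (complexify f)"
  unfolding tc.map_linear_op by (rule linear_op_cong) (rule to_complex_S)

lemma complexify_inject: "complexify f = complexify g \<Longrightarrow> f = g"
  by (metis map_retract(1))

lemma complexify_var: "a < n \<Longrightarrow> \<exists>u. complexify (mfps_var a :: 'k mfps) = lin n u"
  by (rule exI[of _ "\<lambda>b. if b = a then 1 else 0"]) (simp only: lin_unit tc.map_simps)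

lemma S_derivation:
  assumes "a < n" "b < n"
  shows "linear_op n S (pb (mfps_var a) (mfps_var b))
    = pb (linear_op n S (mfps_var a)) (mfps_var b) + pb (mfps_var a) (linear_op n S (mfps_var b))"
proof -
  obtain u w where uw: "complexify (mfps_var a :: 'k mfps) = lin n u"
      "complexify (mfps_var b :: 'k mfps) = lin n w"
    using complexify_var assms by metis
  show ?thesis
    by (rule complexify_inject)
      (unfold complexify_S complexify_pb tc.map_simps(1) uw, rule SC_derivation)
qed

text \<open>Consequently \<open>S\<close> does not mix symplectic and Lie algebra variables.\<close>

lemma S_homog:
  assumes "a < n"
  shows "homog W (W a) (lin n (S a))"
proof -
  obtain u where u: "complexify (mfps_var a :: 'k mfps) = lin n u" using complexify_var assms by metis
  have "wt_proj W k (linear_op n S (mfps_var a)) = linear_op n S (wt_proj W k (mfps_var a))" for k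
    by (rule complexify_inject) (unfold complexify_S tc.map_wt_proj u, rule SC_wt_proj)
  from this[of "W a"] have "wt_proj W (W a) (lin n (S a)) = lin n (S a)"
    using assms wt_proj_homog[OF homog_var, of W "W a" a, where 'a = 'k] by simp
  then show ?thesis by (metis homog_wt_proj)
qed

text \<open>Euler's formula for a quadratic form in the symplectic variables,
  \<open>2 q = \<Sum> x_i dq/dx_i + y_i dq/dy_i\<close>, with the derivatives replaced by
  \<open>dq/dx_i = {q, y_i} = S y_i\<close> and
  \<open>dq/dy_i = - {q, x_i} = - S x_i\<close>.\<close>

definition quad :: "'k mfps"
  where "quad = mfps_const (1/2) * (\<Sum>i<l. lin n (S (l + i)) * mfps_var i - lin n (S i) * mfps_var (l + i))"

lemma quad_formal: "quad \<in> formal_functions n"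
  unfolding quad_def by (intro formal_functions_times formal_functions_sum formal_functions_minus) auto

lemma quad_homog: "homog W 2 quad"
  unfolding quad_def
proof (intro homog_const_mult homog_sum homog_minus)
  fix i assume i: "i \<in> {..<l}"
  have "homog W (1 + 1) (lin n (S (l + i)) * mfps_var i)" "homog W (1 + 1) (lin n (S i) * mfps_var (l + i))"
    using S_homog[of i] S_homog[of "l + i"] homog_var[of W i] homog_var[of W "l + i"] i
    by (intro homog_times; simp add: W_def)+
  then show "homog W 2 (lin n (S (l + i)) * mfps_var i)" "homog W 2 (lin n (S i) * mfps_var (l + i))"
    by (simp_all add: numeral_2_eq_2)
qed

lemma quad_vf: "a < 2*l \<Longrightarrow> pb quad (mfps_var a) = lin n (S a)"
    and quad_vf_z: "i < m \<Longrightarrow> pb quad (mfps_var (2*l + i)) = 0"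
proof -
  let ?x = "mfps_var :: nat \<Rightarrow> 'k mfps" and ?S = "\<lambda>a. lin n (S a)"
  have xy: "?S a = lin (2*l) (S a)" if "a < 2*l" for a
    using S_homog[of a] that by (intro homog_lin_xy) (simp add: W_def)
  have expand: "pb quad (?x b) = mfps_const (1/2) *
      (\<Sum>i<l. (pb (?S (l + i)) (?x b) * ?x i + ?S (l + i) * P i b)
        - (pb (?S i) (?x b) * ?x (l + i) + ?S i * P (l + i) b))" if "b < n" for b
    unfolding quad_def using that by (simp add: pb_times_left poisson_bracket_var_var)
  show "pb quad (?x (2*l + i)) = 0" if "i < m" for i
  proof -
    have "pb (?S a) (?x (2*l + i)) = 0" if "a < 2*l" for a
    proof -
      have "pb (lin (2*l) (S a)) (?x (2*l + i)) = 0"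
        using \<open>i < m\<close> by (simp add: lin_def poisson_bracket_var_var P_mixed)
      then show ?thesis by (simp only: xy[OF that])
    qed
    then show ?thesis using that by (simp add: expand P_mixed)
  qed
  show "pb quad (?x a) = lin n (S a)" if a: "a < 2*l" for a
  proof -
    \<comment> \<open>Brackets of symplectic variables are constant and killed by \<open>S\<close>;
      the derivation property then says that \<open>S\<close> is infinitesimally symplectic.\<close>
    have der: "pb (?S i) (?x a) = - pb (?x i) (?S a)" if i: "i < 2*l" for i
    proof -
      obtain r where "pb (?x i) (?x a) = mfps_const r"
        using P_xy[OF i, of a] i a by (auto simp: poisson_bracket_var_var)
      then have "pb (?S i) (?x a) + pb (?x i) (?S a) = 0"
        using S_derivation[of i a] i a by simp
      then show ?thesis by (simp only: eq_neg_iff_add_eq_0)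
    qed
    \<comment> \<open>Euler's formula for a linear form. The product rule yields two sums, this one
      and \<open>symplectic_identity\<close>; each gives \<open>S a\<close>, which the factor 1/2
      compensates.\<close>
    have first: "(\<Sum>i<l. pb (?x i) w * ?x (l + i) - pb (?x (l + i)) w * ?x i) = w"
      if w: "w = lin (2*l) u" for u w
    proof -
      have "(\<Sum>i<l. pb (?x i) w * ?x (l + i) - pb (?x (l + i)) w * ?x i)
          = (\<Sum>i<l. \<Sum>a<2*l. mfps_const (u a) * (P i a * ?x (l + i) - P (l + i) a * ?x i))"
      proof (rule sum.cong[OF refl])
        fix i assume "i \<in> {..<l}"
        moreover have "pb (?x j) w = (\<Sum>a<2*l. mfps_const (u a) * P j a)" if "j < n" for j
          using that by (simp add: w lin_def poisson_bracket_var_var)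
        ultimately show "pb (?x i) w * ?x (l + i) - pb (?x (l + i)) w * ?x i
            = (\<Sum>a<2*l. mfps_const (u a) * (P i a * ?x (l + i) - P (l + i) a * ?x i))"
          by (simp add: sum_distrib_right right_diff_distrib sum_subtractf mult.assoc)
      qed
      also have "\<dots> = (\<Sum>a<2*l. mfps_const (u a) * (\<Sum>i<l. P i a * ?x (l + i) - P (l + i) a * ?x i))"
        unfolding sum_distrib_left by (rule sum.swap)
      also have "\<dots> = w" unfolding w lin_def by (simp add: symplectic_identity)
      finally show ?thesis .
    qed
    have "pb quad (?x a) = mfps_const (1/2) *
        ((\<Sum>i<l. pb (?x i) (?S a) * ?x (l + i) - pb (?x (l + i)) (?S a) * ?x i)
        + (\<Sum>i<l. P i a * ?S (l + i) - P (l + i) a * ?S i))"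
    proof -
      have ring: "(- u * x + s * p) - (- v * y + s' * p') = (v * y - u * x) + (p * s - p' * s')"
        for u v x y s s' p p' :: "'k mfps" by (simp add: algebra_simps)
      have step: "(pb (?S (l + i)) (?x a) * ?x i + ?S (l + i) * P i a)
            - (pb (?S i) (?x a) * ?x (l + i) + ?S i * P (l + i) a)
          = (pb (?x i) (?S a) * ?x (l + i) - pb (?x (l + i)) (?S a) * ?x i)
            + (P i a * ?S (l + i) - P (l + i) a * ?S i)" if "i < l" for i
      proof -
        have i: "i < 2*l" "l + i < 2*l" using that by auto
        show ?thesis unfolding der[OF i(1)] der[OF i(2)] by (rule ring)
      qed
      have "a < n" using a by simp
      show ?thesis
        unfolding expand[OF \<open>a < n\<close>] sum.distrib[symmetric]
        by (rule arg_cong[where f = "\<lambda>s. mfps_const (1/2) * s"], rule sum.cong[OF refl], rule step) simp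
    qed
    also have "\<dots> = mfps_const (1/2) * (?S a + ?S a)"
      using first[OF xy[OF a]] symplectic_identity[OF a, of ?S] by simp
    also have "\<dots> = (mfps_const (1/2) + mfps_const (1/2)) * ?S a"
      by (simp add: distrib_left distrib_right)
    also have "\<dots> = ?S a"
      by (simp add: mfps_const_simps(6) flip: mfps_const_simps(1))
    finally show ?thesis .
  qed
qed

text \<open>After subtracting the field of \<open>quad\<close>, what is left of \<open>S\<close> is
  a derivation that vanishes on symplectic variables and preserves the Lie algebra variables; it is
  inner, generated by some \<open>zform t\<close>.\<close>

lemma semisimple_part_exists:
  "\<exists>q. q \<in> formal_functions n \<and> homog W 2 q \<and> (\<forall>f. pb q f = linear_op n S f)"
proof -
  define D where "D = (\<lambda>a b. S a b - ham_matrix quad a b)"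
  have D: "linear_op n D f = linear_op n S f - pb quad f" for f
    unfolding weight_2_linear_op[OF quad_formal quad_homog] D_def linear_op_def lin_minus
    by (rule vf_apply_fields_minus)
  have "\<exists>t. \<forall>a<n. linear_op n D (mfps_var a) = pb (zform t) (mfps_var a)"
  proof (rule derivation_inner)
    show "zform u = 0" if "\<And>j. j < m \<Longrightarrow> killing (zform u) (mfps_var (2*l + j)) = 0" for u
      using that by (rule killing_nondegenerate)
    show "linear_op n D (pb (mfps_var a) (mfps_var b))
        = pb (linear_op n D (mfps_var a)) (mfps_var b) + pb (mfps_var a) (linear_op n D (mfps_var b))"
      if "a < n" "b < n" for a b
      unfolding D S_derivation[OF that] pb_jacobi[of quad] by simp
    show "linear_op n D (mfps_var a) = 0" if "a < 2*l" for a
      unfolding D quad_vf[OF that] using that by simp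
    show "\<exists>u. linear_op n D (mfps_var (2*l + i)) = zform u" if "i < m" for i
      unfolding D quad_vf_z[OF that]
      using that homog_lin_zform[of "S (2*l + i)"] S_homog[of "2*l + i"] by (auto simp: W_def)
  qed
  then obtain t where t: "\<And>a. a < n \<Longrightarrow> linear_op n D (mfps_var a) = pb (zform t) (mfps_var a)" by blast
  have "pb (quad + zform t) (mfps_var a) = lin n (S a)" if "a < n" for a
  proof -
    have "lin n (S a) - pb quad (mfps_var a) = pb (zform t) (mfps_var a)"
      using t[OF that] that unfolding D by simp
    then show ?thesis unfolding pb_add_left by (metis add.commute diff_add_cancel)
  qed
  then have "pb (quad + zform t) f = linear_op n S f" for f
    unfolding linear_op_def by (subst poisson_bracket_vf) (rule vf_apply_cong)
  then show ?thesis using quad_formal quad_homog zform_formal zform_homog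
    by (intro exI[of _ "quad + zform t"]) auto
qed

end

section \<open>The function \<open>h_ss\<close> and the homological equation\<close>

context weight_2_hamiltonian
begin

definition h_ss :: "'k mfps"
  where "h_ss = (SOME q. q \<in> formal_functions n \<and> homog W 2 q \<and> (\<forall>f. pb q f = linear_op n S f))"

lemma h_ss: "h_ss \<in> formal_functions n" "homog W 2 h_ss" "pb h_ss f = linear_op n S f"
  using someI_ex[OF semisimple_part_exists] unfolding h_ss_def by auto

lemma complexify_h_ss: "CC.pb (complexify h_ss) f = linear_op n SC f"
proof -
  have "CC.ham_matrix (complexify h_ss) a b = SC a b" if "a < n" "b < n" for a b
  proof -
    have "ham_matrix h_ss a b = S a b"
      unfolding ham_matrix_def using that by (simp add: h_ss(3))
    then show ?thesis using that by (simp add: to_complex_S flip: complexify_ham_matrix)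
  qed
  then show ?thesis
    using CC.weight_2_linear_op[OF tc.map_formal[OF h_ss(1)] tc.map_homog[OF h_ss(2)]]
    by (simp cong: linear_op_cong)
qed

lemma S_semisimple: "semisimple_mat (mat n n (\<lambda>(a, b). S a b))"
proof -
  have "map_mat to_complex (mat n n (\<lambda>(a, b). S a b)) = mat n n (\<lambda>(a, b). SC a b)"
    by (rule eq_matI) (auto simp: to_complex_S)
  then show ?thesis unfolding semisimple_mat_def SC_def using JB.fc_diagonalizable by simp
qed

text \<open>The semisimple part commutes with the field of \<open>h\<close>, so by the Jacobi
  identity \<open>{h_ss, h}\<close> is a Casimir function of weight 2, and there is none but
  0.\<close>

lemma h_ss_commutes: "pb h_ss h = 0"
proof (rule weight_2_casimir)
  show "zform u = 0" if "\<And>j. j < m \<Longrightarrow> killing (zform u) (mfps_var (2*l + j)) = 0" for u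
    using that by (rule killing_nondegenerate)
  show "pb h_ss h \<in> formal_functions n" by (intro formal_pb h_ss h)
  have "wt_proj W 2 (pb h_ss h) = pb h_ss h"
    using wt_proj_pb_weight_2[OF h_ss(2), of 2 h] wt_proj_homog[OF h(2), of 2] by simp
  then show "homog W 2 (pb h_ss h)" by (metis homog_wt_proj)
  fix a assume a: "a < n"
  obtain u where u: "complexify (mfps_var a :: 'k mfps) = lin n u" using complexify_var a by metis
  have "complexify (pb h_ss (pb h (mfps_var a))) = complexify (pb h (pb h_ss (mfps_var a)))"
    unfolding complexify_pb u complexify_h_ss L_eq[symmetric] SC_def by (rule JB.fc_commute)
  then have "pb h_ss (pb h (mfps_var a)) = pb h (pb h_ss (mfps_var a))" by (rule complexify_inject)
  then show "pb (pb h_ss h) (mfps_var a) = 0" using pb_jacobi[of h_ss h "mfps_var a"] by simp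
qed

lemma nilpotent_part_pow:
  assumes "a < n"
  shows "((\<lambda>f. pb h f - pb h_ss f) ^^ n) (mfps_var a) = 0"
proof -
  obtain u where u: "complexify (mfps_var a :: 'k mfps) = lin n u" using complexify_var assms by metis
  have "complexify (((\<lambda>f. pb h f - pb h_ss f) ^^ k) (mfps_var a))
      = ((\<lambda>f. JB.L f - linear_op n (JB.fc (\<lambda>x. x)) f) ^^ k) (lin n u)" for k
  proof (induction k)
    case (Suc k)
    show ?case
      by (unfold funpow.simps o_apply Suc[symmetric])
        (unfold tc.map_simps complexify_pb complexify_h_ss SC_def L_eq, rule refl)
  qed (simp only: funpow.simps id_apply u)
  then have "complexify (((\<lambda>f. pb h f - pb h_ss f) ^^ n) (mfps_var a)) = 0"
    by (simp only: JB.nilpotent_part)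
  then show ?thesis by (rule complexify_eq_0)
qed

text \<open>Every polynomial is a sum of generalised eigenvectors of \<open>{h, \<cdot>}\<close> on which \<open>{h_ss, \<cdot>}\<close> acts
  as the eigenvalue, because such sums are closed under products. On the part with nonzero eigenvalues
  \<open>{h, \<cdot>}\<close> is invertible.\<close>

inductive_set eigensums :: "complex mfps set" where
  eigen: "gen_eigen JB.L r f \<Longrightarrow> f \<in> formal_functions n \<Longrightarrow> linear_op n SC f = mfps_const r * f
    \<Longrightarrow> f \<in> eigensums"
| add: "f \<in> eigensums \<Longrightarrow> g \<in> eigensums \<Longrightarrow> f + g \<in> eigensums"

lemma eigensums_times:
  assumes "f \<in> eigensums" "g \<in> eigensums"
  shows "f * g \<in> eigensums"
  using assms
proof (induction arbitrary: g)
  case (eigen r f)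
  note f = eigen.hyps
  from eigen.prems show ?case
  proof induction
    case (eigen s g)
    have "gen_eigen JB.L (r + s) (f * g)"
    proof (rule gen_eigen_bilinear[OF _ _ _ f(1) eigen.hyps(1)])
      show "mfps_bilinear ((*) :: complex mfps \<Rightarrow> _)"
        by (simp add: mfps_bilinear_def distrib_left distrib_right mult.assoc mult.left_commute)
    qed (simp_all add: linear_op_times)
    moreover have "linear_op n SC (f * g) = mfps_const (r + s) * (f * g)"
      by (simp only: linear_op_times f eigen.hyps) (simp add: mfps_const_simps algebra_simps)
    ultimately show ?case using f eigen.hyps by (intro eigensums.eigen) auto
  next
    case (add g g')
    then show ?case by (auto simp: distrib_left intro: eigensums.add)
  qed
next
  case (add f f')
  then show ?case by (auto simp: distrib_right intro: eigensums.add)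
qed

lemma eigensums_const: "mfps_const d \<in> eigensums"
proof (rule eigensums.eigen)
  show "gen_eigen JB.L 0 (mfps_const d)"
    by (rule gen_eigen.step) (simp add: mfps_const_simps gen_eigen.zero)
qed (simp_all add: mfps_const_simps)

lemma eigensums_sum: "(\<And>x. x \<in> X \<Longrightarrow> f x \<in> eigensums) \<Longrightarrow> (\<Sum>x\<in>X. f x) \<in> eigensums"
  using eigensums_const[of 0]
  by (induction X rule: infinite_finite_induct) (auto simp: mfps_const_simps intro: eigensums.add)

lemma eigensums_var: "a < n \<Longrightarrow> mfps_var a \<in> eigensums"
  unfolding lin_unit[symmetric]
proof (subst JB.lin_in_basis, rule eigensums_sum, rule eigensums_times[OF eigensums_const])
  fix i assume "i \<in> {..<n}"
  then show "JB.v i \<in> eigensums"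
    using JB.gen_eigen_basis[of i] JB.fc_basis[of i "\<lambda>x. x"]
    by (intro eigensums.eigen) (auto simp: SC_def)
qed

lemma eigensums_monomial: "set_mset M \<subseteq> {..<n} \<Longrightarrow> (\<Prod>i\<in>#M. mfps_var i) \<in> eigensums"
proof (induction M)
  case empty
  then show ?case using eigensums_const[of 1] by (simp add: mfps_const_simps)
next
  case (add a M)
  then show ?case by (auto intro: eigensums_times eigensums_var)
qed

text \<open>Homogeneity bounds the degree, so \<open>f\<close> is a finite sum of monomials.\<close>

lemma eigensums_polynomial:
  assumes "f \<in> formal_functions n" "homog W k f"
  shows "f \<in> eigensums"
proof -
  let ?T = "{M. set_mset M \<subseteq> {..<n} \<and> size M \<le> k}"
  have "finite ?T" by (rule finite_multisets_bounded) simp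
  moreover have "M \<in> ?T" if "mfps_coeff f M \<noteq> 0" for M
    using that assms size_le_wt[of W M] by (auto simp: formal_functions_def homog_def)
  ultimately have "f = (\<Sum>M\<in>?T. mfps_const (mfps_coeff f M) * (\<Prod>i\<in>#M. mfps_var i))"
    by (rule mfps_monomial_expansion)
  also have "\<dots> \<in> eigensums"
    by (intro eigensums_sum eigensums_times eigensums_const eigensums_monomial) auto
  finally show ?thesis .
qed

lemma eigensums_decompose:
  assumes "f \<in> eigensums"
  shows "\<exists>k g. k \<in> formal_functions n \<and> g \<in> formal_functions n \<and> f = k + JB.L g \<and> linear_op n SC k = 0"
  using assms
proof induction
  case (eigen r f)
  show ?case
  proof (cases "r = 0")
    case True
    then show ?thesis using eigen by (intro exI[of _ f] exI[of _ 0]) (simp add: mfps_const_simps)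
  next
    case False
    have "\<exists>g\<in>formal_functions n. JB.L g = f"
      by (rule gen_eigen_in_image[OF eigen(1) False eigen(2)]) auto
    then obtain g where "g \<in> formal_functions n" "JB.L g = f" by blast
    then show ?thesis by (intro exI[of _ 0] exI[of _ g]) simp
  qed
next
  case (add f f')
  then obtain k g k' g' where *: "k \<in> formal_functions n" "g \<in> formal_functions n" "f = k + JB.L g"
    "linear_op n SC k = 0" "k' \<in> formal_functions n" "g' \<in> formal_functions n" "f' = k' + JB.L g'"
    "linear_op n SC k' = 0" by blast
  show ?case
    by (intro exI[of _ "k + k'"] exI[of _ "g + g'"]) (use * in auto)
qed

text \<open>Solved over the complex numbers first. The equation is linear with coefficients in the
  ground field and both fields preserve weights, so \<open>retract\<close> and the projection to
  weight \<open>j\<close> turn a complex solution into the required one.\<close>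

lemma homological_equation:
  assumes "f \<in> formal_functions n" "homog W j f"
  shows "\<exists>k g. k \<in> formal_functions n \<and> homog W j k \<and> g \<in> formal_functions n \<and> homog W j g
    \<and> f = k + pb h g \<and> pb h_ss k = 0"
proof -
  have "complexify f \<in> eigensums"
    using assms by (intro eigensums_polynomial[of _ j] tc.map_formal tc.map_homog)
  from eigensums_decompose[OF this] obtain k g where
    kg: "k \<in> formal_functions n" "g \<in> formal_functions n" "complexify f = k + CC.pb hC g"
      "CC.pb (complexify h_ss) k = 0"
    unfolding L_eq complexify_h_ss by blast
  have retract_pb: "mfps_map retract (CC.pb (complexify x) y) = pb x (mfps_map retract y)" for x y
    using map_retract_bracket[of n P x y] by (simp add: complexify_P)
  define k' g' where "k' = wt_proj W j (mfps_map retract k :: 'k mfps)"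
    and "g' = wt_proj W j (mfps_map retract g :: 'k mfps)"
  have "f = mfps_map retract (complexify f)" by (simp add: map_retract)
  also have "\<dots> = mfps_map retract k + pb h (mfps_map retract g)"
    unfolding kg(3) by (simp add: map_retract retract_pb)
  finally have "wt_proj W j f = wt_proj W j (mfps_map retract k + pb h (mfps_map retract g))" by simp
  then have "f = k' + pb h g'"
    using wt_proj_homog[OF assms(2), of j]
    by (simp add: k'_def g'_def wt_proj_pb_weight_2[OF h(2)])
  moreover have "pb h_ss k' = 0"
  proof -
    have "pb h_ss (mfps_map retract k) = 0"
      using kg(4) retract_pb[of h_ss k] by (simp add: map_retract)
    then show ?thesis unfolding k'_def using wt_proj_pb_weight_2[OF h_ss(2), of j "mfps_map retract k"]
      by simp
  qed
  ultimately show ?thesis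
    using kg(1,2) by (intro exI[of _ k'] exI[of _ g']) (auto simp: k'_def g'_def map_retract_formal)
qed

end

section \<open>Formal canonical transformations\<close>

context lie_poisson
begin

text \<open>The homogeneous parts of the time-one map of the flow with \<open>d\<Phi>/dt = \<Phi> \<circ> ad g(t)\<close>,
  \<open>g(t) = \<Sum> t\<^bsup>i-1\<^esup> g\<^sub>i\<close>: the operator \<open>phi g j\<close> is the coefficient of \<open>t\<^sup>j\<close> and, if \<open>g\<^sub>i\<close>
  has weight \<open>i + 2\<close>, raises the weight by \<open>j\<close>.\<close>

function phi :: "(nat \<Rightarrow> 'a mfps) \<Rightarrow> nat \<Rightarrow> 'a mfps \<Rightarrow> 'a mfps" where
  "phi g j f = (if j = 0 then f
    else mfps_const (1 / of_nat j) * (\<Sum>i\<in>{..<j}. phi g i (pb (g (j - i)) f)))"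
  by auto
termination by (relation "measure (\<lambda>(g, j, f). j)") auto

declare phi.simps [simp del]

lemma phi_0 [simp]: "phi g 0 f = f"
  by (simp add: phi.simps)

text \<open>The differential equation of the flow read off at a power of \<open>t\<close>. With the
  factor \<open>j\<close> kept on the left it has no denominators and also holds for
  \<open>j = 0\<close>.\<close>

lemma phi_rec: "mfps_const (of_nat j) * phi g j f = (\<Sum>i<j. phi g i (pb (g (j - i)) f))"
proof (cases "j = 0")
  case False
  then have "mfps_const (of_nat j) * mfps_const (1 / of_nat j) = (1 :: 'a mfps)"
    by (simp add: mfps_const_simps(6) flip: mfps_const_simps(4))
  then show ?thesis using False by (subst phi.simps) (simp flip: mult.assoc)
qed (simp add: mfps_const_simps)

lemma of_nat_const_cancel:
  assumes "mfps_const (of_nat j) * f = mfps_const (of_nat j) * g" "j \<noteq> 0"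
  shows "f = (g :: 'a mfps)"
proof (rule mfps_ext)
  fix M
  have "mfps_coeff (mfps_const (of_nat j) * f) M = mfps_coeff (mfps_const (of_nat j) * g) M"
    using assms(1) by simp
  then show "mfps_coeff f M = mfps_coeff g M" using assms(2) by simp
qed

lemma phi_add [simp]: "phi g j (f + f') = phi g j f + phi g j f'"
proof (induction j arbitrary: f f' rule: less_induct)
  case (less j)
  show ?case
  proof (cases "j = 0")
    case False
    then show ?thesis
      by (subst (1 2 3) phi.simps) (simp add: less sum.distrib distrib_left)
  qed simp
qed

lemma phi_const_mult [simp]: "phi g j (mfps_const r * f) = mfps_const r * phi g j f"
proof (induction j arbitrary: f rule: less_induct)
  case (less j)
  show ?case
  proof (cases "j = 0")
    case False
    then show ?thesis
      by (subst (1 2) phi.simps) (simp add: less sum_distrib_left mult.left_commute)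
  qed simp
qed

lemma phi_zero [simp]: "phi g j 0 = 0"
  using phi_const_mult[of g j 0 0] by (simp add: mfps_const_simps)

lemma phi_sum [simp]: "phi g j (\<Sum>x\<in>X. f x) = (\<Sum>x\<in>X. phi g j (f x))"
  by (induction X rule: infinite_finite_induct) simp_all

lemma phi_const: "j \<noteq> 0 \<Longrightarrow> phi g j (mfps_const r) = 0"
  by (subst phi.simps) simp

text \<open>Only \<open>g 1\<close> up to \<open>g j\<close> enter. Hence the generators can be
  chosen one after the other, and \<open>g 0\<close> has no influence.\<close>

lemma phi_cong:
  assumes "\<And>i. 0 < i \<Longrightarrow> i \<le> j \<Longrightarrow> g i = g' i"
  shows "phi g j f = phi g' j f"
  using assms
proof (induction j arbitrary: f rule: less_induct)
  case (less j)
  have "phi g i (pb (g (j - i)) f) = phi g' i (pb (g' (j - i)) f)" if "i < j" for i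
  proof -
    have "g (j - i) = g' (j - i)" by (rule less.prems) (use that in auto)
    moreover have "phi g i f = phi g' i f" for f
      by (rule less.IH[OF that]) (use less.prems that in auto)
    ultimately show ?thesis by simp
  qed
  then show ?case by (subst (1 2) phi.simps) simp
qed

lemma phi_formal:
  assumes "\<And>i. g i \<in> formal_functions n" "f \<in> formal_functions n"
  shows "phi g j f \<in> formal_functions n"
  using assms(2)
proof (induction j arbitrary: f rule: less_induct)
  case (less j)
  then show ?case
    by (subst phi.simps) (auto intro!: formal_functions_times formal_functions_sum formal_pb assms(1))
qed

lemma wt_proj_pb_small:
  assumes "homog W (s + 2) g" "k < s"
  shows "wt_proj W k (pb g f) = 0"
proof -
  have "wt_proj W k (pb g (mfps_var a) * mfps_deriv a f) = 0" if "a < n" for a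
    using wt_proj_homog_times[OF homog_pb_var[OF assms(1) that], of k] assms(2) by simp
  then show ?thesis by (subst poisson_bracket_vf) (simp add: vf_apply_def)
qed

lemma wt_proj_phi:
  assumes "\<And>i. homog W (i + 2) (g i)"
  shows "wt_proj W k (phi g j f) = (if j \<le> k then phi g j (wt_proj W (k - j) f) else 0)"
proof (induction j arbitrary: k f rule: less_induct)
  case (less j)
  show ?case
  proof (cases "j = 0")
    case False
    have "wt_proj W k (phi g i (pb (g (j - i)) f))
        = (if j \<le> k then phi g i (pb (g (j - i)) (wt_proj W (k - j) f)) else 0)" if i: "i < j" for i
    proof (cases "j \<le> k")
      case True
      then have "wt_proj W (k - i) (pb (g (j - i)) f) = pb (g (j - i)) (wt_proj W (k - j) f)"
        using wt_proj_pb_homog[OF assms, of "k - j" "j - i" f] i by simp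
      then show ?thesis using True i less.IH[OF i] by simp
    next
      case False
      then show ?thesis using i less.IH[OF i] wt_proj_pb_small[OF assms, of "k - i" "j - i" f] by simp
    qed
    then show ?thesis using False by (subst (1 2) phi.simps) simp
  qed simp
qed

lemma homog_phi:
  assumes "\<And>i. homog W (i + 2) (g i)" "homog W k f"
  shows "homog W (k + j) (phi g j f)"
proof -
  have "wt_proj W (k + j) (phi g j f) = phi g j f"
    using wt_proj_phi[OF assms(1), of "k + j" j f] wt_proj_homog[OF assms(2), of k] by simp
  then show ?thesis by (metis homog_wt_proj)
qed

text \<open>The flow of derivations respects the operation \<open>B\<close>, stated for
  coefficients. Multiplied by \<open>j = a + (j - a)\<close>, both sides satisfy the recursion of
  \<open>phi_rec\<close>.\<close>

lemma phi_bilinear: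
  assumes B: "mfps_bilinear B" and der: "\<And>g f h. pb g (B f h) = B (pb g f) h + B f (pb g h)"
  shows "phi g j (B f h) = (\<Sum>a\<le>j. B (phi g a f) (phi g (j - a) h))"
proof (induction j arbitrary: f h rule: less_induct)
  case (less j)
  note Bs = mfps_bilinearD[OF B] mfps_bilinear_sum[OF B]
  let ?c = "\<lambda>k. mfps_const (of_nat k) :: 'a mfps"
  let ?D = "\<lambda>i. pb (g i)"
  show ?case
  proof (cases "j = 0")
    case False
    have "?c j * phi g j (B f h) = (\<Sum>i<j. \<Sum>a\<le>i. B (phi g a (?D (j - i) f)) (phi g (i - a) h))
        + (\<Sum>i<j. \<Sum>a\<le>i. B (phi g a f) (phi g (i - a) (?D (j - i) h)))"
      by (simp add: phi_rec der less.IH sum.distrib)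
    \<comment> \<open>Grouped by the index \<open>b = i - a\<close> of the factor with
      \<open>h\<close>, the inner sum is the recursion for \<open>phi g (j - b) f\<close>.\<close>
    also have "(\<Sum>i<j. \<Sum>a\<le>i. B (phi g a (?D (j - i) f)) (phi g (i - a) h))
        = (\<Sum>b<j. \<Sum>a<j - b. B (phi g a (?D (j - b - a) f)) (phi g b h))"
      by (subst (1 2) sum.Sigma; (simp; fail)?)
        (rule sum.reindex_bij_witness[where i = "\<lambda>(b, a). (a + b, a)" and j = "\<lambda>(i, a). (i - a, a)"];
          auto)
    also have "\<dots> = (\<Sum>b<j. ?c (j - b) * B (phi g (j - b) f) (phi g b h))"
      by (intro sum.cong refl, unfold Bs(3)[symmetric] phi_rec Bs(7), rule refl)
    also have "\<dots> = (\<Sum>a\<le>j. ?c a * B (phi g a f) (phi g (j - a) h))"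
    proof -
      have "(\<Sum>b<j. ?c (j - b) * B (phi g (j - b) f) (phi g b h))
          = (\<Sum>a\<in>{1..j}. ?c a * B (phi g a f) (phi g (j - a) h))"
        by (rule sum.reindex_bij_witness[where i = "\<lambda>a. j - a" and j = "\<lambda>b. j - b"]) auto
      also have "\<dots> = (\<Sum>a\<le>j. ?c a * B (phi g a f) (phi g (j - a) h))"
        by (rule sum.mono_neutral_left) (auto simp: mfps_const_simps not_less_eq_eq Suc_le_eq)
      finally show ?thesis .
    qed
    also have "(\<Sum>i<j. \<Sum>a\<le>i. B (phi g a f) (phi g (i - a) (?D (j - i) h)))
        = (\<Sum>a<j. \<Sum>b<j - a. B (phi g a f) (phi g b (?D (j - a - b) h)))"
      by (subst (1 2) sum.Sigma; (simp; fail)?)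
        (rule sum.reindex_bij_witness[where i = "\<lambda>(a, b). (a + b, a)" and j = "\<lambda>(i, a). (a, i - a)"];
          auto)
    also have "\<dots> = (\<Sum>a<j. ?c (j - a) * B (phi g a f) (phi g (j - a) h))"
      by (intro sum.cong refl, unfold Bs(4)[symmetric] phi_rec Bs(8), rule refl)
    also have "\<dots> = (\<Sum>a\<le>j. ?c (j - a) * B (phi g a f) (phi g (j - a) h))"
      by (rule sum.mono_neutral_left) (auto simp: mfps_const_simps)
    finally have "?c j * phi g j (B f h)
        = (\<Sum>a\<le>j. (?c a + ?c (j - a)) * B (phi g a f) (phi g (j - a) h))"
      by (simp add: distrib_right sum.distrib)
    also have "\<dots> = ?c j * (\<Sum>a\<le>j. B (phi g a f) (phi g (j - a) h))"
      unfolding sum_distrib_left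
      by (intro sum.cong refl) (simp flip: mfps_const_simps(1) of_nat_add)
    finally show ?thesis by (rule of_nat_const_cancel) (rule False)
  qed simp
qed

end

section \<open>The time-one map as an automorphism of the Poisson algebra\<close>

context lie_poisson
begin

text \<open>The sum of all \<open>phi g j f\<close>. If \<open>g i\<close> has weight
  \<open>i + 2\<close>, then \<open>phi g j\<close> raises weights by \<open>j\<close>, so terms
  with \<open>j > wt W M\<close> do not reach the monomial \<open>M\<close> and the truncation loses
  nothing.\<close>

definition Phi :: "(nat \<Rightarrow> 'a mfps) \<Rightarrow> 'a mfps \<Rightarrow> 'a mfps"
  where "Phi g f = Abs_mfps (\<lambda>M. \<Sum>j\<le>wt W M. mfps_coeff (phi g j f) M)"

lemma mfps_coeff_Phi: "mfps_coeff (Phi g f) M = (\<Sum>j\<le>wt W M. mfps_coeff (phi g j f) M)"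
  by (simp add: Phi_def)

lemma Phi_simps [simp]:
  "Phi g (f + f') = Phi g f + Phi g f'"
  "Phi g (mfps_const r * f) = mfps_const r * Phi g f"
  "Phi g 0 = 0"
  by (rule mfps_ext; simp add: mfps_coeff_Phi sum.distrib sum_distrib_left)+

lemma Phi_sum [simp]: "Phi g (\<Sum>x\<in>X. f x) = (\<Sum>x\<in>X. Phi g (f x))"
  by (induction X rule: infinite_finite_induct) simp_all

lemma Phi_const [simp]: "Phi g (mfps_const r) = mfps_const r"
proof (rule mfps_ext)
  fix M
  have "mfps_coeff (Phi g (mfps_const r)) M
      = (\<Sum>j\<le>wt W M. if j = 0 then mfps_coeff (mfps_const r) M else 0)"
    unfolding mfps_coeff_Phi by (rule sum.cong) (auto simp: phi_const)
  then show "mfps_coeff (Phi g (mfps_const r)) M = mfps_coeff (mfps_const r) M" by simp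
qed

lemma Phi_formal:
  assumes "\<And>i. g i \<in> formal_functions n" "f \<in> formal_functions n"
  shows "Phi g f \<in> formal_functions n"
  unfolding formal_functions_def
proof (intro CollectI allI impI)
  fix M assume "mfps_coeff (Phi g f) M \<noteq> 0"
  then obtain j where "mfps_coeff (phi g j f) M \<noteq> 0"
    unfolding mfps_coeff_Phi by (auto elim!: sum.not_neutral_contains_not_neutral)
  then show "set_mset M \<subseteq> {..<n}"
    using phi_formal[of g f j, OF assms] unfolding formal_functions_def by blast
qed

lemma wt_proj_Phi:
  assumes "\<And>i. homog W (i + 2) (g i)"
  shows "wt_proj W k (Phi g f) = (\<Sum>j\<le>k. phi g j (wt_proj W (k - j) f))"
proof -
  have "wt_proj W k (Phi g f) = (\<Sum>j\<le>k. wt_proj W k (phi g j f))"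
    by (rule mfps_ext) (simp add: mfps_coeff_wt_proj mfps_coeff_Phi)
  then show ?thesis by (simp add: wt_proj_phi[OF assms])
qed

lemma wt_proj_0: "wt_proj W 0 f = mfps_const (mfps_coeff f {#})"
proof (rule mfps_ext)
  fix M
  have "wt W M = 0 \<longleftrightarrow> M = {#}" using size_le_wt[of W M] by auto
  then show "mfps_coeff (wt_proj W 0 f) M = mfps_coeff (mfps_const (mfps_coeff f {#})) M"
    by (simp add: mfps_coeff_wt_proj mfps_coeff_const)
qed

text \<open>\<open>d\<close> is the loss of weight under \<open>B\<close>: 0 for the product, 2 for
  the bracket. The condition \<open>low\<close> rules out contributions whose weight would become
  negative.\<close>

lemma Phi_bilinear:
  assumes g: "\<And>i. homog W (i + 2) (g i)"
    and B: "mfps_bilinear B" and der: "\<And>g f h. pb g (B f h) = B (pb g f) h + B f (pb g h)"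
    and deg: "\<And>k f h. wt_proj W k (B f h) = (\<Sum>p\<le>k + d. B (wt_proj W p f) (wt_proj W (k + d - p) h))"
    and low: "\<And>r f h. r < d \<Longrightarrow> (\<Sum>p\<le>r. B (wt_proj W p f) (wt_proj W (r - p) h)) = 0"
  shows "B (Phi g f) (Phi g h) = Phi g (B f h)"
proof (rule wt_proj_eqI)
  fix k
  note Bs = mfps_bilinearD[OF B] mfps_bilinear_sum[OF B]
  define N where "N = k + d"
  define T where "T = (\<lambda>i p j q. B (phi g i (wt_proj W p f)) (phi g j (wt_proj W q h)))"
  define G where "G = (\<lambda>r. \<Sum>p\<le>r. B (wt_proj W p f) (wt_proj W (r - p) h))"
  have "wt_proj W k (B (Phi g f) (Phi g h)) = (\<Sum>p\<le>N. \<Sum>i\<le>p. \<Sum>j\<le>N - p. T i (p - i) j (N - p - j))"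
    by (simp add: deg N_def wt_proj_Phi[OF g] Bs T_def) (rule sum.cong[OF refl], rule sum.swap)
  also have "\<dots> = (\<Sum>p\<le>N. \<Sum>(i, j)\<in>{..p} \<times> {..N - p}. T i (p - i) j (N - p - j))"
    by (simp add: sum.cartesian_product)
  also have "\<dots> = (\<Sum>(p, i, j)\<in>(SIGMA p:{..N}. {..p} \<times> {..N - p}). T i (p - i) j (N - p - j))"
    by (subst sum.Sigma) (auto intro!: sum.cong)
  \<comment> \<open>Regrouped by the total shift \<open>s = i + j\<close>; now \<open>p\<close> is
    the weight of the part of \<open>f\<close> before the shift, and \<open>a\<close> is the share
    of \<open>s\<close> that falls to \<open>f\<close>.\<close>
  also have "\<dots> = (\<Sum>(s, p, a)\<in>(SIGMA s:{..N}. {..N - s} \<times> {..s}). T a p (s - a) (N - s - p))"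
    by (rule sum.reindex_bij_witness[where i = "\<lambda>(s, p, a). (p + a, a, s - a)"
          and j = "\<lambda>(p, i, j). (i + j, p - i, i)"]) (auto simp: add.commute)
  also have "\<dots> = (\<Sum>s\<le>N. \<Sum>(p, a)\<in>{..N - s} \<times> {..s}. T a p (s - a) (N - s - p))"
    by (subst sum.Sigma) (auto intro!: sum.cong)
  also have "\<dots> = (\<Sum>s\<le>N. \<Sum>p\<le>N - s. \<Sum>a\<le>s. T a p (s - a) (N - s - p))"
    by (simp add: sum.cartesian_product)
  also have "\<dots> = (\<Sum>s\<le>N. phi g s (G (N - s)))"
    by (simp add: G_def T_def phi_bilinear[OF B der])
  \<comment> \<open>For \<open>s > k\<close> the weight \<open>N - s\<close> is below
    \<open>d\<close>, where \<open>low\<close> applies.\<close>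
  also have "\<dots> = (\<Sum>s\<le>k. phi g s (G (N - s)))"
  proof (rule sum.mono_neutral_right)
    show "\<forall>s\<in>{..N} - {..k}. phi g s (G (N - s)) = 0"
    proof
      fix s assume "s \<in> {..N} - {..k}"
      then have "N - s < d" by (auto simp: N_def)
      then have "G (N - s) = 0" unfolding G_def by (rule low)
      then show "phi g s (G (N - s)) = 0" by simp
    qed
  qed (auto simp: N_def)
  also have "\<dots> = wt_proj W k (Phi g (B f h))"
    by (simp add: wt_proj_Phi[OF g] deg G_def N_def)
  finally show "wt_proj W k (B (Phi g f) (Phi g h)) = wt_proj W k (Phi g (B f h))" .
qed

lemma Phi_times:
  assumes "\<And>i. homog W (i + 2) (g i)"
  shows "Phi g f * Phi g h = Phi g (f * h)"
proof (rule Phi_bilinear[where d = 0, OF assms])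
  show "mfps_bilinear ((*) :: 'a mfps \<Rightarrow> _)"
    by (simp add: mfps_bilinear_def distrib_left distrib_right mult.assoc mult.left_commute)
qed (simp_all add: pb_times_right wt_proj_times)

lemma Phi_pb:
  assumes "\<And>i. homog W (i + 2) (g i)"
  shows "pb (Phi g f) (Phi g h) = Phi g (pb f h)"
proof (rule Phi_bilinear[where d = 2, OF assms mfps_bilinear_pb])
  show "pb g (pb f h) = pb (pb g f) h + pb f (pb g h)" for g f h by (rule pb_jacobi)
  show "wt_proj W k (pb f h) = (\<Sum>p\<le>k + 2. pb (wt_proj W p f) (wt_proj W (k + 2 - p) h))" for k f h
    by (rule wt_proj_pb)
  fix r :: nat and f h :: "'a mfps"
  assume r: "r < 2"
  show "(\<Sum>p\<le>r. pb (wt_proj W p f) (wt_proj W (r - p) h)) = 0"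
  proof (rule sum.neutral, intro ballI)
    fix p assume "p \<in> {..r}"
    \<comment> \<open>One of the two arguments then has weight 0, so it is a constant.\<close>
    with r have "p = 0 \<or> r - p = 0" by auto
    then show "pb (wt_proj W p f) (wt_proj W (r - p) h) = 0" by (auto simp: wt_proj_0)
  qed
qed

lemma Phi_monomial:
  assumes "\<And>i. homog W (i + 2) (g i)"
  shows "Phi g (\<Prod>i\<in>#M. mfps_var i) = (\<Prod>i\<in>#M. Phi g (mfps_var i))"
proof (induction M)
  case empty
  then show ?case using Phi_const[of g 1] by (simp add: mfps_const_simps)
next
  case (add i M)
  then show ?case by (simp flip: Phi_times[OF assms])
qed

end

lemma mfps_coeff_prod_mset_eq_0:
  assumes "\<And>i. i \<in># M \<Longrightarrow> mfps_coeff (\<phi> i) {#} = (0 :: 'a::comm_ring_1)" "size N < size M"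
  shows "mfps_coeff (\<Prod>i\<in>#M. \<phi> i) N = 0"
  using assms
proof (induction M arbitrary: N)
  case (add i M)
  have "mfps_coeff (\<phi> i) A * mfps_coeff (\<Prod>i\<in>#M. \<phi> i) B = 0" if "A + B = N" for A B
  proof (cases "A = {#}")
    case False
    then have "size A > 0" by (simp add: nonempty_has_size)
    then have "size B < size M" using add.prems(2) that by auto
    then show ?thesis using add by simp
  qed (simp add: add.prems)
  then show ?case by (auto simp: mfps_coeff_times intro!: sum.neutral)
qed simp

context lie_poisson
begin

text \<open>For a polynomial this is multiplicativity. At a fixed \<open>N\<close> only finitely
  many monomials of \<open>f\<close> matter, since \<open>Phi\<close> never lowers weights;
  \<open>mfps_compose\<close> keeps still fewer, but the others contribute 0 because the new
  coordinates have no constant term.\<close>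

lemma Phi_compose:
  assumes g: "\<And>i. homog W (i + 2) (g i)" and f: "f \<in> formal_functions n"
  shows "Phi g f = mfps_compose n f (\<lambda>a. Phi g (mfps_var a))"
proof (rule mfps_ext)
  fix N
  let ?k = "wt W N"
  let ?T = "{M. set_mset M \<subseteq> {..<n} \<and> size M \<le> ?k}"
  let ?\<phi> = "\<lambda>a. Phi g (mfps_var a)"
  have fin: "finite ?T" by (rule finite_multisets_bounded) simp
  define f' where "f' = (\<Sum>M\<in>?T. mfps_const (mfps_coeff f M) * (\<Prod>i\<in>#M. mfps_var i))"
  have f': "mfps_coeff f' M = (if M \<in> ?T then mfps_coeff f M else 0)" for M
    using fin by (simp add: f'_def mfps_coeff_mono if_distrib sum.delta' cong: if_cong)
  have "wt_proj W p f = wt_proj W p f'" if "p \<le> ?k" for p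
  proof (rule mfps_ext)
    fix M
    have "mfps_coeff f M = mfps_coeff f' M" if "wt W M = p"
    proof -
      have "size M \<le> ?k" using size_le_wt[of W M] that \<open>p \<le> ?k\<close> by simp
      then show ?thesis using f unfolding f' formal_functions_def by auto
    qed
    then show "mfps_coeff (wt_proj W p f) M = mfps_coeff (wt_proj W p f') M"
      by (simp add: mfps_coeff_wt_proj)
  qed
  then have "wt_proj W ?k (Phi g f) = wt_proj W ?k (Phi g f')"
    by (simp add: wt_proj_Phi[OF g])
  then have "mfps_coeff (Phi g f) N = mfps_coeff (Phi g f') N"
    by (metis mfps_coeff_wt_proj)
  also have "\<dots> = (\<Sum>M\<in>?T. mfps_coeff f M * mfps_coeff (\<Prod>i\<in>#M. ?\<phi> i) N)"
    by (simp add: f'_def Phi_monomial[OF g])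
  also have "\<dots> = (\<Sum>M | set_mset M \<subseteq> {..<n} \<and> size M \<le> size N.
      mfps_coeff f M * mfps_coeff (\<Prod>i\<in>#M. ?\<phi> i) N)"
  proof (rule sum.mono_neutral_right[OF fin])
    show "{M. set_mset M \<subseteq> {..<n} \<and> size M \<le> size N} \<subseteq> ?T"
      using size_le_wt[of W N] by (auto intro: order.trans)
    have "mfps_coeff (?\<phi> i) {#} = 0" for i
      by (simp add: mfps_coeff_Phi mfps_coeff_var)
    then show "\<forall>M\<in>?T - {M. set_mset M \<subseteq> {..<n} \<and> size M \<le> size N}.
        mfps_coeff f M * mfps_coeff (\<Prod>i\<in>#M. ?\<phi> i) N = 0"
      by (auto intro!: mfps_coeff_prod_mset_eq_0)
  qed
  finally show "mfps_coeff (Phi g f) N = mfps_coeff (mfps_compose n f ?\<phi>) N"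
    by (simp add: mfps_compose_def)
qed

text \<open>\<open>Phi\<close> respects the bracket and acts by substitution, so \<open>P\<close>
  keeps its form. The corrections strictly raise weights; hence, in the chosen order of variables,
  the linear part is upper triangular with ones on the diagonal.\<close>

lemma Phi_coordinates:
  assumes g: "\<And>i. homog W (i + 2) (g i)" "\<And>i. g i \<in> formal_functions n"
  shows "canonical_coordinates l m c P (\<lambda>a. Phi g (mfps_var a))"
  unfolding canonical_coordinates_def
proof
  let ?\<phi> = "\<lambda>a. Phi g (mfps_var a)"
  show "bivector_in_coordinates n ?\<phi> P P"
    unfolding bivector_in_coordinates_def
    by (simp add: formal_P Phi_pb[OF g(1)] pb_var_var Phi_compose[OF g(1)])
  show "formal_coordinates n ?\<phi>"
    unfolding formal_coordinates_def
  proof (intro conjI allI impI)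
    fix i assume i: "i < n"
    show "?\<phi> i \<in> formal_functions n" by (intro Phi_formal g) (use i in auto)
    show "mfps_coeff (?\<phi> i) {#} = 0" by (simp add: mfps_coeff_Phi mfps_coeff_var)
  next
    let ?A = "mat n n (\<lambda>(i, j). mfps_coeff (?\<phi> i) {#j#})"
    have coeff: "mfps_coeff (?\<phi> i) {#j#} = (if i = j then 1 else 0)" if "W j \<le> W i" for i j
    proof -
      have "mfps_coeff (phi g s (mfps_var i)) {#j#} = 0" if "s \<noteq> 0" for s
      proof (rule ccontr)
        assume "mfps_coeff (phi g s (mfps_var i)) {#j#} \<noteq> 0"
        then have "wt W {#j#} = W i + s"
          using homog_phi[OF g(1) homog_var, of i s] unfolding homog_def by blast
        then have "W j = W i + s" by simp
        with that \<open>W j \<le> W i\<close> show False by simp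
      qed
      then have "mfps_coeff (?\<phi> i) {#j#} = (\<Sum>s\<le>W j. if s = 0 then mfps_coeff (mfps_var i) {#j#} else 0)"
        unfolding mfps_coeff_Phi by (intro sum.cong) auto
      then show ?thesis by (auto simp: mfps_coeff_var)
    qed
    have A: "?A \<in> carrier_mat n n" by simp
    have "upper_triangular ?A"
      by (rule upper_triangularI) (auto simp: coeff W_def)
    then have "det ?A = prod_list (diag_mat ?A)" by (rule det_upper_triangular[OF _ A])
    also have "diag_mat ?A = map (\<lambda>i. 1) [0..<n]"
      unfolding diag_mat_def by (auto simp: coeff)
    also have "prod_list \<dots> = (1 :: 'a)" by (simp add: map_replicate_const)
    finally have "det ?A \<noteq> 0" by simp
    from det_non_zero_imp_unit[OF A this, of undefined] obtain B where
      "B \<in> carrier_mat n n" "?A * B = 1\<^sub>m n" "B * ?A = 1\<^sub>m n"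
      by (auto simp: Units_def ring_mat_def)
    then show "invertible_mat ?A"
      unfolding invertible_mat_def inverts_mat_def square_mat.simps by (intro conjI exI[of _ B]) auto
  qed
qed

end

section \<open>The normal form\<close>

context weight_2_hamiltonian
begin

text \<open>At weight \<open>j + 2\<close> the unknown \<open>K j\<close> appears as itself, and the
  new generator \<open>g j\<close> only through its bracket with \<open>K 0 = h\<close>. The
  homological equation determines suitable values of both.\<close>

lemma normal_form_series:
  assumes H: "H \<in> formal_functions n" "wt_proj W 2 H = h"
  obtains g K where "\<And>j. homog W (j + 2) (g j)" "\<And>j. g j \<in> formal_functions n"
    "\<And>j. homog W (j + 2) (K j)" "\<And>j. K j \<in> formal_functions n" "\<And>j. pb h_ss (K j) = 0"
    "\<And>j. wt_proj W (j + 2) H = (\<Sum>a\<le>j. phi g a (K (j - a)))" "K 0 = h"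
proof -
  \<comment> \<open>\<open>F j\<close> is the pair of \<open>g j\<close> and \<open>K j\<close>. The
    update \<open>F(j := r)\<close> makes the relation depend only on the candidate \<open>r\<close>
    and the values below \<open>j\<close>, as dependent choice requires.\<close>
  define R where "R = (\<lambda>(F :: nat \<Rightarrow> 'k mfps \<times> 'k mfps) j r.
    homog W (j + 2) (fst r) \<and> fst r \<in> formal_functions n \<and>
    homog W (j + 2) (snd r) \<and> snd r \<in> formal_functions n \<and> pb h_ss (snd r) = 0 \<and>
    wt_proj W (j + 2) H = (\<Sum>a\<le>j. phi (\<lambda>i. fst ((F(j := r)) i)) a (snd ((F(j := r)) (j - a)))) \<and>
    (j = 0 \<longrightarrow> snd r = h))"
  have "\<exists>F. \<forall>j. R F j (F j)"
  proof (rule dependent_wellorder_choice)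
    fix r :: "'k mfps \<times> 'k mfps" and F F' :: "nat \<Rightarrow> 'k mfps \<times> 'k mfps" and j
    assume eq: "\<And>i. i < j \<Longrightarrow> F i = F' i"
    have "phi (\<lambda>i. fst ((F(j := r)) i)) a (snd ((F(j := r)) (j - a)))
        = phi (\<lambda>i. fst ((F'(j := r)) i)) a (snd ((F'(j := r)) (j - a)))" if "a \<le> j" for a
    proof -
      have "snd ((F(j := r)) (j - a)) = snd ((F'(j := r)) (j - a))"
        using eq[of "j - a"] by auto
      moreover have "phi (\<lambda>i. fst ((F(j := r)) i)) a f = phi (\<lambda>i. fst ((F'(j := r)) i)) a f" for f
        by (rule phi_cong) (use eq that in auto)
      ultimately show ?thesis by simp
    qed
    then show "R F j r = R F' j r" unfolding R_def by (simp cong: sum.cong_simp)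
  next
    fix j and F :: "nat \<Rightarrow> 'k mfps \<times> 'k mfps"
    assume IH: "\<And>i. i < j \<Longrightarrow> R F i (F i)"
    show "\<exists>r. R F j r"
    proof (cases "j = 0")
      case True
      then show ?thesis
        by (intro exI[of _ "(0, h)"]) (simp add: R_def h h_ss_commutes H numeral_2_eq_2[symmetric])
    next
      case False
      define g where "g = (\<lambda>i. if i < j then fst (F i) else 0)"
      define K where "K = (\<lambda>i. snd (F i))"
      have g: "homog W (i + 2) (g i)" "g i \<in> formal_functions n" for i
        using IH[of i] by (auto simp: g_def R_def)
      have K: "homog W (i + 2) (K i)" "K i \<in> formal_functions n" if "i < j" for i
        using IH[OF that] by (auto simp: K_def R_def)
      have K0: "K 0 = h" using IH[of 0] False by (simp add: R_def K_def)
      \<comment> \<open>What is left for \<open>K j\<close> if \<open>g j\<close> were 0.\<close>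
      define f where "f = wt_proj W (j + 2) H - (\<Sum>a\<in>{1..j}. phi g a (K (j - a)))"
      have "f \<in> formal_functions n" unfolding f_def
        using H K by (intro formal_functions_minus formal_functions_sum phi_formal g) auto
      moreover have "homog W (j + 2) f" unfolding f_def
      proof (intro homog_minus homog_wt_proj homog_sum)
        fix a assume "a \<in> {1..j}"
        then have "homog W (j - a + 2 + a) (phi g a (K (j - a)))" by (intro homog_phi g K) auto
        moreover have "j - a + 2 + a = j + 2" using \<open>a \<in> {1..j}\<close> by auto
        ultimately show "homog W (j + 2) (phi g a (K (j - a)))" by (simp only:)
      qed
      ultimately obtain k u where ku: "k \<in> formal_functions n" "homog W (j + 2) k"
        "u \<in> formal_functions n" "homog W (j + 2) u" "f = k + pb h u" "pb h_ss k = 0"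
        using homological_equation by blast
      \<comment> \<open>\<open>g j\<close> enters \<open>j * phi g j h\<close> only as
        \<open>{g j, h}\<close>. For \<open>g j = - j u\<close> this is \<open>j {h, u}\<close>, so
        \<open>phi g j h\<close> gains exactly \<open>{h, u}\<close>.\<close>
      define r where "r = (- (mfps_const (of_nat j) * u), k)"
      let ?g = "\<lambda>i. fst ((F(j := r)) i)" and ?K = "\<lambda>i. snd ((F(j := r)) i)"
      have phi_less: "phi ?g a x = phi g a x" if "a < j" for a x
        by (rule phi_cong) (use that in \<open>auto simp: g_def\<close>)
      have phi_j: "phi ?g j h = phi g j h + pb h u"
      proof (rule of_nat_const_cancel[OF _ False])
        let ?c = "mfps_const (of_nat j) :: 'k mfps"
        have "?c * phi ?g j h = (\<Sum>i<j. phi g i (pb (?g (j - i)) h))"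
          unfolding phi_rec by (intro sum.cong refl phi_less) auto
        also have "\<dots> = (\<Sum>i<j. phi g i (pb (g (j - i)) h) + (if i = 0 then ?c * pb h u else 0))"
        proof (rule sum.cong[OF refl])
          fix i assume i: "i \<in> {..<j}"
          have "pb (- (?c * u)) h = ?c * pb h u" using pb_skew[of u h] by simp
          then show "phi g i (pb (?g (j - i)) h)
              = phi g i (pb (g (j - i)) h) + (if i = 0 then ?c * pb h u else 0)"
            using i False by (auto simp: g_def r_def)
        qed
        also have "\<dots> = ?c * phi g j h + ?c * pb h u"
          using False by (simp add: sum.distrib phi_rec)
        finally show "?c * phi ?g j h = ?c * (phi g j h + pb h u)" by (simp add: distrib_left)
      qed
      have "{..j} = insert 0 {1..j}" by auto
      then have "(\<Sum>a\<le>j. phi ?g a (?K (j - a))) = ?K j + (\<Sum>a\<in>{1..j}. phi ?g a (?K (j - a)))"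
        by simp
      also have "(\<Sum>a\<in>{1..j}. phi ?g a (?K (j - a)))
          = (\<Sum>a\<in>{1..j}. phi g a (K (j - a)) + (if a = j then pb h u else 0))"
      proof (rule sum.cong[OF refl])
        fix a assume a: "a \<in> {1..j}"
        show "phi ?g a (?K (j - a)) = phi g a (K (j - a)) + (if a = j then pb h u else 0)"
        proof (cases "a = j")
          case True
          have "?K 0 = h" using False K0 by (simp add: K_def)
          then show ?thesis using True phi_j K0 by simp
        next
          case False
          moreover have "j - a \<noteq> j" using a by auto
          ultimately show ?thesis using a phi_less[of a] by (simp add: K_def)
        qed
      qed
      also have "\<dots> = (\<Sum>a\<in>{1..j}. phi g a (K (j - a))) + pb h u"
        using False by (simp add: sum.distrib)
      also have "?K j + ((\<Sum>a\<in>{1..j}. phi g a (K (j - a))) + pb h u) = wt_proj W (j + 2) H"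
        using ku(5) by (simp add: f_def r_def algebra_simps)
      finally have "R F j r"
        using ku False unfolding R_def r_def by auto
      then show ?thesis ..
    qed
  qed
  then obtain F where F: "\<And>j. R F j (F j)" by blast
  note F = F[unfolded R_def fun_upd_triv]
  show ?thesis
    by (rule that[of "\<lambda>j. fst (F j)" "\<lambda>j. snd (F j)"]) (use F in blast)+
qed

end

section \<open>The linear part of the field in normal form\<close>

context weight_2_hamiltonian
begin

text \<open>The linear part \<open>T\<close> of the vector field of \<open>K\<close>: terms of weight greater than \<open>2\<close> only
  contribute a block mapping the symplectic variables to the Lie algebra variables.\<close>

context
  fixes K :: "'k mfps"
  assumes K: "K \<in> formal_functions n" "wt_proj W 0 K = 0" "wt_proj W 1 K = 0" "wt_proj W 2 K = h"
    and commutes: "pb h_ss K = 0"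
begin

lemma ham_matrix_h: "a < n \<Longrightarrow> W b \<noteq> W a \<Longrightarrow> ham_matrix h a b = 0"
  using homog_pb_var[of 0 h a] h(2) unfolding homog_def ham_matrix_def
  by (metis add.left_neutral add.right_neutral numeral_2_eq_2 one_add_one wt_simps(1,2))

lemma S_block: "a < n \<Longrightarrow> b < n \<Longrightarrow> W b \<noteq> W a \<Longrightarrow> S a b = 0"
  using S_homog[of a] unfolding homog_def
  by (metis add.right_neutral mfps_coeff_lin_single wt_simps(1,2))

text \<open>The entry \<open>(a, b)\<close> comes from the part of \<open>K\<close> of weight
  \<open>W b + 2 - W a\<close>. This is 2 within the diagonal blocks and 1 below them, where
  \<open>K\<close> has no terms; only the block with \<open>W a = 1\<close> and
  \<open>W b = 2\<close> sees weight 3.\<close>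

lemma ham_matrix_K:
  assumes "a < n" "b < n" "W b \<le> W a"
  shows "ham_matrix K a b = ham_matrix h a b"
proof -
  have "ham_matrix K a b = mfps_coeff (wt_proj W (W b) (pb K (mfps_var a))) {#b#}"
    by (simp add: ham_matrix_def mfps_coeff_wt_proj)
  also have "wt_proj W (W b) (pb K (mfps_var a))
      = (\<Sum>p\<le>W b + 2. if p = W b + 2 - W a then pb (wt_proj W p K) (mfps_var a) else 0)"
    unfolding wt_proj_pb
  proof (rule sum.cong[OF refl])
    fix p assume "p \<in> {..W b + 2}"
    then have "W b + 2 - p = W a \<longleftrightarrow> p = W b + 2 - W a"
      by (auto simp: W_def)
    then show "pb (wt_proj W p K) (wt_proj W (W b + 2 - p) (mfps_var a))
        = (if p = W b + 2 - W a then pb (wt_proj W p K) (mfps_var a) else 0)"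
      using wt_proj_homog[OF homog_var, of W "W b + 2 - p" a, where 'a = 'k] by simp
  qed
  also have "\<dots> = pb (wt_proj W (W b + 2 - W a) K) (mfps_var a)"
    by (subst sum.delta) simp_all
  finally have *: "ham_matrix K a b = ham_matrix (wt_proj W (W b + 2 - W a) K) a b"
    by (simp add: ham_matrix_def)
  show ?thesis
  proof (cases "W b = W a")
    case True
    then show ?thesis using K(4) unfolding * by simp
  next
    case False
    then have "W b + 2 - W a = 1" using assms(3) by (auto simp: W_def split: if_splits)
    then show ?thesis using ham_matrix_h[OF assms(1) False] K(3) unfolding * by (simp add: ham_matrix_zero)
  qed
qed

text \<open>The field of \<open>h_ss\<close> is linear and preserves degree, so commuting with the
  field of \<open>K\<close> it commutes with the linear part.\<close>

lemma ham_matrix_K_commutes: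
  assumes "a < n" "b < n"
  shows "mat_mult n S (ham_matrix K) a b = mat_mult n (ham_matrix K) S a b"
proof -
  let ?p = "wt_proj (\<lambda>_. 1) 1 :: 'k mfps \<Rightarrow> _"
  have lin_part: "?p (pb K (mfps_var c)) = lin n (ham_matrix K c)" if "c < n" for c
  proof -
    have "pb K (mfps_var c) \<in> formal_functions n" using that by (intro formal_pb K) auto
    then have "?p (pb K (mfps_var c)) = lin n (\<lambda>b. mfps_coeff (pb K (mfps_var c)) {#b#})"
      by (rule degree_one_eq_lin)
    then show ?thesis by (simp add: ham_matrix_def[abs_def])
  qed
  have "pb h_ss (pb K (mfps_var a)) = pb K (pb h_ss (mfps_var a))"
    using pb_jacobi[of h_ss K "mfps_var a"] commutes by simp
  then have "?p (linear_op n S (pb K (mfps_var a))) = ?p (pb K (lin n (S a)))"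
    using assms by (simp add: h_ss(3))
  also have "?p (linear_op n S (pb K (mfps_var a))) = lin n (mat_mult n (ham_matrix K) S a)"
    unfolding wt_proj_linear_op_degree lin_part[OF assms(1)] linear_op_lin mat_mult_def ..
  also have "?p (pb K (lin n (S a))) = lin n (mat_mult n S (ham_matrix K) a)"
  proof -
    have "?p (pb K (lin n (S a))) = (\<Sum>c<n. mfps_const (S a c) * ?p (pb K (mfps_var c)))"
      by (simp add: lin_def)
    also have "\<dots> = (\<Sum>c<n. mfps_const (S a c) * lin n (ham_matrix K c))"
      by (intro sum.cong refl) (simp only: lin_part lessThan_iff)
    finally show ?thesis by (simp add: mat_mult_def lin_sum lin_const_mult)
  qed
  finally show ?thesis using assms(2) by (simp add: lin_inject)
qed

definition N :: "nat \<Rightarrow> nat \<Rightarrow> 'k" where "N a b = ham_matrix K a b - S a b"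

definition N0 :: "nat \<Rightarrow> nat \<Rightarrow> 'k" where "N0 a b = ham_matrix h a b - S a b"

lemma linear_op_N0: "linear_op n N0 f = pb h f - pb h_ss f"
  unfolding weight_2_linear_op[OF h] h_ss(3) linear_op_def N0_def lin_minus
  by (rule vf_apply_fields_minus)

lemma linear_op_N0_pow: "(linear_op n N0 ^^ n) (lin n u) = 0"
proof -
  have lin_pow: "(linear_op n N0 ^^ k) (lin n u) = (\<Sum>a<n. mfps_const (u a) * (linear_op n N0 ^^ k) (mfps_var a))" for k
    by (induction k) (simp_all add: lin_def)
  have "linear_op n N0 = (\<lambda>f. pb h f - pb h_ss f)"
    by (simp add: fun_eq_iff linear_op_N0)
  then have "(linear_op n N0 ^^ n) (mfps_var a) = 0" if "a < n" for a
    using nilpotent_part_pow[OF that] by simp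
  then show ?thesis unfolding lin_pow by simp
qed

text \<open>\<open>N\<close> and \<open>N0\<close> differ only by the block from symplectic to Lie
  algebra variables. The difference of their values is thus a \<open>zform\<close>, and 0 on forms
  without symplectic variables.\<close>

lemma linear_op_N_lin:
  obtains w where "linear_op n N (lin n u) = linear_op n N0 (lin n u) + zform w"
    "(\<And>a. a < 2*l \<Longrightarrow> u a = 0) \<Longrightarrow> zform w = 0"
proof -
  define d where "d = (\<lambda>b. \<Sum>a<n. u a * (N a b - N0 a b))"
  have d: "linear_op n N (lin n u) = linear_op n N0 (lin n u) + lin n d"
    unfolding linear_op_lin lin_add[symmetric] d_def
    by (intro lin_cong) (simp add: right_diff_distrib sum_subtractf)
  have NN: "N a b = N0 a b" if "a < n" "b < n" "2*l \<le> a \<or> b < 2*l" for a b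
    using ham_matrix_K[OF that(1,2)] that(3) by (auto simp: N_def N0_def W_def)
  have "lin n d = zform (\<lambda>i. d (2*l + i))"
  proof -
    have "d b = 0" if "b < 2*l" for b
      unfolding d_def using NN[of _ b] that by (intro sum.neutral) auto
    then have "lin (2*l) d = lin (2*l) (\<lambda>_. 0)" by (intro lin_cong) simp
    then show ?thesis unfolding lin_split by (simp add: lin_def mfps_const_simps)
  qed
  moreover have "zform (\<lambda>i. d (2*l + i)) = 0" if "\<And>a. a < 2*l \<Longrightarrow> u a = 0"
    unfolding zform_eq_0
  proof (intro allI impI)
    fix i assume "i < m"
    have "u a * (N a (2*l + i) - N0 a (2*l + i)) = 0" if "a < n" for a
      using \<open>\<And>a. a < 2*l \<Longrightarrow> u a = 0\<close>[of a] NN[of a "2*l + i"] that \<open>i < m\<close> by (cases "a < 2*l") auto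
    then show "d (2*l + i) = 0" unfolding d_def by (intro sum.neutral) auto
  qed
  ultimately show ?thesis using d that by simp
qed

lemma zform_lin_vanishing: "\<exists>u. zform w = lin n u \<and> (\<forall>a<2*l. u a = 0)"
proof (intro exI conjI)
  let ?u = "\<lambda>a. if a < 2*l then 0 else w (a - 2*l)"
  have "lin n ?u = lin (2*l) (\<lambda>_. 0) + zform w"
    unfolding lin_split by (intro arg_cong2[of _ _ _ _ "(+)"] lin_cong zform_cong) auto
  then show "zform w = lin n ?u" by (simp add: lin_def mfps_const_simps)
qed simp

lemma linear_op_N0_zform: "\<exists>w'. linear_op n N0 (zform w) = zform w'"
proof -
  obtain u where u: "zform w = lin n u" "\<And>a. a < 2*l \<Longrightarrow> u a = 0"
    using zform_lin_vanishing by blast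
  define d where "d = (\<lambda>b. \<Sum>a<n. u a * N0 a b)"
  have "d b = 0" if "b < 2*l" for b
    unfolding d_def
  proof (rule sum.neutral, intro ballI)
    fix a assume "a \<in> {..<n}"
    then show "u a * N0 a b = 0"
      using u(2)[of a] ham_matrix_h[of a b] S_block[of a b] that by (cases "a < 2*l") (auto simp: N0_def W_def)
  qed
  then have "lin (2*l) d = lin (2*l) (\<lambda>_. 0)" by (intro lin_cong) simp
  then have "lin n d = zform (\<lambda>i. d (2*l + i))" unfolding lin_split by (simp add: lin_def mfps_const_simps)
  then show ?thesis unfolding u(1) linear_op_lin d_def[symmetric] by blast
qed

lemma linear_op_N_zform: "linear_op n N (zform w) = linear_op n N0 (zform w)"
proof -
  obtain u where u: "zform w = lin n u" "\<And>a. a < 2*l \<Longrightarrow> u a = 0"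
    using zform_lin_vanishing by blast
  obtain w' where "linear_op n N (lin n u) = linear_op n N0 (lin n u) + zform w'" "zform w' = 0"
    using linear_op_N_lin[of u] u(2) by blast
  then show ?thesis by (simp add: u(1))
qed

text \<open>Modulo \<open>zform\<close>s \<open>N\<close> agrees with \<open>N0\<close>, so
  \<open>n\<close> steps lead into the \<open>zform\<close>s. There the two coincide, and
  \<open>n\<close> further steps give 0.\<close>

lemma linear_op_N_nilpotent: "(linear_op n N ^^ (n + n)) (lin n u) = 0"
proof -
  have lin: "\<exists>u'. (linear_op n N0 ^^ k) (lin n u) = lin n u'" for k
    by (induction k) (auto simp: linear_op_lin)
  have "\<exists>w. (linear_op n N ^^ k) (lin n u) = (linear_op n N0 ^^ k) (lin n u) + zform w" for k
  proof (induction k)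
    case 0
    show ?case by (intro exI[of _ "\<lambda>_. 0"]) (simp add: zform_eq_0)
  next
    case (Suc k)
    then obtain w where w: "(linear_op n N ^^ k) (lin n u) = (linear_op n N0 ^^ k) (lin n u) + zform w" ..
    obtain u' where u': "(linear_op n N0 ^^ k) (lin n u) = lin n u'" using lin by blast
    obtain w' where "linear_op n N (lin n u') = linear_op n N0 (lin n u') + zform w'"
      using linear_op_N_lin by metis
    moreover obtain w'' where "linear_op n N0 (zform w) = zform w''" using linear_op_N0_zform by blast
    ultimately have "(linear_op n N ^^ Suc k) (lin n u)
        = (linear_op n N0 ^^ Suc k) (lin n u) + zform (\<lambda>i. w' i + w'' i)"
      by (simp add: w u' linear_op_N_zform zform_add)
    then show ?case by (intro exI[of _ "\<lambda>i. w' i + w'' i"])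
  qed
  then obtain w where "(linear_op n N ^^ n) (lin n u) = (linear_op n N0 ^^ n) (lin n u) + zform w"
    by blast
  then have "(linear_op n N ^^ n) (lin n u) = zform w" by (simp add: linear_op_N0_pow)
  moreover have "(linear_op n N ^^ k) (zform w) = (linear_op n N0 ^^ k) (zform w) \<and>
      (\<exists>w'. (linear_op n N0 ^^ k) (zform w) = zform w')" for k
  proof (induction k)
    case (Suc k)
    then show ?case using linear_op_N_zform linear_op_N0_zform by fastforce
  qed auto
  moreover have "(linear_op n N0 ^^ n) (zform w) = 0"
    using zform_lin[of w] linear_op_N0_pow by auto
  moreover have "(linear_op n N ^^ (n + n)) f = (linear_op n N ^^ n) ((linear_op n N ^^ n) f)" for f
    by (simp only: funpow_add[of n n] o_apply)
  ultimately show ?thesis by (simp only:)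
qed

lemma semisimple_part: "is_semisimple_part n (mat n n (\<lambda>(a, b). ham_matrix K a b)) (mat n n (\<lambda>(a, b). S a b))"
  unfolding is_semisimple_part_def
proof (intro conjI bexI exI)
  let ?S = "mat n n (\<lambda>(a, b). S a b)" and ?N = "mat n n (\<lambda>(a, b). N a b)"
  show "?S \<in> carrier_mat n n" "?N \<in> carrier_mat n n" by simp_all
  show "semisimple_mat ?S" by (rule S_semisimple)
  have prod: "mat n n (\<lambda>(a, b). A a b) * mat n n (\<lambda>(a, b). B a b) = mat n n (\<lambda>(a, b). mat_mult n A B a b)"
    for A B :: "nat \<Rightarrow> nat \<Rightarrow> 'k"
    by (rule eq_matI) (auto simp: scalar_prod_def mat_mult_def lessThan_atLeast0)
  have "mat_mult n S N a b = mat_mult n N S a b" if "a < n" "b < n" for a b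
    using ham_matrix_K_commutes[OF that]
    by (simp add: mat_mult_def N_def right_diff_distrib left_diff_distrib sum_subtractf)
  then show "?S * ?N = ?N * ?S" unfolding prod by (intro eq_matI) auto
  show "mat n n (\<lambda>(a, b). ham_matrix K a b) = ?S + ?N"
    by (rule eq_matI) (auto simp: N_def)
  have pow: "(linear_op n N ^^ k) (mfps_var a) = lin n (\<lambda>b. (?N ^\<^sub>m k) $$ (a, b))" if "a < n" for a k
  proof (induction k)
    case 0
    have "lin n (\<lambda>b. (?N ^\<^sub>m 0) $$ (a, b)) = lin n (\<lambda>b. if b = a then 1 else 0)"
      using that by (intro lin_cong) auto
    then show ?case using that by (simp add: lin_unit)
  next
    case (Suc k)
    have "(?N ^\<^sub>m k) \<in> carrier_mat n n" by simp
    then have "(?N ^\<^sub>m Suc k) $$ (a, b) = (\<Sum>c<n. (?N ^\<^sub>m k) $$ (a, c) * N c b)" if "b < n" for b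
      using \<open>a < n\<close> that by (simp add: scalar_prod_def lessThan_atLeast0)
    then show ?case by (simp add: Suc linear_op_lin cong: lin_cong)
  qed
  show "?N ^\<^sub>m (n + n) = 0\<^sub>m n n"
  proof (rule eq_matI)
    fix a b assume "a < dim_row (0\<^sub>m n n :: 'k mat)" "b < dim_col (0\<^sub>m n n :: 'k mat)"
    then have ab: "a < n" "b < n" by simp_all
    have "lin n (\<lambda>b. (?N ^\<^sub>m (n + n)) $$ (a, b)) = 0"
      using pow[OF ab(1), of "n + n"] linear_op_N_nilpotent[of "\<lambda>b. if b = a then 1 else 0"]
      unfolding lin_unit[OF ab(1)] by simp
    then have "(?N ^\<^sub>m (n + n)) $$ (a, b) = 0"
      using mfps_coeff_lin_single[OF ab(2), of "\<lambda>b. (?N ^\<^sub>m (n + n)) $$ (a, b)"] by simp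
    then show "(?N ^\<^sub>m (n + n)) $$ (a, b) = 0\<^sub>m n n $$ (a, b)" using ab by simp
  qed simp_all
qed

end

text \<open>With the series \<open>k\<close> assembled from the \<open>K j\<close> one has
  \<open>H = Phi g k\<close>. As \<open>Phi g\<close> substitutes the new coordinates,
  \<open>H\<close> reads \<open>k\<close> in them and \<open>H_ss\<close> reads \<open>h_ss\<close>;
  both statements about brackets are pulled back along \<open>Phi g\<close>.\<close>

theorem poincare_birkhoff_normal_form:
  assumes H: "H \<in> formal_functions n" "wt_proj W 0 H = 0" "wt_proj W 1 H = 0" "wt_proj W 2 H = h"
  shows "\<exists>\<phi> F Q S. canonical_coordinates l m c P \<phi> \<and>
    vf_in_coordinates n \<phi> (hamiltonian_vf n P H) F \<and>
    is_semisimple_part n (linear_part n F) S \<and>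
    Q \<in> formal_functions n \<and> at_most_quadratic Q \<and>
    vf_in_coordinates n \<phi> (hamiltonian_vf n P (mfps_compose n Q \<phi>)) (linear_vf n S) \<and>
    poisson_bracket n P H (mfps_compose n Q \<phi>) = 0 \<and>
    mfps_compose n Q \<phi> \<in> formal_functions n"
proof -
  obtain g K where g: "\<And>j. homog W (j + 2) (g j)" "\<And>j. g j \<in> formal_functions n"
    and K: "\<And>j. homog W (j + 2) (K j)" "\<And>j. K j \<in> formal_functions n" "\<And>j. pb h_ss (K j) = 0"
    and HK: "\<And>j. wt_proj W (j + 2) H = (\<Sum>a\<le>j. phi g a (K (j - a)))" and K0: "K 0 = h"
    by (rule normal_form_series[OF H(1,4)], rule that)
  define k where "k = Abs_mfps (\<lambda>M. if wt W M \<ge> 2 then mfps_coeff (K (wt W M - 2)) M else 0)"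
  have k: "wt_proj W 0 k = 0" "wt_proj W 1 k = 0" "\<And>j. wt_proj W (j + 2) k = K j"
  proof -
    fix j
    show "wt_proj W (j + 2) k = K j"
    proof (rule mfps_ext)
      fix M
      show "mfps_coeff (wt_proj W (j + 2) k) M = mfps_coeff (K j) M"
        using K(1)[of j] unfolding homog_def by (auto simp: mfps_coeff_wt_proj k_def)
    qed
  qed (rule mfps_ext; simp add: mfps_coeff_wt_proj k_def)+
  have k_formal: "k \<in> formal_functions n"
    using K(2) unfolding formal_functions_def k_def by (auto split: if_splits)
  have weight_cases: "(j = 0 \<or> j = 1) \<or> (\<exists>i. j = i + 2)" for j :: nat
    by (metis One_nat_def add_2_eq_Suc' not0_implies_Suc)
  have k_commutes: "pb h_ss k = 0"
  proof (rule wt_proj_eqI)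
    fix j
    have "pb h_ss (wt_proj W j k) = 0" using weight_cases[of j] k K(3) by auto
    then show "wt_proj W j (pb h_ss k) = wt_proj W j 0" by (simp add: wt_proj_pb_weight_2[OF h_ss(2)])
  qed
  have Phi_k: "Phi g k = H"
  proof (rule wt_proj_eqI)
    fix j
    from weight_cases[of j] show "wt_proj W j (Phi g k) = wt_proj W j H"
    proof
      assume j: "j = 0 \<or> j = 1"
      have "wt_proj W (j - i) k = 0" for i
      proof -
        have "j - i = 0 \<or> j - i = 1" using j by auto
        then show ?thesis using k(1,2) by auto
      qed
      then show ?thesis using j H by (auto simp: wt_proj_Phi[OF g(1)])
    next
      assume "\<exists>i. j = i + 2"
      then obtain i where j: "j = i + 2" ..
      have "wt_proj W j (Phi g k) = (\<Sum>a\<le>j. phi g a (wt_proj W (j - a) k))"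
        by (rule wt_proj_Phi[OF g(1)])
      \<comment> \<open>The two omitted terms involve the parts of \<open>k\<close> of weight 0 and
        1.\<close>
      also have "\<dots> = (\<Sum>a\<le>i. phi g a (wt_proj W (j - a) k))"
      proof (rule sum.mono_neutral_right)
        show "\<forall>a\<in>{..j} - {..i}. phi g a (wt_proj W (j - a) k) = 0"
        proof
          fix a assume "a \<in> {..j} - {..i}"
          then have "j - a = 0 \<or> j - a = 1" using j by auto
          then show "phi g a (wt_proj W (j - a) k) = 0" using k(1,2) by auto
        qed
      qed (auto simp: j)
      also have "\<dots> = (\<Sum>a\<le>i. phi g a (K (i - a)))"
      proof (rule sum.cong[OF refl])
        fix a assume "a \<in> {..i}"
        then have "j - a = (i - a) + 2" using j by auto
        then show "phi g a (wt_proj W (j - a) k) = phi g a (K (i - a))" by (simp only: k(3))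
      qed
      finally show ?thesis by (simp only: j HK)
    qed
  qed
  let ?\<phi> = "\<lambda>a. Phi g (mfps_var a)"
  let ?S = "mat n n (\<lambda>(a, b). S a b)"
  let ?F = "\<lambda>a. pb k (mfps_var a)"
  have comp: "mfps_compose n f ?\<phi> = Phi g f" if "f \<in> formal_functions n" for f
    using Phi_compose[OF g(1) that] by simp
  have "canonical_coordinates l m c P ?\<phi>" by (rule Phi_coordinates[OF g])
  moreover have "vf_in_coordinates n ?\<phi> (hamiltonian_vf n P H) ?F"
    unfolding vf_in_coordinates_def
  proof (intro allI impI conjI)
    fix a assume "a < n"
    then show *: "pb k (mfps_var a) \<in> formal_functions n" by (intro formal_pb k_formal) auto
    show "pb H (Phi g (mfps_var a)) = mfps_compose n (pb k (mfps_var a)) ?\<phi>"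
      by (simp only: comp[OF *] Phi_pb[OF g(1)] flip: Phi_k)
  qed
  moreover have "is_semisimple_part n (linear_part n ?F) ?S"
  proof -
    have "linear_part n ?F = mat n n (\<lambda>(a, b). ham_matrix k a b)"
      by (simp add: linear_part_def ham_matrix_def)
    then show ?thesis
      using semisimple_part[OF k_formal k(1,2) _ k_commutes] k(3)[of 0] K0 by (simp add: numeral_2_eq_2)
  qed
  moreover have "at_most_quadratic h_ss"
    unfolding at_most_quadratic_def
  proof (intro allI impI)
    fix M assume "mfps_coeff h_ss M \<noteq> 0"
    then have "wt W M = 2" using h_ss(2) by (simp add: homog_def)
    then show "size M \<le> 2" using size_le_wt[of W M] by simp
  qed
  moreover have "vf_in_coordinates n ?\<phi> (hamiltonian_vf n P (Phi g h_ss)) (linear_vf n ?S)"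
    unfolding vf_in_coordinates_def
  proof (intro allI impI)
    fix a assume a: "a < n"
    have "linear_vf n ?S a = lin n (S a)"
      unfolding linear_vf_def using a by (simp add: lin_def)
    moreover have "pb (Phi g h_ss) (Phi g (mfps_var a)) = Phi g (lin n (S a))"
      using a by (simp add: Phi_pb[OF g(1)] h_ss(3))
    ultimately show "linear_vf n ?S a \<in> formal_functions n \<and>
        pb (Phi g h_ss) (Phi g (mfps_var a)) = mfps_compose n (linear_vf n ?S a) ?\<phi>"
      by (simp add: comp)
  qed
  moreover have "pb H (Phi g h_ss) = 0"
    using k_commutes pb_skew[of k h_ss] by (simp add: Phi_pb[OF g(1)] flip: Phi_k)
  moreover have "Phi g h_ss \<in> formal_functions n" by (intro Phi_formal g h_ss)
  ultimately show ?thesis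
    using h_ss(1) comp[OF h_ss(1)] by (intro exI[of _ ?\<phi>] exI[of _ ?F] exI[of _ h_ss] exI[of _ ?S]) simp
qed

end

theorem theoremC:
  fixes l m n :: nat
    and scale :: "'k::real_or_complex \<Rightarrow> 'g::ab_group_add \<Rightarrow> 'g"
    and br :: "'g \<Rightarrow> 'g \<Rightarrow> 'g"
    and e :: "nat \<Rightarrow> 'g"
    and c :: "nat \<Rightarrow> nat \<Rightarrow> nat \<Rightarrow> 'k"
    and P :: "'k bivector"
    and H :: "'k mfps"
  assumes n: "n = 2 * l + m"
    and lie: "lie_algebra scale br"
    and semisimple: "lie_algebra.semisimple scale br"
    and constants: "lie_algebra.structure_constants scale br m e c"
    and P: "P = canonical_bivector l m c"
    and H: "H \<in> formal_functions n"
    and H_0: "mfps_coeff H {#} = 0"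
    and X_H_0: "\<forall>a<n. mfps_coeff (hamiltonian_vf n P H (mfps_var a)) {#} = 0"
  shows "\<exists>\<phi> F Q S. canonical_coordinates l m c P \<phi> \<and>
    vf_in_coordinates n \<phi> (hamiltonian_vf n P H) F \<and>
    is_semisimple_part n (linear_part n F) S \<and>
    Q \<in> formal_functions n \<and> at_most_quadratic Q \<and>
    (let H_ss = mfps_compose n Q \<phi> in
      vf_in_coordinates n \<phi> (hamiltonian_vf n P H_ss) (linear_vf n S) \<and>
      poisson_bracket n P H H_ss = 0) \<and>
    (\<exists>G \<in> formal_functions n. vf_in_coordinates n \<phi> (hamiltonian_vf n P G) (linear_vf n S))"
proof -
  interpret L: lie_algebra scale br by (rule lie)
  interpret SL: semisimple_lie_poisson scale br l m e c
    by unfold_locales (rule constants semisimple)+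
  have H': "H \<in> formal_functions (2*l + m)" using H n by simp
  interpret N: weight_2_hamiltonian scale br l m e c "wt_proj SL.W 2 H"
    by unfold_locales (auto intro: H')
  have "wt_proj SL.W 0 H = 0" by (simp add: SL.wt_proj_0 H_0 mfps_const_simps)
  \<comment> \<open>A monomial of weight 1 is a single symplectic variable. Its coefficient is, up
    to sign, the constant term of the component of the field at the conjugate variable, which is 0
    by \<open>X_H_0\<close>.\<close>
  moreover have "wt_proj SL.W 1 H = 0"
  proof (rule mfps_ext)
    fix M
    have "mfps_coeff H M = 0" if M: "wt SL.W M = 1"
    proof -
      obtain b where b: "M = {#b#}" "SL.W b = 1"
        using M size_le_wt[of SL.W M] by (cases M) auto
      then have b2: "b < 2*l" by (auto simp: SL.W_def split: if_splits)
      let ?d = "if b < l then l + b else b - l"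
      have "mfps_coeff (SL.pb H (mfps_var ?d)) {#} = 0"
        using X_H_0 b2 unfolding n P by auto
      then have "mfps_coeff (mfps_deriv b H) {#} = 0"
        unfolding SL.pb_var_dual[OF b2] by (auto simp: mfps_coeff_one split: if_splits)
      then show ?thesis by (simp add: mfps_coeff_deriv b(1))
    qed
    then show "mfps_coeff (wt_proj SL.W 1 H) M = mfps_coeff 0 M" by (simp add: mfps_coeff_wt_proj)
  qed
  ultimately obtain \<phi> F Q S where "canonical_coordinates l m c P \<phi>"
    "vf_in_coordinates n \<phi> (hamiltonian_vf n P H) F" "is_semisimple_part n (linear_part n F) S"
    "Q \<in> formal_functions n" "at_most_quadratic Q"
    "vf_in_coordinates n \<phi> (hamiltonian_vf n P (mfps_compose n Q \<phi>)) (linear_vf n S)"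
    "poisson_bracket n P H (mfps_compose n Q \<phi>) = 0"
    "mfps_compose n Q \<phi> \<in> formal_functions n"
    using N.poincare_birkhoff_normal_form[OF H'] unfolding n P by blast
  \<comment> \<open>The witness for \<open>G\<close> is \<open>H_ss\<close> itself.\<close>
  then show ?thesis unfolding Let_def by blast
qed

end
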